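(* Let $d\ge0$ be an integer, let $F=\langle x,y,z_1,\dots,z_d\mid\ \rangle$ be the free group of rank $d+2$, let $u$ and $r$ be elements of $F$ with $u\in\langle z_1,\dots,z_d\rangle$, let $S=\langle x,y,z_1,\dots,z_d\mid[x,y]u\rangle$ and $G=\langle x,y,z_1,\dots,z_d\mid[x,y]u,\ r\rangle$. Then there exist an element $w$ of $F$, an element $v$ of the normal closure of $[x,y]u$ in $F$, and an automorphism $\alpha$ of the free group $\langle x,y\mid\ \rangle$ which fixes $[x,y]$ (extended to $F$ by fixing $z_1,\dots,z_d$), such that $$r'=v\cdot w\,\alpha(r)\,w^{-1}$$ is either a non-negative power of $x$ or a Hempel relator for the presentation $\langle x,y,z_1,\dots,z_d\parallel[x,y]u\rangle$. Here, $G\simeq\langle x,y,z_1,\dots,z_d\mid[x,y]u,\ r'\rangle$ and $\log_Fr'=\log_S(\bar r)$, where $\bar r$ denotes the image of $r$ in $S$.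
   Context: Notation: $[a,b]=aba^{-1}b^{-1}$. Log: for a nontrivial element $g$ of a group $H$ such that $\langle g\rangle$ is contained in a unique maximal infinite cyclic subgroup $D$ of $H$, $\log_Hg=[D:\langle g\rangle]$; and $\log_H1=\infty$. (Every element of $F$ and of $S$ is either trivial or of this kind.) Hempel relator: for $i\in\mathbb{Z}$ and $f\in F$ write ${}^{i}f=y^ify^{-i}$. Let $X_1=\{{}^{1}x\}\cup\{{}^{i}z_j:i\ge0,\ 1\le j\le d\}$, which freely generates a free subgroup $\langle X_1\rangle$ of $F$. An element $r\in F$ is a Hempel relator for the presentation $\langle x,y,z_1,\dots,z_d\parallel[x,y]u\rangle$ if: (R1) $r\in\langle X_1\rangle$; (R2) in $\langle X_1\rangle$, $r$ is not conjugate to any element of the cyclic subgroup $\langle u^{-1}\cdot{}^{1}x\rangle$; (R3) $r$ is cyclically reduced with respect to the free basis $X_1$; (R4) $r$ does not lie in the free factor $\langle\{{}^{1}x\}\cup\{{}^{i}z_j:i\ge1,\ 1\le j\le d\}\rangle$ of $\langle X_1\rangle$. *)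

theory Defs
  imports "HOL-Algebra.Algebra" "HOL-Library.Extended_Nat"
begin

section \<open>Free groups and presentations\<close>

text \<open>A letter \<open>(a, True)\<close> stands for \<open>a\<close>, and \<open>(a, False)\<close> for its inverse.\<close>

type_synonym 'a letter = "'a \<times> bool"

definition inv_letter :: "'a letter \<Rightarrow> 'a letter" where
  "inv_letter l = (fst l, \<not> snd l)"

definition reduced :: "'a letter list \<Rightarrow> bool" where
  "reduced w \<longleftrightarrow> successively (\<lambda>p q. q \<noteq> inv_letter p) w"

definition cyclically_reduced :: "'a letter list \<Rightarrow> bool" where
  "cyclically_reduced w \<longleftrightarrow> reduced w \<and> (w \<noteq> [] \<longrightarrow> hd w \<noteq> inv_letter (last w))"

fun push :: "'a letter \<Rightarrow> 'a letter list \<Rightarrow> 'a letter list" where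
  "push l [] = [l]"
| "push l (m # w) = (if m = inv_letter l then w else l # m # w)"

definition reduce :: "'a letter list \<Rightarrow> 'a letter list" where
  "reduce w = foldr push w []"

definition free_group :: "'a set \<Rightarrow> 'a letter list monoid" where
  "free_group B =
     \<lparr>carrier = {w. reduced w \<and> fst ` set w \<subseteq> B}, monoid.mult = (\<lambda>v w. reduce (v @ w)), one = []\<rparr>"

definition free_gen :: "'a \<Rightarrow> 'a letter list" where
  "free_gen a = [(a, True)]"

definition eval_word :: "('b, 'c) monoid_scheme \<Rightarrow> ('a \<Rightarrow> 'b) \<Rightarrow> 'a letter list \<Rightarrow> 'b" where
  "eval_word G f w =
     foldr (\<lambda>(a, pos) g. (if pos then f a else inv\<^bsub>G\<^esub> (f a)) \<otimes>\<^bsub>G\<^esub> g) w \<one>\<^bsub>G\<^esub>"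

text \<open>The elements of \<open>A\<close> are themselves used as letters here; when \<open>A\<close> freely generates
  a subgroup, the word \<open>w\<close> is the unique reduced expression of \<open>r\<close> in \<open>A\<close>.\<close>

definition cyclically_reduced_wrt :: "('a, 'b) monoid_scheme \<Rightarrow> 'a set \<Rightarrow> 'a \<Rightarrow> bool" where
  "cyclically_reduced_wrt G A r \<longleftrightarrow>
     (\<exists>w. fst ` set w \<subseteq> A \<and> cyclically_reduced w \<and> eval_word G (\<lambda>a. a) w = r)"

definition commutator :: "('a, 'b) monoid_scheme \<Rightarrow> 'a \<Rightarrow> 'a \<Rightarrow> 'a" where
  "commutator G a b = a \<otimes>\<^bsub>G\<^esub> b \<otimes>\<^bsub>G\<^esub> inv\<^bsub>G\<^esub> a \<otimes>\<^bsub>G\<^esub> inv\<^bsub>G\<^esub> b"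

definition normal_closure :: "('a, 'b) monoid_scheme \<Rightarrow> 'a set \<Rightarrow> 'a set" where
  "normal_closure G R = \<Inter>{N. N \<lhd> G \<and> R \<subseteq> N}"

definition presented_group :: "'a set \<Rightarrow> 'a letter list set \<Rightarrow> 'a letter list set monoid" where
  "presented_group B R = free_group B Mod normal_closure (free_group B) R"

definition image_in_presented :: "'a set \<Rightarrow> 'a letter list set \<Rightarrow> 'a letter list \<Rightarrow> 'a letter list set" where
  "image_in_presented B R w = normal_closure (free_group B) R #>\<^bsub>free_group B\<^esub> w"


subsection \<open>The group axioms\<close>

lemma inv_letter_inv [simp]: "inv_letter (inv_letter l) = l"
  by (simp add: inv_letter_def)

lemma fst_inv_letter [simp]: "fst (inv_letter l) = fst l"
  by (simp add: inv_letter_def)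

lemma reduced_push: "reduced w \<Longrightarrow> reduced (push l w)"
  by (cases w) (auto simp: reduced_def successively_Cons)

lemma reduced_foldr_push: "reduced w \<Longrightarrow> reduced (foldr push v w)"
  by (induction v) (auto intro: reduced_push)

lemma set_push: "set (push l w) \<subseteq> insert l (set w)"
  by (cases w) auto

lemma set_foldr_push: "set (foldr push v w) \<subseteq> set v \<union> set w"
proof (induction v)
  case (Cons l v)
  then show ?case using set_push[of l "foldr push v w"] by auto
qed simp

lemma push_cancel:
  assumes "reduced w"
  shows "push l (push (inv_letter l) w) = w"
proof (cases w)
  case (Cons m v)
  then show ?thesis using assms
    by (cases v) (auto simp: reduced_def successively_Cons)
qed simp

lemma foldr_push_push:
  assumes "reduced w"
  shows "foldr push (push l v) w = push l (foldr push v w)"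
proof (cases v)
  case (Cons m v')
  then show ?thesis using assms by (auto simp: push_cancel reduced_foldr_push)
qed simp

lemma foldr_push_foldr_push:
  assumes "reduced w"
  shows "foldr push (foldr push u v) w = foldr push u (foldr push v w)"
  by (induction u) (simp_all add: foldr_push_push assms)

lemma foldr_push_reduced: "reduced w \<Longrightarrow> foldr push w [] = w"
proof (induction w)
  case (Cons l w)
  then have "reduced w" by (auto simp: reduced_def successively_Cons)
  with Cons show ?case by (cases w) (auto simp: reduced_def)
qed simp

lemma foldr_push_inv: "reduced w \<Longrightarrow> foldr push (map inv_letter (rev v)) (foldr push v w) = w"
proof (induction v)
  case (Cons l v)
  then show ?case using push_cancel[of "foldr push v w" "inv_letter l"]
    by (simp add: reduced_foldr_push)
qed simp

lemma reduced_inv: "reduced w \<Longrightarrow> reduced (map inv_letter (rev w))"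
  unfolding reduced_def by (auto simp: successively_map intro: successively_mono)

theorem group_free_group: "group (free_group B)"
proof (rule groupI)
  let ?F = "free_group B"
  have mult: "v \<otimes>\<^bsub>?F\<^esub> w = foldr push v w" if "w \<in> carrier ?F" for v w
    using that by (simp add: free_group_def reduce_def foldr_push_reduced)
  have reduced: "reduced w" if "w \<in> carrier ?F" for w
    using that by (simp add: free_group_def)
  show closed: "v \<otimes>\<^bsub>?F\<^esub> w \<in> carrier ?F" if "v \<in> carrier ?F" "w \<in> carrier ?F" for v w
    using that set_foldr_push[of v w] unfolding mult[OF that(2)]
    by (fastforce simp: free_group_def reduced_foldr_push)
  show "\<one>\<^bsub>?F\<^esub> \<in> carrier ?F"
    by (simp add: free_group_def reduced_def)
  show "u \<otimes>\<^bsub>?F\<^esub> v \<otimes>\<^bsub>?F\<^esub> w = u \<otimes>\<^bsub>?F\<^esub> (v \<otimes>\<^bsub>?F\<^esub> w)"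
    if "u \<in> carrier ?F" "v \<in> carrier ?F" "w \<in> carrier ?F" for u v w
    using that closed[OF that(2,3)] by (simp add: mult foldr_push_foldr_push reduced)
  show "\<one>\<^bsub>?F\<^esub> \<otimes>\<^bsub>?F\<^esub> w = w" if "w \<in> carrier ?F" for w
    using that by (simp add: mult) (simp add: free_group_def)
  show "\<exists>v\<in>carrier ?F. v \<otimes>\<^bsub>?F\<^esub> w = \<one>\<^bsub>?F\<^esub>" if "w \<in> carrier ?F" for w
  proof
    show "map inv_letter (rev w) \<in> carrier ?F"
      using that by (force simp: free_group_def reduced_inv)
    show "map inv_letter (rev w) \<otimes>\<^bsub>?F\<^esub> w = \<one>\<^bsub>?F\<^esub>"
      using foldr_push_inv[of "[]" w] that
      by (simp add: mult foldr_push_reduced reduced) (simp add: free_group_def reduced_def)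
  qed
qed


section \<open>Logarithms of group elements\<close>

definition infinite_cyclic_subgroup :: "'a set \<Rightarrow> ('a, 'b) monoid_scheme \<Rightarrow> bool" where
  "infinite_cyclic_subgroup D H \<longleftrightarrow>
     subgroup D H \<and> cyclic_group (H\<lparr>carrier := D\<rparr>) \<and> infinite D"

definition maximal_infinite_cyclic_subgroup :: "'a set \<Rightarrow> ('a, 'b) monoid_scheme \<Rightarrow> bool" where
  "maximal_infinite_cyclic_subgroup D H \<longleftrightarrow>
     infinite_cyclic_subgroup D H \<and>
     (\<forall>E. infinite_cyclic_subgroup E H \<and> D \<subseteq> E \<longrightarrow> E = D)"

text \<open>Meaningful only if \<open>g\<close> is trivial or the cyclic subgroup generated by \<open>g\<close> lies in a unique
  maximal infinite cyclic subgroup; the index is then finite, so \<open>card\<close> is adequate.\<close>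

definition group_log :: "('a, 'b) monoid_scheme \<Rightarrow> 'a \<Rightarrow> enat" where
  "group_log H g =
     (if g = \<one>\<^bsub>H\<^esub> then \<infinity>
      else let D = (THE D. maximal_infinite_cyclic_subgroup D H \<and> generate H {g} \<subseteq> D)
           in enat (card (rcosets\<^bsub>H\<lparr>carrier := D\<rparr>\<^esub> (generate H {g}))))"


section \<open>Hempel relators\<close>

datatype gen = GX | GY | GZ nat

abbreviation x\<^sub>F :: "gen letter list" where "x\<^sub>F \<equiv> free_gen GX"
abbreviation y\<^sub>F :: "gen letter list" where "y\<^sub>F \<equiv> free_gen GY"
abbreviation z\<^sub>F :: "nat \<Rightarrow> gen letter list" where "z\<^sub>F j \<equiv> free_gen (GZ j)"

definition gens :: "nat \<Rightarrow> gen set" where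
  "gens d = {GX, GY} \<union> GZ ` {1..d}"

definition freeF :: "nat \<Rightarrow> gen letter list monoid" where
  "freeF d = free_group (gens d)"

definition freeFxy :: "gen letter list monoid" where
  "freeFxy = free_group {GX, GY}"

definition surface_relator :: "nat \<Rightarrow> gen letter list \<Rightarrow> gen letter list" where
  "surface_relator d u = commutator (freeF d) x\<^sub>F y\<^sub>F \<otimes>\<^bsub>freeF d\<^esub> u"

text \<open>The endomorphism of \<open>freeF d\<close> that agrees with \<open>\<alpha>\<close> on \<open>freeFxy\<close> and fixes every \<open>z\<^sub>F j\<close>.\<close>

definition extend_to_F :: "nat \<Rightarrow> (gen letter list \<Rightarrow> gen letter list) \<Rightarrow>
    gen letter list \<Rightarrow> gen letter list" where
  "extend_to_F d \<alpha> =
     eval_word (freeF d) (\<lambda>g. case g of GX \<Rightarrow> \<alpha> x\<^sub>F | GY \<Rightarrow> \<alpha> y\<^sub>F | GZ j \<Rightarrow> z\<^sub>F j)"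

definition y_conj :: "nat \<Rightarrow> int \<Rightarrow> gen letter list \<Rightarrow> gen letter list" where
  "y_conj d i f = y\<^sub>F [^]\<^bsub>freeF d\<^esub> i \<otimes>\<^bsub>freeF d\<^esub> f \<otimes>\<^bsub>freeF d\<^esub> y\<^sub>F [^]\<^bsub>freeF d\<^esub> (- i)"

definition X1 :: "nat \<Rightarrow> gen letter list set" where
  "X1 d = {y_conj d 1 x\<^sub>F} \<union> {y_conj d i (z\<^sub>F j) | i j. i \<ge> 0 \<and> 1 \<le> j \<and> j \<le> d}"

definition X1_upper :: "nat \<Rightarrow> gen letter list set" where
  "X1_upper d = {y_conj d 1 x\<^sub>F} \<union> {y_conj d i (z\<^sub>F j) | i j. i \<ge> 1 \<and> 1 \<le> j \<and> j \<le> d}"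

text \<open>\<open>X1 d\<close> freely generates the subgroup it generates, of which \<open>X1_upper d\<close> generates
  the free factor omitting the letters \<open>y_conj d 0 (z\<^sub>F j)\<close>.\<close>

definition hempel_relator :: "nat \<Rightarrow> gen letter list \<Rightarrow> gen letter list \<Rightarrow> bool" where
  "hempel_relator d u r \<longleftrightarrow>
     r \<in> generate (freeF d) (X1 d) \<and>
     \<not> (\<exists>g \<in> generate (freeF d) (X1 d).
          \<exists>c \<in> generate (freeF d) {inv\<^bsub>freeF d\<^esub> u \<otimes>\<^bsub>freeF d\<^esub> y_conj d 1 x\<^sub>F}.
            r = g \<otimes>\<^bsub>freeF d\<^esub> c \<otimes>\<^bsub>freeF d\<^esub> inv\<^bsub>freeF d\<^esub> g) \<and>
     cyclically_reduced_wrt (freeF d) (X1 d) r \<and>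
     r \<notin> generate (freeF d) (X1_upper d)"

end

theory Submission
  imports Defs
begin

text \<open>Some automorphism of \<open>\<langle>x, y\<rangle>\<close> that fixes \<open>[x, y]\<close> makes the exponent sum of \<open>y\<close> in \<open>r\<close> zero
  and that of \<open>x\<close> nonnegative (Euclid's algorithm). The group \<open>S\<close> is the mapping torus of an
  automorphism \<open>\<phi>\<close> (conjugation by \<open>y\<close>) of the free group on \<open>y x y\<inverse>\<close> and all \<open>y\<^sup>i z\<^sub>j y\<^sup>-\<^sup>i\<close>, and the
  image of \<open>r\<close> now lies in this free group. Conjugate by a power of \<open>y\<close> so that only indices
  \<open>i \<ge> 0\<close> occur, and reduce cyclically. As long as no letter of index \<open>0\<close> occurs, conjugating by
  \<open>y\<inverse>\<close> keeps the indices nonnegative and lowers their upper bound, so the process ends either at a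
  power of \<open>x\<close> or at a Hempel relator. For the logarithms, the root of an element of the free
  kernel inside that kernel lifts to a root in \<open>F\<close>, because roots in free groups are unique.\<close>

section \<open>Logarithms and roots\<close>

text \<open>Conjugacy and roots are hard to see in a quotient by a normal closure, so they are
  studied in \<open>T\<close>, a concrete model of S. The way back to F is a homomorphism
  \<open>s\<close> from the free kernel \<open>K\<close> to F with
  \<open>\<psi> (s b) = (b, 0)\<close>: a normal form found in \<open>K\<close> becomes an actual
  element of F, and v is the quotient of two elements of F with the same image under
  \<open>\<psi>\<close>, whose kernel is exactly the normal closure of the relator. The relator says
  y x y^-1 = u x, so x itself becomes the word u^-1 (y x y^-1) over the kernel basis. Hence a
  failure of R2 means conjugacy in S to a power of x, which is the other alternative. The exponent
  of that power is nonnegative because the exponent sum of x vanishes on the relator and is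
  therefore the same for r' and for \<alpha>(r). \<open>max_root\<close> is a certificate for a
  logarithm that can be moved between groups: it is produced in \<open>K\<close> from the
  combinatorics of words, passes to \<open>T\<close> because roots of level-zero elements have level
  zero, and is pulled back to F along \<open>\<psi>\<close>.\<close>

definition max_root :: "('a, 'b) monoid_scheme \<Rightarrow> 'a \<Rightarrow> 'a \<Rightarrow> nat \<Rightarrow> bool" where
  "max_root G g c n \<longleftrightarrow> c \<in> carrier G \<and> n > 0 \<and> c [^]\<^bsub>G\<^esub> n = g \<and>
     (\<forall>m::int. c [^]\<^bsub>G\<^esub> m = \<one>\<^bsub>G\<^esub> \<longrightarrow> m = 0) \<and>
     (\<forall>e \<in> carrier G. \<forall>k::nat. k > 0 \<and> e [^]\<^bsub>G\<^esub> k = g \<longrightarrow> (\<exists>m::int. e = c [^]\<^bsub>G\<^esub> m))"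

context group
begin

lemma int_pow_inj:
  assumes "c \<in> carrier G" "\<And>m::int. c [^] m = \<one> \<Longrightarrow> m = 0" "c [^] i = c [^] (j::int)"
  shows "i = j"
proof -
  have "c [^] (i - j) = \<one>"
    using assms by (simp add: int_pow_diff)
  then show ?thesis using assms(2) by fastforce
qed

lemma infinite_cyclic_subgroup_iff:
  "infinite_cyclic_subgroup D G \<longleftrightarrow>
     (\<exists>e \<in> carrier G. D = generate G {e} \<and> (\<forall>m::int. e [^] m = \<one> \<longrightarrow> m = 0))"
proof
  assume D: "infinite_cyclic_subgroup D G"
  then have sub: "subgroup D G" and inf: "infinite D"
    and cyc: "cyclic_group (G\<lparr>carrier := D\<rparr>)"
    by (auto simp: infinite_cyclic_subgroup_def)
  interpret H: group "G\<lparr>carrier := D\<rparr>"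
    using sub by (rule subgroup_imp_group)
  obtain e where e: "e \<in> D" "D = range (\<lambda>n::int. e [^]\<^bsub>G\<lparr>carrier := D\<rparr>\<^esub> n)"
    using cyc unfolding H.cyclic_group by auto
  then have D_eq: "D = range (\<lambda>n::int. e [^] n)"
    using int_pow_consistent[OF sub e(1)] by simp
  have eG: "e \<in> carrier G"
    using sub e(1) subgroup.mem_carrier by fast
  have "m = 0" if m: "e [^] m = \<one>" for m :: int
  proof (rule ccontr)
    assume "m \<noteq> 0"
    \<comment> \<open>If e^m = 1 with m nonzero, exponents may be reduced modulo |m|, which leaves
      finitely many elements in D.\<close>
    have "e [^] n \<in> (\<lambda>n. e [^] n) ` {0..<\<bar>m\<bar>}" for n :: int
    proof
      have abs: "e [^] \<bar>m\<bar> = \<one>"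
        using m eG by (cases "m \<ge> 0") (auto simp: int_pow_neg)
      have "e [^] n = e [^] (\<bar>m\<bar> * (n div \<bar>m\<bar>) + n mod \<bar>m\<bar>)" by simp
      also have "\<dots> = e [^] (\<bar>m\<bar> * (n div \<bar>m\<bar>)) \<otimes> e [^] (n mod \<bar>m\<bar>)"
        using eG by (rule int_pow_mult)
      also have "e [^] (\<bar>m\<bar> * (n div \<bar>m\<bar>)) = \<one>"
        using eG abs int_pow_pow[OF eG, of "\<bar>m\<bar>" "n div \<bar>m\<bar>"] by simp
      finally show "e [^] n = e [^] (n mod \<bar>m\<bar>)" using eG by simp
      show "n mod \<bar>m\<bar> \<in> {0..<\<bar>m\<bar>}" using \<open>m \<noteq> 0\<close> by simp
    qed
    then have "D \<subseteq> (\<lambda>n. e [^] n) ` {0..<\<bar>m\<bar>}" unfolding D_eq by auto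
    then show False using inf finite_surj by blast
  qed
  moreover have "D = generate G {e}"
    unfolding D_eq generate_pow[OF eG] by auto
  ultimately show "\<exists>e \<in> carrier G. D = generate G {e} \<and> (\<forall>m::int. e [^] m = \<one> \<longrightarrow> m = 0)"
    using eG by auto
next
  assume "\<exists>e \<in> carrier G. D = generate G {e} \<and> (\<forall>m::int. e [^] m = \<one> \<longrightarrow> m = 0)"
  then obtain e where eG: "e \<in> carrier G" and D: "D = generate G {e}"
    and inf: "\<And>m::int. e [^] m = \<one> \<Longrightarrow> m = 0" by auto
  have sub: "subgroup D G" using eG D by (auto intro: generate_is_subgroup)
  have D_eq: "D = range (\<lambda>n::int. e [^] n)" using D generate_pow[OF eG] by auto
  have "e \<in> D" using D by (auto intro: generate.incl)
  interpret H: group "G\<lparr>carrier := D\<rparr>"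
    using sub by (rule subgroup_imp_group)
  have "inj (\<lambda>n::int. e [^] n)"
    using int_pow_inj[OF eG inf] by (auto intro!: injI)
  then have "infinite D"
    unfolding D_eq using range_inj_infinite infinite_UNIV_int finite_imageD by blast
  moreover have "cyclic_group (G\<lparr>carrier := D\<rparr>)"
    unfolding H.cyclic_group
  proof
    show "e \<in> carrier (G\<lparr>carrier := D\<rparr>)" using \<open>e \<in> D\<close> by simp
    show "carrier (G\<lparr>carrier := D\<rparr>) = range (\<lambda>n::int. e [^]\<^bsub>G\<lparr>carrier := D\<rparr>\<^esub> n)"
      using D_eq int_pow_consistent[OF sub \<open>e \<in> D\<close>] by simp
  qed
  ultimately show "infinite_cyclic_subgroup D G"
    using sub by (simp add: infinite_cyclic_subgroup_def)
qed

text \<open>The subgroup generated by c is not merely maximal: it contains every infinite cyclic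
  subgroup through g, since a generator of such a subgroup is, up to inversion, a root of g. This
  gives the \<open>THE\<close> in \<open>group_log\<close> a unique value. The cosets then
  correspond to the exponents of c modulo n.\<close>

lemma group_log_eq_max_root:
  assumes "max_root G g c n"
  shows "group_log G g = enat n"
proof -
  have cG: "c \<in> carrier G" and n: "n > 0" and cn: "c [^] n = g"
    and inf: "\<And>m::int. c [^] m = \<one> \<Longrightarrow> m = 0"
    and root: "\<And>e k. e \<in> carrier G \<Longrightarrow> (k::nat) > 0 \<Longrightarrow> e [^] k = g \<Longrightarrow> \<exists>m::int. e = c [^] m"
    using assms unfolding max_root_def by auto
  have cni: "c [^] (int n) = g" using cn by (simp add: int_pow_int)
  have gG: "g \<in> carrier G" using cG cn by auto
  have g1: "g \<noteq> \<one>" using inf[of "int n"] cni n by auto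
  define C where "C = generate G {c}"
  have C_eq: "C = range (\<lambda>k::int. c [^] k)" unfolding C_def generate_pow[OF cG] by auto
  have gen_g: "generate G {g} = range (\<lambda>k::int. g [^] k)" using generate_pow[OF gG] by auto
  have C_inf: "infinite_cyclic_subgroup C G"
    unfolding infinite_cyclic_subgroup_iff C_def using cG inf by auto
  have Csub: "subgroup C G" unfolding C_def using cG by (auto intro: generate_is_subgroup)
  have greatest: "E \<subseteq> C" if E: "infinite_cyclic_subgroup E G" "generate G {g} \<subseteq> E" for E
  proof -
    obtain e where e: "e \<in> carrier G" "E = generate G {e}"
      using E(1) unfolding infinite_cyclic_subgroup_iff by auto
    have "g \<in> E" using E(2) by (auto intro: generate.incl)
    then obtain k :: int where k: "g = e [^] k" unfolding e(2) generate_pow[OF e(1)] by blast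
    have "e \<in> C"
    proof (cases "k > 0")
      case True
      then have "e [^] nat k = g" using k by simp
      then show ?thesis using root[OF e(1), of "nat k"] True C_eq by auto
    next
      case False
      \<comment> \<open>\<open>max_root\<close> speaks of positive exponents only, so for negative k
        the inverse of e takes the place of e.\<close>
      have "k \<noteq> 0" using k g1 by (metis int_pow_0)
      then have "(inv e) [^] nat (- k) = g" using k False e(1) by (simp add: int_pow_inv int_pow_neg)
      then have "inv e \<in> C" using root[of "inv e" "nat (- k)"] False \<open>k \<noteq> 0\<close> C_eq e(1) by auto
      then have "inv (inv e) \<in> C" using Csub by (metis subgroup.m_inv_closed)
      then show ?thesis using e(1) by simp
    qed
    then show ?thesis using e(2) Csub generate_subgroup_incl[of "{e}" C] by auto
  qed
  have gC: "g \<in> C" unfolding C_eq using cni by force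
  have genC: "generate G {g} \<subseteq> C"
    using generate_subgroup_incl[of "{g}" C] gC Csub by auto
  have the: "(THE D. maximal_infinite_cyclic_subgroup D G \<and> generate G {g} \<subseteq> D) = C"
  proof (rule the_equality)
    show "maximal_infinite_cyclic_subgroup C G \<and> generate G {g} \<subseteq> C"
      unfolding maximal_infinite_cyclic_subgroup_def
      using C_inf genC greatest by blast
    show "D = C" if "maximal_infinite_cyclic_subgroup D G \<and> generate G {g} \<subseteq> D" for D
      using that greatest[of D] C_inf unfolding maximal_infinite_cyclic_subgroup_def by blast
  qed
  define K where "K = G\<lparr>carrier := C\<rparr>"
  \<comment> \<open>\<open>f j\<close> is the coset of c^j: the powers of c with exponent congruent
    to j modulo n.\<close>
  define f where "f = (\<lambda>j::int. range (\<lambda>k::int. c [^] (int n * k + j)))"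
  have coset: "generate G {g} #>\<^bsub>K\<^esub> (c [^] j) = f j" for j :: int
  proof -
    have "g [^] k \<otimes> c [^] j = c [^] (int n * k + j)" for k :: int
      using cG int_pow_pow[OF cG, of "int n" k] by (simp add: cni[symmetric] int_pow_mult)
    then show ?thesis
      unfolding r_coset_def K_def gen_g f_def by auto
  qed
  have "rcosets\<^bsub>K\<^esub> (generate G {g}) = range f"
    unfolding RCOSETS_def using coset by (auto simp: K_def C_eq)
  also have "\<dots> = f ` {0..<int n}"
  proof -
    have "f j = f (j mod int n)" for j
    proof -
      have *: "int n * k + j = int n * (k + j div int n) + j mod int n" for k
        by (simp add: algebra_simps)
      have "int n * k + j mod int n = int n * (k - j div int n) + j" for k
        by (simp add: algebra_simps minus_mult_div_eq_mod [symmetric])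
      then have "f (j mod int n) \<subseteq> f j" unfolding f_def by auto
      moreover have "f j \<subseteq> f (j mod int n)"
      proof
        fix a assume "a \<in> f j"
        then obtain k where "a = c [^] (int n * k + j)" unfolding f_def by auto
        then have "a = c [^] (int n * (k + j div int n) + j mod int n)" using *[of k] by simp
        then show "a \<in> f (j mod int n)" unfolding f_def by blast
      qed
      ultimately show ?thesis by blast
    qed
    moreover have "j mod int n \<in> {0..<int n}" for j using n by auto
    ultimately have "f j \<in> f ` {0..<int n}" for j by (metis imageI)
    then show ?thesis by auto
  qed
  finally have rc: "rcosets\<^bsub>K\<^esub> (generate G {g}) = f ` {0..<int n}" .
  have "inj_on f {0..<int n}"
  proof (rule inj_onI)
    fix i j assume ij: "i \<in> {0..<int n}" "j \<in> {0..<int n}" "f i = f j"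
    have "c [^] i = c [^] (int n * 0 + i)" by simp
    then have "c [^] i \<in> f i" unfolding f_def by blast
    then have "c [^] i \<in> f j" using ij(3) by simp
    then obtain k where "c [^] i = c [^] (int n * k + j)" unfolding f_def by auto
    then have "i = int n * k + j" using int_pow_inj[OF cG inf] by blast
    then have "i mod int n = j mod int n" by simp
    then show "i = j" using ij by simp
  qed
  then have "card (rcosets\<^bsub>K\<^esub> (generate G {g})) = n"
    using rc by (simp add: card_image)
  then show ?thesis
    using g1 by (simp add: group_log_def the K_def)
qed

section \<open>Roots under conjugation\<close>

lemma cancel_left_inv:
  assumes "p \<in> carrier G" "z \<in> carrier G"
  shows "inv p \<otimes> (p \<otimes> z) = z" "p \<otimes> (inv p \<otimes> z) = z"
  using assms by (simp_all flip: m_assoc)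

lemma conj_hom:
  assumes "p \<in> carrier G"
  shows "(\<lambda>x. p \<otimes> x \<otimes> inv p) \<in> hom G G"
  using assms by (simp add: hom_def m_assoc cancel_left_inv)

lemma max_root_conj:
  assumes "max_root G g c n" "p \<in> carrier G"
  shows "max_root G (p \<otimes> g \<otimes> inv p) (p \<otimes> c \<otimes> inv p) n"
proof -
  define f where "f = (\<lambda>p x. p \<otimes> x \<otimes> inv p)"
  have hom: "group_hom G G (f p)" if "p \<in> carrier G" for p
    using conj_hom[OF that] by (simp add: f_def group_hom_def group_hom_axioms_def is_group)
  have powf: "f p (x [^] k) = (f p x) [^] k" "f p (x [^] m) = (f p x) [^] m"
    if "p \<in> carrier G" "x \<in> carrier G" for p x and k :: nat and m :: int
    using group_hom.hom_nat_pow[OF hom] group_hom.hom_int_pow[OF hom] that by auto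
  have inv_f: "f (inv p) (f p x) = x" "f p (f (inv p) x) = x" if "x \<in> carrier G" for x
    using assms(2) that by (simp_all add: f_def m_assoc cancel_left_inv)
  have fcl: "f p x \<in> carrier G" "f (inv p) x \<in> carrier G"
    if "x \<in> carrier G" for x
    using assms that by (auto simp: max_root_def f_def)
  have cG: "c \<in> carrier G" using assms by (auto simp: max_root_def)
  have "\<exists>m::int. e = f p c [^] m" if e: "e \<in> carrier G" "0 < (k::nat)" "e [^] k = f p g" for e k
  proof -
    have gG: "g \<in> carrier G" using assms by (auto simp: max_root_def)
    have "f (inv p) e [^] k = g"
      using e inv_f(1)[OF gG] powf(1)[of "inv p" e k] assms by auto
    then obtain m :: int where "f (inv p) e = c [^] m"
      using assms(1) e fcl unfolding max_root_def by metis
    then have "e = f p c [^] m" using inv_f(2)[OF e(1)] powf(2)[OF assms(2) cG, of m] by simp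
    then show ?thesis by blast
  qed
  moreover have "m = 0" if "f p c [^] m = \<one>" for m :: int
  proof -
    have "f p (c [^] m) = \<one>" using that powf assms cG by simp
    then have "c [^] m = f (inv p) \<one>" using inv_f(1)[of "c [^] m"] cG by simp
    also have "\<dots> = \<one>" using assms by (simp add: f_def)
    finally show ?thesis using assms(1) by (auto simp: max_root_def)
  qed
  ultimately have "max_root G (f p g) (f p c) n"
    using assms powf(1)[OF assms(2) cG] fcl unfolding max_root_def by auto
  then show ?thesis by (simp add: f_def)
qed

end

text \<open>A root e of g maps to some power (h c)^m. Since h c has infinite order, comparing
  exponents gives m k = n, so e and c^m are both k-th roots of g and agree by \<open>unique\<close>.
  In the application h is \<open>\<psi>\<close>, and F has unique roots because it is free.\<close>

lemma max_root_pullback: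
  assumes h: "group_hom G H h"
    and root: "max_root H (h g) (h c) n" and c: "c \<in> carrier G" and cn: "c [^]\<^bsub>G\<^esub> n = g"
    and unique: "\<And>e f k. e \<in> carrier G \<Longrightarrow> f \<in> carrier G \<Longrightarrow> (k::nat) > 0 \<Longrightarrow>
        e [^]\<^bsub>G\<^esub> k = f [^]\<^bsub>G\<^esub> k \<Longrightarrow> e = f"
  shows "max_root G g c n"
proof -
  interpret group_hom G H h by (rule h)
  have n: "n > 0" using root by (simp add: max_root_def)
  have "m = 0" if "c [^]\<^bsub>G\<^esub> m = \<one>\<^bsub>G\<^esub>" for m :: int
  proof -
    have "h c [^]\<^bsub>H\<^esub> m = \<one>\<^bsub>H\<^esub>" using hom_int_pow[OF c, of m] that by simp
    then show ?thesis using root by (auto simp: max_root_def)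
  qed
  moreover have "\<exists>m::int. e = c [^]\<^bsub>G\<^esub> m"
    if e: "e \<in> carrier G" "0 < (k::nat)" "e [^]\<^bsub>G\<^esub> k = g" for e k
  proof -
    have "h e [^]\<^bsub>H\<^esub> k = h g" using e hom_nat_pow[OF e(1), of k] by simp
    then obtain m :: int where m: "h e = h c [^]\<^bsub>H\<^esub> m"
      using root e unfolding max_root_def by (metis hom_closed)
    have "h c [^]\<^bsub>H\<^esub> (m * int k) = h c [^]\<^bsub>H\<^esub> (int n)"
      using \<open>h e [^]\<^bsub>H\<^esub> k = h g\<close> m c H.int_pow_pow[of "h c" m "int k"] root
      by (simp add: int_pow_int max_root_def)
    then have mk: "m * int k = int n"
      using H.int_pow_inj[of "h c"] root unfolding max_root_def by blast
    have "(c [^]\<^bsub>G\<^esub> m) [^]\<^bsub>G\<^esub> k = c [^]\<^bsub>G\<^esub> (m * int k)"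
      using G.int_pow_pow[OF c, of m "int k"] by (simp add: int_pow_int)
    also have "\<dots> = g" using mk cn by (simp add: int_pow_int)
    finally have "e = c [^]\<^bsub>G\<^esub> m" using unique[OF e(1) _ e(2)] e(3) c by auto
    then show ?thesis ..
  qed
  ultimately show ?thesis using c n cn by (auto simp: max_root_def)
qed

text \<open>This is how S gets its logarithm from \<open>T\<close>: an isomorphism pulls a maximal
  root back.\<close>

lemma group_log_iso:
  assumes h: "h \<in> iso G H" and G: "group G" and H: "group H" and g: "g \<in> carrier G"
    and root: "max_root H (h g) c n"
  shows "group_log G g = enat n"
proof -
  interpret group_hom G H h using h G H by (simp add: group_hom_def group_hom_axioms_def iso_def)
  have bij: "bij_betw h (carrier G) (carrier H)" using h by (simp add: iso_def)
  obtain c' where c': "c' \<in> carrier G" "h c' = c"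
    using bij root unfolding bij_betw_def max_root_def by (metis imageE)
  have inj: "h a = h b \<Longrightarrow> a = b" if "a \<in> carrier G" "b \<in> carrier G" for a b
    using bij that by (auto simp: bij_betw_def inj_on_def)
  have powc: "c' [^]\<^bsub>G\<^esub> n = g" 
    using inj[of "c' [^]\<^bsub>G\<^esub> n" g] c' g root by (auto simp: hom_nat_pow max_root_def)
  have "max_root G g c' n"
    unfolding max_root_def
  proof (intro conjI allI ballI impI)
    show "c' \<in> carrier G" "c' [^]\<^bsub>G\<^esub> n = g" "n > 0"
      using c' powc root by (auto simp: max_root_def)
    fix m :: int assume "c' [^]\<^bsub>G\<^esub> m = \<one>\<^bsub>G\<^esub>"
    then have "c [^]\<^bsub>H\<^esub> m = \<one>\<^bsub>H\<^esub>" using c' hom_int_pow[OF c'(1), of m] by simp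
    then show "m = 0" using root by (auto simp: max_root_def)
  next
    fix e and k :: nat assume e: "e \<in> carrier G" and k: "0 < k \<and> e [^]\<^bsub>G\<^esub> k = g"
    then have "h e [^]\<^bsub>H\<^esub> k = h g" using hom_nat_pow[OF e, of k] by simp
    then obtain m :: int where "h e = c [^]\<^bsub>H\<^esub> m"
      using root e k unfolding max_root_def by (metis hom_closed)
    then have "h e = h (c' [^]\<^bsub>G\<^esub> m)" using c' hom_int_pow[OF c'(1), of m] by simp
    then show "\<exists>m::int. e = c' [^]\<^bsub>G\<^esub> m" using inj[OF e] c' by blast
  qed
  then show ?thesis by (rule G.group_log_eq_max_root)
qed

section \<open>Words and homomorphisms of free groups\<close>

abbreviation inv_word :: "'a letter list \<Rightarrow> 'a letter list" where
  "inv_word w \<equiv> map inv_letter (rev w)"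

abbreviation word_power :: "'a list \<Rightarrow> nat \<Rightarrow> 'a list" where
  "word_power w k \<equiv> concat (replicate k w)"

lemma carrier_free_group:
  "w \<in> carrier (free_group B) \<longleftrightarrow> reduced w \<and> fst ` set w \<subseteq> B"
  by (simp add: free_group_def)

lemma one_free_group [simp]: "\<one>\<^bsub>free_group B\<^esub> = []"
  by (simp add: free_group_def)

lemma mult_free_group: "v \<otimes>\<^bsub>free_group B\<^esub> w = reduce (v @ w)"
  by (simp add: free_group_def)

lemma reduce_reduced: "reduced w \<Longrightarrow> reduce w = w"
  by (simp add: reduce_def foldr_push_reduced)

lemma mult_free_group_eq_append:
  "reduced (v @ w) \<Longrightarrow> v \<otimes>\<^bsub>free_group B\<^esub> w = v @ w"
  by (simp add: mult_free_group reduce_reduced)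

lemma free_gen_closed: "a \<in> B \<Longrightarrow> free_gen a \<in> carrier (free_group B)"
  by (simp add: carrier_free_group free_gen_def reduced_def)

lemma inv_free_group:
  assumes "w \<in> carrier (free_group B)"
  shows "inv\<^bsub>free_group B\<^esub> w = inv_word w"
proof -
  interpret group "free_group B" by (rule group_free_group)
  have "inv_word w \<otimes>\<^bsub>free_group B\<^esub> w = []"
    using foldr_push_inv[of "[]" w] assms
    by (simp add: mult_free_group reduce_def foldr_push_reduced carrier_free_group)
      (simp add: reduced_def)
  moreover have "inv_word w \<in> carrier (free_group B)"
    using assms by (force simp: carrier_free_group reduced_inv)
  ultimately show ?thesis using assms inv_equality by simp
qed

text \<open>Multiplication in \<open>free_group\<close> does not depend on the alphabet, so the free
  group on fewer letters is literally a subset of the larger one. Free factors can therefore be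
  treated as carriers.\<close>

lemma subgroup_free_group:
  assumes "C \<subseteq> B"
  shows "subgroup (carrier (free_group C)) (free_group B)"
proof -
  interpret B: group "free_group B" by (rule group_free_group)
  interpret C: group "free_group C" by (rule group_free_group)
  have sub: "carrier (free_group C) \<subseteq> carrier (free_group B)"
    using assms by (fastforce simp: carrier_free_group)
  show ?thesis
  proof (rule B.subgroupI)
    show "carrier (free_group C) \<noteq> {}" using C.one_closed by blast
    show "inv\<^bsub>free_group B\<^esub> w \<in> carrier (free_group C)" if "w \<in> carrier (free_group C)" for w
      using that sub C.inv_closed[OF that] by (auto simp: inv_free_group subset_eq)
    show "v \<otimes>\<^bsub>free_group B\<^esub> w \<in> carrier (free_group C)"
      if "v \<in> carrier (free_group C)" "w \<in> carrier (free_group C)" for v w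
      using C.m_closed[OF that] by (simp add: mult_free_group)
  qed (rule sub)
qed

lemma reduced_ConsD: "reduced (l # w) \<Longrightarrow> reduced w"
  by (auto simp: reduced_def successively_Cons)

section \<open>Evaluation of words and the universal property\<close>

context group
begin

lemma eval_word_Nil [simp]: "eval_word G f [] = \<one>"
  by (simp add: eval_word_def)

lemma eval_word_Cons [simp]:
  "eval_word G f (l # w) = (if snd l then f (fst l) else inv (f (fst l))) \<otimes> eval_word G f w"
  by (simp add: eval_word_def split: prod.split)

lemma eval_word_in_subgroup:
  "subgroup H G \<Longrightarrow> f ` fst ` set w \<subseteq> H \<Longrightarrow> eval_word G f w \<in> H"
  by (induction w) (auto intro: subgroup.m_closed subgroup.m_inv_closed subgroup.one_closed)

lemma eval_word_closed:
  "f ` fst ` set w \<subseteq> carrier G \<Longrightarrow> eval_word G f w \<in> carrier G"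
  using eval_word_in_subgroup[OF subgroup_self] .

lemma eval_word_append:
  assumes "f ` fst ` set v \<subseteq> carrier G" "f ` fst ` set w \<subseteq> carrier G"
  shows "eval_word G f (v @ w) = eval_word G f v \<otimes> eval_word G f w"
  using assms(1) by (induction v) (auto simp: m_assoc eval_word_closed assms(2))

lemma eval_word_push:
  assumes "f (fst l) \<in> carrier G" "f ` fst ` set w \<subseteq> carrier G"
  shows "eval_word G f (push l w) = eval_word G f (l # w)"
proof (cases w)
  case (Cons m v)
  then show ?thesis
    using assms by (auto simp: inv_letter_def cancel_left_inv eval_word_closed)
qed simp

lemma eval_word_reduce:
  assumes "f ` fst ` set w \<subseteq> carrier G"
  shows "eval_word G f (reduce w) = eval_word G f w"
proof -
  have "eval_word G f (foldr push w []) = eval_word G f w"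
    using assms
  proof (induction w)
    case (Cons l w)
    have "f ` fst ` set (foldr push w []) \<subseteq> carrier G"
      using set_foldr_push[of w "[]"] Cons.prems by fastforce
    then show ?case using Cons by (simp add: eval_word_push)
  qed simp
  then show ?thesis by (simp add: reduce_def)
qed

lemma eval_word_hom:
  assumes "f ` B \<subseteq> carrier G"
  shows "group_hom (free_group B) G (eval_word G f)"
proof -
  have sub: "f ` fst ` set w \<subseteq> carrier G" if "w \<in> carrier (free_group B)" for w
    using that assms by (auto simp: carrier_free_group)
  have "eval_word G f (v \<otimes>\<^bsub>free_group B\<^esub> w) = eval_word G f v \<otimes> eval_word G f w"
    if "v \<in> carrier (free_group B)" "w \<in> carrier (free_group B)" for v w
    using sub that eval_word_reduce[of f "v @ w"]
    by (simp add: mult_free_group image_Un eval_word_append)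
  moreover have "eval_word G f w \<in> carrier G" if "w \<in> carrier (free_group B)" for w
    using sub[OF that] by (rule eval_word_closed)
  ultimately show ?thesis
    by (simp add: group_hom_def group_hom_axioms_def group_free_group is_group hom_def)
qed

lemma eval_word_free_gen [simp]: "f a \<in> carrier G \<Longrightarrow> eval_word G f (free_gen a) = f a"
  by (simp add: free_gen_def)

end

text \<open>The uniqueness half of the universal property; it reduces identities between
  homomorphisms on F and \<open>K\<close> to identities on letters.\<close>

lemma hom_free_group_eq:
  assumes "group_hom (free_group B) G h" "group_hom (free_group B) G k"
    and "\<And>a. a \<in> B \<Longrightarrow> h (free_gen a) = k (free_gen a)" "w \<in> carrier (free_group B)"
  shows "h w = k w"
proof -
  interpret h: group_hom "free_group B" G h by fact
  interpret k: group_hom "free_group B" G k by fact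
  show ?thesis using assms(4)
  proof (induction w)
    case Nil
    then show ?case using h.hom_one k.hom_one by simp
  next
    case (Cons l w)
    obtain a pos where l: "l = (a, pos)" by (cases l)
    have w: "w \<in> carrier (free_group B)" and a: "a \<in> B"
      using Cons.prems l by (auto simp: carrier_free_group dest: reduced_ConsD)
    have l_eq: "[l] = (if pos then free_gen a else inv\<^bsub>free_group B\<^esub> free_gen a)"
      using a inv_free_group[OF free_gen_closed[OF a]]
      by (simp add: l free_gen_def inv_letter_def)
    have "h [l] = k [l]" and lB: "[l] \<in> carrier (free_group B)"
      unfolding l_eq using assms(3)[OF a] a free_gen_closed[OF a] by auto
    moreover have "l # w = [l] \<otimes>\<^bsub>free_group B\<^esub> w"
      using Cons.prems by (simp add: mult_free_group reduce_reduced carrier_free_group)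
    ultimately show ?case using Cons.IH[OF w] w by simp
  qed
qed

lemma (in group) generate_eq_eval_word_image:
  assumes "f ` B \<subseteq> carrier G"
  shows "generate G (f ` B) = eval_word G f ` carrier (free_group B)"
proof
  interpret e: group_hom "free_group B" G "eval_word G f" using assms by (rule eval_word_hom)
  show "generate G (f ` B) \<subseteq> eval_word G f ` carrier (free_group B)"
  proof (rule generate_subgroup_incl)
    show "f ` B \<subseteq> eval_word G f ` carrier (free_group B)"
    proof (rule image_subsetI)
      fix b assume b: "b \<in> B"
      then have "f b = eval_word G f (free_gen b)" using assms by (simp add: image_subset_iff)
      then show "f b \<in> eval_word G f ` carrier (free_group B)"
        using free_gen_closed[OF b] by (rule image_eqI)
    qed
    show "subgroup (eval_word G f ` carrier (free_group B)) G"
      by (rule e.img_is_subgroup)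
  qed
  show "eval_word G f ` carrier (free_group B) \<subseteq> generate G (f ` B)"
  proof
    fix g assume "g \<in> eval_word G f ` carrier (free_group B)"
    then obtain w where w: "fst ` set w \<subseteq> B" "g = eval_word G f w"
      by (auto simp: carrier_free_group)
    have "f ` B \<subseteq> generate G (f ` B)" by (auto intro: generate.incl)
    then show "g \<in> generate G (f ` B)"
      unfolding w(2) using w(1)
      by (intro eval_word_in_subgroup[OF generate_is_subgroup[OF assms]]) blast
  qed
qed

section \<open>Roots in free groups\<close>

lemma word_power_add: "word_power w (j + k) = word_power w j @ word_power w k"
  by (simp add: replicate_add)

lemma word_power_mult: "word_power (word_power w j) k = word_power w (j * k)"
  by (induction k) (simp_all add: word_power_add)

lemma word_power_commute: "w @ word_power w k = word_power w k @ w"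
  by (induction k) simp_all

lemma word_power_commute_word:
  "x @ w = w @ x \<Longrightarrow> x @ word_power w k = word_power w k @ x"
proof (induction k)
  case (Suc k)
  have "x @ word_power w (Suc k) = (x @ w) @ word_power w k" by simp
  also have "\<dots> = w @ (x @ word_power w k)" using Suc.prems by simp
  finally show ?case using Suc by simp
qed simp

lemma length_word_power: "length (word_power w k) = k * length w"
  by (induction k) simp_all

lemma word_power_eq_Nil: "word_power w k = [] \<longleftrightarrow> k = 0 \<or> w = []"
  by (induction k) auto

lemma hd_word_power: "k > 0 \<Longrightarrow> hd (word_power w k) = hd w"
  by (induction k) (auto simp: hd_append)

lemma last_word_power: "k > 0 \<Longrightarrow> last (word_power w k) = last w"
  by (induction k) (auto simp: last_append word_power_eq_Nil)

lemma set_word_power: "k > 0 \<Longrightarrow> set (word_power w k) = set w"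
  by (induction k) auto

text \<open>A word that commutes with w also commutes with a long power of w, and is therefore a
  prefix of that power. A prefix is determined by its length.\<close>

lemma commute_same_length_eq:
  assumes "x @ w = w @ x" "y @ w = w @ y" "length x = length y" "w \<noteq> []"
  shows "x = y"
proof -
  let ?W = "word_power w (length x)"
  have len: "length x \<le> length ?W" using assms(4) by (simp add: length_word_power Suc_le_eq)
  have *: "z = take (length x) ?W" if "z @ w = w @ z" "length z = length x" for z
  proof -
    have "z = take (length x) (z @ ?W)" using that(2) by simp
    also have "\<dots> = take (length x) (?W @ z)" using word_power_commute_word[OF that(1)] by simp
    also have "\<dots> = take (length x) ?W" using len by simp
    finally show ?thesis .
  qed
  show ?thesis using *[of x] *[of y] assms by simp
qed

text \<open>Both v and t commute with their common power, hence so do v t and t v. These have equal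
  length, so \<open>commute_same_length_eq\<close> applies.\<close>

lemma word_power_eq_imp_commute:
  assumes "word_power v k = word_power t n" "k > 0" "n > 0"
  shows "v @ t = t @ v"
proof (cases "word_power v k = []")
  case True
  then show ?thesis using assms by (simp add: word_power_eq_Nil)
next
  case False
  define w where "w = word_power v k"
  have v: "v @ w = w @ v" unfolding w_def by (rule word_power_commute)
  have t: "t @ w = w @ t" unfolding w_def assms(1) by (rule word_power_commute)
  have "(v @ t) @ w = w @ (v @ t)" "(t @ v) @ w = w @ (t @ v)"
    using v t by (metis append.assoc)+
  then show ?thesis using commute_same_length_eq[of "v @ t" w "t @ v"] False w_def by simp
qed

section \<open>Reduced words, cyclic cores and their powers\<close>

lemma reduced_appendD: "reduced (u @ v) \<Longrightarrow> reduced u \<and> reduced v"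
  by (simp add: reduced_def successively_append_iff)

lemma reduced_word_power:
  assumes "cyclically_reduced w"
  shows "reduced (word_power w k)"
proof (cases "w = []")
  case False
  show ?thesis
  proof (induction k)
    case (Suc k)
    then show ?case
      using assms False unfolding cyclically_reduced_def reduced_def
      by (cases "k = 0") (auto simp: successively_append_iff hd_word_power)
  qed (simp add: reduced_def)
qed (simp add: reduced_def)

text \<open>Only the junctions matter. A power has the same first and last letter as w, so the outer
  junctions are unchanged, and the inner ones are free of cancellation by cyclic
  reducedness.\<close>

lemma reduced_conj_word_power:
  assumes "reduced (p @ w @ inv_word p)" "cyclically_reduced w" "w \<noteq> []" "k > 0"
  shows "reduced (p @ word_power w k @ inv_word p)"
  using assms reduced_word_power[OF assms(2), of k] unfolding reduced_def
  by (auto simp: successively_append_iff hd_word_power last_word_power word_power_eq_Nil)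

lemma pow_free_group:
  assumes "w \<in> carrier (free_group B)" "cyclically_reduced w"
  shows "w [^]\<^bsub>free_group B\<^esub> (k::nat) = word_power w k"
proof -
  interpret group "free_group B" by (rule group_free_group)
  show ?thesis
  proof (induction k)
    case (Suc k)
    have "w [^]\<^bsub>free_group B\<^esub> Suc k = w \<otimes>\<^bsub>free_group B\<^esub> w [^]\<^bsub>free_group B\<^esub> k"
      using assms(1) by (rule nat_pow_Suc2)
    then show ?case
      using Suc reduced_word_power[OF assms(2), of "Suc k"]
      by (simp add: mult_free_group_eq_append)
  qed simp
qed

lemma append_conj_eq_mult:
  assumes "reduced (p @ w @ inv_word p)" "fst ` set p \<subseteq> B" "fst ` set w \<subseteq> B"
  shows "p @ w @ inv_word p = p \<otimes>\<^bsub>free_group B\<^esub> w \<otimes>\<^bsub>free_group B\<^esub> inv\<^bsub>free_group B\<^esub> p"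
proof -
  have red: "reduced p" "reduced (p @ w)" using assms(1) reduced_appendD append_assoc by metis+
  then have p: "p \<in> carrier (free_group B)" using assms by (simp add: carrier_free_group)
  show ?thesis using assms(1) red(2) inv_free_group[OF p] by (simp add: mult_free_group_eq_append)
qed

lemma pow_conj_free_group:
  assumes "reduced (p @ w @ inv_word p)" "cyclically_reduced w" "w \<noteq> []" "k > 0"
    and B: "fst ` set p \<subseteq> B" "fst ` set w \<subseteq> B"
  shows "(p @ w @ inv_word p) [^]\<^bsub>free_group B\<^esub> (k::nat) = p @ word_power w k @ inv_word p"
proof -
  interpret group "free_group B" by (rule group_free_group)
  have "reduced p" "reduced w" using assms(1) reduced_appendD by metis+
  then have p: "p \<in> carrier (free_group B)" and w: "w \<in> carrier (free_group B)"
    using B by (simp_all add: carrier_free_group)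
  interpret c: group_hom "free_group B" "free_group B"
      "\<lambda>x. p \<otimes>\<^bsub>free_group B\<^esub> x \<otimes>\<^bsub>free_group B\<^esub> inv\<^bsub>free_group B\<^esub> p"
    using conj_hom[OF p] by (simp add: group_hom_def group_hom_axioms_def is_group)
  have "(p @ w @ inv_word p) [^]\<^bsub>free_group B\<^esub> k =
      p \<otimes>\<^bsub>free_group B\<^esub> word_power w k \<otimes>\<^bsub>free_group B\<^esub> inv\<^bsub>free_group B\<^esub> p"
    using append_conj_eq_mult[OF assms(1) B] c.hom_nat_pow[OF w, of k] pow_free_group[OF w assms(2)]
    by simp
  also have "\<dots> = p @ word_power w k @ inv_word p"
    using append_conj_eq_mult[OF reduced_conj_word_power[OF assms(1-4)] B(1)] B(2) \<open>k > 0\<close>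
    by (simp add: set_word_power)
  finally show ?thesis .
qed

lemma cyclic_reduction:
  assumes "reduced g" "g \<noteq> []"
  shows "\<exists>p w. g = p @ w @ inv_word p \<and> cyclically_reduced w \<and> w \<noteq> []"
  using assms
proof (induction "length g" arbitrary: g rule: less_induct)
  case less
  show ?case
  proof (cases "cyclically_reduced g")
    case True
    then show ?thesis using less.prems by (intro exI[of _ "[]"] exI[of _ g]) simp
  next
    case False
    then have hd: "hd g = inv_letter (last g)" using less.prems by (auto simp: cyclically_reduced_def)
    obtain a g1 where g1: "g = a # g1" using less.prems by (cases g) auto
    \<comment> \<open>No letter is its own inverse, so a word of length one is already cyclically
      reduced.\<close>
    have "g1 \<noteq> []" using hd g1 by (auto simp: inv_letter_def prod_eq_iff)
    then obtain g' b where g': "g1 = g' @ [b]" by (metis rev_exhaust)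
    then have b: "b = inv_letter a" using hd g1 by auto
    have "reduced g'" "g' \<noteq> []"
      using less.prems(1) g1 g' b by (auto simp: reduced_def successively_append_iff successively_Cons)
    moreover have "length g' < length g" using g1 g' by simp
    ultimately obtain p w where "g' = p @ w @ inv_word p \<and> cyclically_reduced w \<and> w \<noteq> []"
      using less.hyps by blast
    then show ?thesis using g1 g' b by (intro exI[of _ "a # p"] exI[of _ w]) simp
  qed
qed

text \<open>The equation is between lists. If one conjugating prefix were longer than the other, the
  core of the other side would begin with a letter and end with its inverse.\<close>

lemma cyclic_reduction_unique:
  assumes "p @ w @ inv_word p = q @ v @ inv_word q" "cyclically_reduced w" "cyclically_reduced v"
    and "w \<noteq> []" "v \<noteq> []"
  shows "p = q \<and> w = v"
  using assms(1)
proof (induction p arbitrary: q)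
  case Nil
  show ?case
  proof (cases q)
    case (Cons a q')
    then have "hd w = a" "last w = inv_letter a" using Nil by auto
    then show ?thesis using assms(2,4) by (simp add: cyclically_reduced_def)
  qed (use Nil in simp)
next
  case (Cons a p)
  show ?case
  proof (cases q)
    case Nil
    then have eq: "v = a # p @ w @ inv_word p @ [inv_letter a]" using Cons.prems by simp
    then have "hd v = a" "last v = inv_letter a" by auto
    then show ?thesis using assms(3,5) by (simp add: cyclically_reduced_def)
  next
    case (Cons b q')
    then show ?thesis using Cons.IH[of q'] Cons.prems by simp
  qed
qed

lemma cyclic_reduction_conj:
  assumes "g \<in> carrier (free_group B)"
  obtains p w where "p \<in> carrier (free_group B)" "w \<in> carrier (free_group B)" "cyclically_reduced w"
    "g = p \<otimes>\<^bsub>free_group B\<^esub> w \<otimes>\<^bsub>free_group B\<^esub> inv\<^bsub>free_group B\<^esub> p"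
proof (cases "g = []")
  case True
  interpret group "free_group B" by (rule group_free_group)
  show ?thesis
    using True one_closed that[of "[]" "[]"] inv_one r_one[of "[]"]
    by (simp add: cyclically_reduced_def reduced_def)
next
  case False
  then obtain p w where pw: "g = p @ w @ inv_word p" "cyclically_reduced w"
    using cyclic_reduction assms unfolding carrier_free_group by blast
  then have B: "fst ` set p \<subseteq> B" "fst ` set w \<subseteq> B" and red: "reduced (p @ w @ inv_word p)"
    using assms by (auto simp: carrier_free_group)
  then have "reduced p" "reduced w" using reduced_appendD by metis+
  then show ?thesis
    using that[of p w] pw B append_conj_eq_mult[OF red B] by (simp add: carrier_free_group)
qed

lemma free_group_decompose:
  assumes "e \<in> carrier (free_group B)" "e \<noteq> []"
  obtains p w where "e = p @ w @ inv_word p" "reduced (p @ w @ inv_word p)"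
    "cyclically_reduced w" "w \<noteq> []" "fst ` set p \<subseteq> B" "fst ` set w \<subseteq> B"
    "\<And>k. k > 0 \<Longrightarrow> e [^]\<^bsub>free_group B\<^esub> (k::nat) = p @ word_power w k @ inv_word p"
proof -
  obtain p w where pw: "e = p @ w @ inv_word p" "cyclically_reduced w" "w \<noteq> []"
    using cyclic_reduction assms unfolding carrier_free_group by blast
  then have B: "fst ` set p \<subseteq> B" "fst ` set w \<subseteq> B" and red: "reduced (p @ w @ inv_word p)"
    using assms by (auto simp: carrier_free_group)
  show ?thesis
    using that[of p w] pw B red pow_conj_free_group[OF red pw(2,3) _ B] by simp
qed

lemma cyclically_reduced_word_power:
  assumes "cyclically_reduced w" "w \<noteq> []" "k > 0"
  shows "cyclically_reduced (word_power w k)"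
  using assms by (simp add: cyclically_reduced_def[of "concat _"] reduced_word_power)
    (simp add: cyclically_reduced_def hd_word_power last_word_power)

lemma cyclically_reduced_root:
  assumes "cyclically_reduced (word_power t n)" "n > 0"
  shows "cyclically_reduced t"
proof -
  obtain m where "n = Suc m" using assms(2) by (cases n) auto
  then have "reduced t" using assms(1) reduced_appendD by (auto simp: cyclically_reduced_def)
  then show ?thesis
    using assms by (auto simp: cyclically_reduced_def hd_word_power last_word_power word_power_eq_Nil)
qed

lemma pow_free_group_eq_Nil:
  assumes "e \<in> carrier (free_group B)" "k > 0" "e [^]\<^bsub>free_group B\<^esub> (k::nat) = []"
  shows "e = []"
proof (rule ccontr)
  assume "e \<noteq> []"
  then obtain p w where "w \<noteq> []" "e [^]\<^bsub>free_group B\<^esub> k = p @ word_power w k @ inv_word p"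
    using free_group_decompose[OF assms(1)] assms(2) by metis
  then show False using assms by (simp add: word_power_eq_Nil)
qed

text \<open>Taking a power changes only the cyclic core. So e and f share the conjugating prefix,
  and their cores have the same k-th power; the core is the initial k-th part of that word.\<close>

lemma free_group_unique_roots:
  assumes e: "e \<in> carrier (free_group B)" and f: "f \<in> carrier (free_group B)" and k: "(k::nat) > 0"
    and eq: "e [^]\<^bsub>free_group B\<^esub> k = f [^]\<^bsub>free_group B\<^esub> k"
  shows "e = f"
proof (cases "e = [] \<or> f = []")
  case True
  interpret group "free_group B" by (rule group_free_group)
  have "[] [^]\<^bsub>free_group B\<^esub> k = []" using nat_pow_one by simp
  then show ?thesis using True pow_free_group_eq_Nil[OF e k] pow_free_group_eq_Nil[OF f k] eq by auto
next
  case False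
  obtain p w where e': "e = p @ w @ inv_word p" "cyclically_reduced w" "w \<noteq> []"
      "e [^]\<^bsub>free_group B\<^esub> k = p @ word_power w k @ inv_word p"
    using free_group_decompose[OF e] False k by metis
  obtain q v where f': "f = q @ v @ inv_word q" "cyclically_reduced v" "v \<noteq> []"
      "f [^]\<^bsub>free_group B\<^esub> k = q @ word_power v k @ inv_word q"
    using free_group_decompose[OF f] False k by metis
  have pq: "p = q" "word_power w k = word_power v k"
    using cyclic_reduction_unique[of p "word_power w k" q "word_power v k"] e' f' eq k
    by (auto simp: cyclically_reduced_word_power word_power_eq_Nil)
  then have "k * length w = k * length v" by (metis length_word_power)
  then have "length w = length v" using k by simp
  obtain m where "k = Suc m" using k by (cases k) auto
  then have "w = v" using pq(2) \<open>length w = length v\<close> by simp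
  then show ?thesis using pq e' f' by simp
qed

text \<open>The core w of g is written as t^n with n as large as possible, and t is conjugated back
  by p. Any other root of g has the same prefix p and a core that commutes with t.\<close>

lemma free_group_max_root:
  assumes g: "g \<in> carrier (free_group B)" "g \<noteq> []"
  obtains c n where "max_root (free_group B) g c n"
proof -
  interpret group "free_group B" by (rule group_free_group)
  obtain p w where pw: "g = p @ w @ inv_word p" "reduced (p @ w @ inv_word p)"
    "cyclically_reduced w" "w \<noteq> []" and B: "fst ` set p \<subseteq> B" "fst ` set w \<subseteq> B"
    using free_group_decompose[OF g] by metis
  define S where "S = {n. n > 0 \<and> (\<exists>t. word_power t n = w)}"
  have "n \<le> length w" if n: "n \<in> S" for n
  proof -
    obtain t where "word_power t n = w" using n unfolding S_def by blast
    then have "length w = n * length t" "t \<noteq> []"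
      using length_word_power[of n t] pw(4) by (auto simp: word_power_eq_Nil)
    then show ?thesis by (cases "length t") auto
  qed
  then have fin: "finite S" by (meson finite_nat_set_iff_bounded_le)
  have "1 \<in> S" by (auto simp: S_def intro!: exI[of _ w])
  define n where "n = Max S"
  have nS: "n \<in> S" unfolding n_def using fin \<open>1 \<in> S\<close> by (auto intro: Max_in)
  then have n: "n > 0" by (simp add: S_def)
  obtain t where t: "word_power t n = w" using nS unfolding S_def by blast
  have t0: "t \<noteq> []" using t pw(4) n by (auto simp: word_power_eq_Nil)
  have tcr: "cyclically_reduced t" using cyclically_reduced_root[of n t] t pw(3) n by simp
  have tset: "set t = set w" using t set_word_power[OF n, of t] by simp
  define c where "c = p @ t @ inv_word p"
  have hdt: "hd t = hd w" "last t = last w" using t n hd_word_power[OF n, of t] last_word_power[OF n, of t] by auto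
  have red: "reduced c"
    using pw(2,4) t0 hdt tcr unfolding c_def reduced_def cyclically_reduced_def
    by (auto simp: successively_append_iff)
  have cB: "c \<in> carrier (free_group B)"
    using red B tset by (auto simp: c_def carrier_free_group inv_letter_def)
  have cpow: "c [^]\<^bsub>free_group B\<^esub> k = p @ word_power t k @ inv_word p" if "k > 0" for k :: nat
    unfolding c_def using pow_conj_free_group[of p t k B] red tcr t0 that B tset by (simp add: c_def)
  have c0: "c \<noteq> []" using t0 by (simp add: c_def)
  have inf: "m = 0" if m: "c [^]\<^bsub>free_group B\<^esub> m = []" for m :: int
  proof (rule ccontr)
    assume "m \<noteq> 0"
    have "c [^]\<^bsub>free_group B\<^esub> \<bar>m\<bar> = []"
      using m cB int_pow_neg[OF cB, of m] inv_one by (cases "m \<ge> 0") auto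
    then have "c [^]\<^bsub>free_group B\<^esub> (nat \<bar>m\<bar>) = []" by simp
    then show False using pow_free_group_eq_Nil[OF cB, of "nat \<bar>m\<bar>"] c0 \<open>m \<noteq> 0\<close> by simp
  qed
  have root: "\<exists>m::int. e = c [^]\<^bsub>free_group B\<^esub> m"
    if e: "e \<in> carrier (free_group B)" and k: "(k::nat) > 0" and ek: "e [^]\<^bsub>free_group B\<^esub> k = g" for e k
  proof -
    have "e \<noteq> []" using ek g(2) nat_pow_one[of k] by auto
    then obtain q v where q: "e = q @ v @ inv_word q" "cyclically_reduced v" "v \<noteq> []"
        "e [^]\<^bsub>free_group B\<^esub> k = q @ word_power v k @ inv_word q"
      using free_group_decompose[OF e] k by metis
    have qp: "q = p" "word_power v k = w"
      using cyclic_reduction_unique[of q "word_power v k" p w] q pw ek k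
      by (auto simp: cyclically_reduced_word_power word_power_eq_Nil)
    have "v @ t = t @ v" using word_power_eq_imp_commute[of k v n t] qp t k n by simp
    then obtain a b s where s: "word_power s a = v" "word_power s b = t"
      using comm_append_are_replicate by metis
    have "word_power s (b * n) = w" using s t word_power_mult by metis
    moreover have "b > 0" using s t0 by (cases b) auto
    ultimately have "b * n \<in> S" using n by (auto simp: S_def)
    then have "b * n \<le> n" unfolding n_def using fin by simp
    then have "b = 1" using \<open>b > 0\<close> n by simp
    then have "word_power t a = v" using s by simp
    moreover have "a > 0" using s q(3) by (cases a) auto
    ultimately have "e = c [^]\<^bsub>free_group B\<^esub> int a" using cpow q qp by (simp add: int_pow_int)
    then show ?thesis ..
  qed
  have "max_root (free_group B) g c n"
    unfolding max_root_def using cB n cpow[OF n] t pw(1) inf root by simp blast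
  then show ?thesis by (rule that)
qed

section \<open>Mapping tori\<close>

lemma group_hom_eval_free_group:
  "f ` A \<subseteq> carrier (free_group B) \<Longrightarrow> group_hom (free_group A) (free_group B) (eval_word (free_group B) f)"
  by (rule group.eval_word_hom[OF group_free_group])

lemma group_hom_id: "group G \<Longrightarrow> group_hom G G (\<lambda>x. x)"
  by (simp add: group_hom_def group_hom_axioms_def hom_def)

lemma group_hom_comp:
  assumes "group_hom G H h" "group_hom H K k"
  shows "group_hom G K (\<lambda>x. k (h x))"
proof -
  interpret h: group_hom G H h by fact
  interpret k: group_hom H K k by fact
  show ?thesis
    by (simp add: group_hom_def group_hom_axioms_def hom_def)
qed

text \<open>Two substitutions are inverse to each other as soon as they are so on letters. The
  \<open>restrict\<close> is there because the members of \<open>auto\<close> are extensional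
  functions, undefined outside the carrier.\<close>

lemma eval_word_mutually_inverse_auto:
  fixes B :: "'a set"
  defines "F \<equiv> free_group B"
  assumes f: "f ` B \<subseteq> carrier F" and g: "g ` B \<subseteq> carrier F"
    and fg: "\<And>b. b \<in> B \<Longrightarrow> eval_word F f (g b) = free_gen b"
    and gf: "\<And>b. b \<in> B \<Longrightarrow> eval_word F g (f b) = free_gen b"
  shows "restrict (eval_word F f) (carrier F) \<in> auto F"
    and "\<And>w. w \<in> carrier F \<Longrightarrow> eval_word F f (eval_word F g w) = w"
    and "\<And>w. w \<in> carrier F \<Longrightarrow> eval_word F g (eval_word F f w) = w"
proof -
  interpret group F unfolding F_def by (rule group_free_group)
  interpret f: group_hom F F "eval_word F f" using group_hom_eval_free_group f unfolding F_def .
  interpret g: group_hom F F "eval_word F g" using group_hom_eval_free_group g unfolding F_def .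
  have id: "group_hom F F (\<lambda>x. x)" by (rule group_hom_id) (rule is_group)
  show fg': "eval_word F f (eval_word F g w) = w" if "w \<in> carrier F" for w
    using hom_free_group_eq[of B F "\<lambda>x. eval_word F f (eval_word F g x)" "\<lambda>x. x" w]
      group_hom_comp[OF g.group_hom_axioms f.group_hom_axioms] id that fg g
    unfolding F_def[symmetric] by (simp add: image_subset_iff)
  show gf': "eval_word F g (eval_word F f w) = w" if "w \<in> carrier F" for w
    using hom_free_group_eq[of B F "\<lambda>x. eval_word F g (eval_word F f x)" "\<lambda>x. x" w]
      group_hom_comp[OF f.group_hom_axioms g.group_hom_axioms] id that gf f
    unfolding F_def[symmetric] by (simp add: image_subset_iff)
  have "bij_betw (eval_word F f) (carrier F) (carrier F)"
    by (rule bij_betw_byWitness[where f' = "eval_word F g"]) (auto simp: fg' gf')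
  then show "restrict (eval_word F f) (carrier F) \<in> auto F"
    using f.homh by (auto simp: auto_def Bij_def hom_def)
qed

text \<open>The semidirect product with the integers, in which (1, 1) is the stable letter that acts
  as \<open>\<phi>\<close>. Powers are taken in \<open>AutoGroup G\<close> so that negative
  exponents make sense.\<close>

definition mapping_torus :: "('a, 'b) monoid_scheme \<Rightarrow> ('a \<Rightarrow> 'a) \<Rightarrow> ('a \<times> int) monoid" where
  "mapping_torus G \<phi> = \<lparr>carrier = carrier G \<times> UNIV,
     monoid.mult = (\<lambda>(a, i) (b, j). (a \<otimes>\<^bsub>G\<^esub> (\<phi> [^]\<^bsub>AutoGroup G\<^esub> i) b, i + j)), one = (\<one>\<^bsub>G\<^esub>, 0)\<rparr>"

locale group_with_automorphism = group G for G (structure) +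
  fixes \<phi> :: "'a \<Rightarrow> 'a"
  assumes auto: "\<phi> \<in> auto G"
begin

abbreviation \<Phi> :: "int \<Rightarrow> 'a \<Rightarrow> 'a" where "\<Phi> i \<equiv> \<phi> [^]\<^bsub>AutoGroup G\<^esub> i"
abbreviation T :: "('a \<times> int) monoid" where "T \<equiv> mapping_torus G \<phi>"

lemma mult_AutoGroup:
  "f \<in> auto G \<Longrightarrow> g \<in> auto G \<Longrightarrow> f \<otimes>\<^bsub>AutoGroup G\<^esub> g = compose (carrier G) f g"
  by (simp add: AutoGroup_def BijGroup_def auto_def)

lemma \<Phi>_auto: "\<Phi> i \<in> auto G"
proof -
  interpret A: group "AutoGroup G" by (rule AutoGroup)
  have "carrier (AutoGroup G) = auto G" by (simp add: AutoGroup_def)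
  then show ?thesis using A.int_pow_closed[of \<phi> i] auto by simp
qed

lemma \<Phi>_closed [simp]: "a \<in> carrier G \<Longrightarrow> \<Phi> i a \<in> carrier G"
  using \<Phi>_auto[of i] by (auto simp: auto_def hom_def)

lemma \<Phi>_group_hom: "group_hom G G (\<Phi> i)"
  using \<Phi>_auto[of i] by (simp add: auto_def group_hom_def group_hom_axioms_def is_group)

lemma \<Phi>_mult: "a \<in> carrier G \<Longrightarrow> b \<in> carrier G \<Longrightarrow> \<Phi> i (a \<otimes> b) = \<Phi> i a \<otimes> \<Phi> i b"
  using group_hom.hom_mult[OF \<Phi>_group_hom] .

lemma \<Phi>_add: "a \<in> carrier G \<Longrightarrow> \<Phi> (i + j) a = \<Phi> i (\<Phi> j a)"
proof -
  assume a: "a \<in> carrier G"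
  interpret A: group "AutoGroup G" by (rule AutoGroup)
  have "\<phi> \<in> carrier (AutoGroup G)" using auto by (simp add: AutoGroup_def)
  then have "\<Phi> (i + j) = \<Phi> i \<otimes>\<^bsub>AutoGroup G\<^esub> \<Phi> j" by (rule A.int_pow_mult)
  then show ?thesis using a by (simp add: mult_AutoGroup \<Phi>_auto compose_def)
qed

lemma one_AutoGroup [simp]: "a \<in> carrier G \<Longrightarrow> \<one>\<^bsub>AutoGroup G\<^esub> a = a"
  by (simp add: AutoGroup_def BijGroup_def)

lemma \<Phi>_1 [simp]: "\<Phi> 1 = \<phi>"
proof -
  interpret A: group "AutoGroup G" by (rule AutoGroup)
  show ?thesis using auto A.int_pow_1[of \<phi>] by (simp add: AutoGroup_def)
qed

lemma carrier_mapping_torus [simp]: "p \<in> carrier T \<longleftrightarrow> fst p \<in> carrier G"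
  by (cases p) (simp add: mapping_torus_def)

lemma one_mapping_torus: "\<one>\<^bsub>T\<^esub> = (\<one>, 0)"
  by (simp add: mapping_torus_def)

lemma mult_mapping_torus: "(a, i) \<otimes>\<^bsub>T\<^esub> (b, j) = (a \<otimes> \<Phi> i b, i + j)"
  by (simp add: mapping_torus_def)

lemma group_mapping_torus: "group T"
proof (rule groupI)
  show "\<exists>q\<in>carrier T. q \<otimes>\<^bsub>T\<^esub> p = \<one>\<^bsub>T\<^esub>" if "p \<in> carrier T" for p
  proof -
    obtain a i where p: "p = (a, i)" by (cases p)
    show ?thesis
      using that group_hom.hom_inv[OF \<Phi>_group_hom, of a "- i"] \<Phi>_add[of a "- i" i]
      by (intro bexI[of _ "(\<Phi> (- i) (inv a), - i)"])
        (auto simp: p mult_mapping_torus one_mapping_torus)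
  qed
qed (auto simp: mult_mapping_torus one_mapping_torus \<Phi>_mult \<Phi>_add m_assoc
      group_hom.hom_one[OF \<Phi>_group_hom])

lemma mapping_torus_embed: "group_hom G T (\<lambda>a. (a, 0))"
  by (simp add: group_hom_def group_hom_axioms_def is_group group_mapping_torus hom_def
      mult_mapping_torus)

lemma mapping_torus_snd: "group_hom T integer_group snd"
  by (auto simp: group_hom_def group_hom_axioms_def group_mapping_torus hom_def mult_mapping_torus)

lemma mapping_torus_pow: "(\<one>, 1) [^]\<^bsub>T\<^esub> (k::int) = (\<one>, k)"
proof -
  interpret T: group T by (rule group_mapping_torus)
  have mem: "(\<one>, k) \<in> carrier T" for k :: int by simp
  have "group_hom integer_group T (\<lambda>k. (\<one>, k))"
    by (simp add: group_hom_def group_hom_axioms_def group_mapping_torus hom_def mult_mapping_torus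
       group_hom.hom_one[OF \<Phi>_group_hom])
  from group_hom.hom_int_pow[OF this, of 1 k] show ?thesis by simp
qed

lemma mapping_torus_conj:
  assumes "a \<in> carrier G"
  shows "(\<one>, k) \<otimes>\<^bsub>T\<^esub> (a, 0) \<otimes>\<^bsub>T\<^esub> inv\<^bsub>T\<^esub> (\<one>, k) = (\<Phi> k a, 0)"
proof -
  interpret T: group T by (rule group_mapping_torus)
  have "(\<one>, k) \<otimes>\<^bsub>T\<^esub> (a, 0) = (\<Phi> k a, 0) \<otimes>\<^bsub>T\<^esub> (\<one>, k)"
    using assms by (simp add: mult_mapping_torus)
  moreover have "(\<Phi> k a, 0) \<otimes>\<^bsub>T\<^esub> (\<one>, k) \<otimes>\<^bsub>T\<^esub> inv\<^bsub>T\<^esub> (\<one>, k) = (\<Phi> k a, 0) \<otimes>\<^bsub>T\<^esub> \<one>\<^bsub>T\<^esub>"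
    using assms T.m_assoc[of "(\<Phi> k a, 0)" "(\<one>, k)" "inv\<^bsub>T\<^esub> (\<one>, k)"] T.r_inv[of "(\<one>, k)"] T.inv_closed[of "(\<one>, k)"] by simp
  ultimately show ?thesis using assms by (simp add: one_mapping_torus mult_mapping_torus)
qed

text \<open>The second coordinate is a homomorphism to the integers, which are torsion-free. So
  every root of (b, 0) has second coordinate 0 and is a root of b in G.\<close>

lemma max_root_mapping_torus:
  assumes "max_root G b c n"
  shows "max_root T (b, 0) (c, 0) n"
proof -
  interpret T: group T by (rule group_mapping_torus)
  interpret e: group_hom G T "\<lambda>a. (a, 0)" by (rule mapping_torus_embed)
  interpret s: group_hom T integer_group snd by (rule mapping_torus_snd)
  have c: "c \<in> carrier G" and n: "n > 0" "c [^] n = b"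
    and inf: "\<And>m::int. c [^] m = \<one> \<Longrightarrow> m = 0"
    and root: "\<And>e k. e \<in> carrier G \<Longrightarrow> (k::nat) > 0 \<Longrightarrow> e [^] k = b \<Longrightarrow> \<exists>m::int. e = c [^] m"
    using assms unfolding max_root_def by blast+
  have pow: "(a, 0) [^]\<^bsub>T\<^esub> (k::nat) = (a [^] k, 0)" "(a, 0) [^]\<^bsub>T\<^esub> (m::int) = (a [^] m, 0)"
    if "a \<in> carrier G" for a k m
    using e.hom_nat_pow[OF that, of k] e.hom_int_pow[OF that, of m] by simp_all
  have ex: "\<exists>m::int. e = (c, 0) [^]\<^bsub>T\<^esub> m"
    if e: "e \<in> carrier T" "(k::nat) > 0" "e [^]\<^bsub>T\<^esub> k = (b, 0)" for e k
  proof -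
    obtain a i where ai: "e = (a, i)" by (cases e)
    have "int k * i = 0" using s.hom_nat_pow[OF e(1), of k] e(3) by (simp add: ai)
    then have "i = 0" using e(2) by simp
    then have "(a [^] k, 0) = (b, 0 :: int)" and a: "a \<in> carrier G" using pow(1)[of a k] e ai by auto
    then obtain m :: int where "a = c [^] m" using root[OF a e(2)] by auto
    then have "e = (c, 0) [^]\<^bsub>T\<^esub> m" using pow(2)[OF c, of m] ai \<open>i = 0\<close> by simp
    then show ?thesis ..
  qed
  have "m = 0" if m: "(c, 0) [^]\<^bsub>T\<^esub> m = \<one>\<^bsub>T\<^esub>" for m :: int
  proof (rule inf)
    show "c [^] m = \<one>" using m unfolding pow(2)[OF c] one_mapping_torus by (rule prod.inject[THEN iffD1, THEN conjunct1])
  qed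
  moreover have "(c, 0) \<in> carrier T" "(c, 0) [^]\<^bsub>T\<^esub> n = (b, 0)"
    using c n(2) by (simp_all add: pow(1))
  ultimately show ?thesis
    unfolding max_root_def using n(1) ex by blast
qed

end

section \<open>The one-relator group as a mapping torus\<close>

lemma group_freeF: "group (freeF d)"
  by (simp add: freeF_def group_free_group)

lemma free_gen_closed_freeF: "a \<in> gens d \<Longrightarrow> free_gen a \<in> carrier (freeF d)"
  by (simp add: freeF_def free_gen_closed)

section \<open>Normal closures, and free groups on subsets of the letters\<close>

lemma subset_normal_closure: "R \<subseteq> normal_closure G R"
  by (auto simp: normal_closure_def)

lemma (in group) normal_closure_normal:
  assumes "R \<subseteq> carrier G"
  shows "normal_closure G R \<lhd> G"
proof -
  have car: "carrier G \<lhd> G" 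
    unfolding normal_inv_iff using subgroup_self by simp
  have sub: "subgroup (normal_closure G R) G"
    unfolding normal_closure_def
    using car assms by (intro subgroups_Inter) (auto simp: normal_inv_iff)
  show ?thesis
    unfolding normal_inv_iff
  proof (intro conjI ballI)
    fix x h assume x: "x \<in> carrier G" and h: "h \<in> normal_closure G R"
    show "x \<otimes> h \<otimes> inv x \<in> normal_closure G R"
      unfolding normal_closure_def
    proof (rule InterI)
      fix N assume N: "N \<in> {N. N \<lhd> G \<and> R \<subseteq> N}"
      then have "h \<in> N" using h unfolding normal_closure_def by auto
      then show "x \<otimes> h \<otimes> inv x \<in> N" using N x by (auto simp: normal_inv_iff)
    qed
  qed (rule sub)
qed

lemma normal_closure_least: "N \<lhd> G \<Longrightarrow> R \<subseteq> N \<Longrightarrow> normal_closure G R \<subseteq> N"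
  by (auto simp: normal_closure_def)

lemma free_gen_image_closed: "C \<subseteq> B \<Longrightarrow> free_gen ` C \<subseteq> carrier (free_group B)"
  by (auto intro!: free_gen_closed)

lemma eval_word_free_gen_id:
  assumes "C \<subseteq> B" "w \<in> carrier (free_group C)"
  shows "eval_word (free_group B) free_gen w = w"
proof -
  interpret B: group "free_group B" by (rule group_free_group)
  have sub: "carrier (free_group C) \<subseteq> carrier (free_group B)"
    using assms(1) subgroup.subset[OF subgroup_free_group] by blast
  have "group_hom (free_group C) (free_group B) (\<lambda>w. w)"
    using sub by (auto simp: group_hom_def group_hom_axioms_def group_free_group hom_def mult_free_group)
  moreover have "group_hom (free_group C) (free_group B) (eval_word (free_group B) free_gen)"
    by (rule B.eval_word_hom[OF free_gen_image_closed[OF assms(1)]])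
  ultimately show ?thesis
    using hom_free_group_eq[of C "free_group B" "eval_word (free_group B) free_gen" "\<lambda>w. w" w]
      assms free_gen_closed[of _ B] by (simp add: subset_iff)
qed

lemma generate_free_gen:
  assumes "C \<subseteq> B"
  shows "generate (free_group B) (free_gen ` C) = carrier (free_group C)"
proof -
  interpret B: group "free_group B" by (rule group_free_group)
  have "generate (free_group B) (free_gen ` C) = eval_word (free_group B) free_gen ` carrier (free_group C)"
    by (rule B.generate_eq_eval_word_image[OF free_gen_image_closed[OF assms]])
  then show ?thesis using eval_word_free_gen_id[OF assms] by simp
qed

lemma group_hom_restrict_free_group:
  assumes "group_hom (free_group B) G h" "C \<subseteq> B"
  shows "group_hom (free_group C) G h"
proof -
  interpret group_hom "free_group B" G h by fact
  have "carrier (free_group C) \<subseteq> carrier (free_group B)"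
    using subgroup.subset[OF subgroup_free_group[OF assms(2)]] .
  then show ?thesis
    using hom_mult by (auto simp: group_hom_def group_hom_axioms_def group_free_group hom_def mult_free_group subset_iff)
qed

text \<open>\<open>None\<close> stands for \<open>y x y\<inverse>\<close> and \<open>Some (i, j)\<close> for \<open>y\<^sup>i z\<^sub>j y\<^sup>-\<^sup>i\<close>. The images of these elements
  in the one-relator group freely generate the kernel of the exponent sum of \<open>y\<close>.\<close>

definition kernel_basis :: "nat \<Rightarrow> (int \<times> nat) option set" where
  "kernel_basis d = insert None (Some ` (UNIV \<times> {1..d}))"

lemma kernel_basisE:
  assumes "b \<in> kernel_basis d"
  obtains "b = None" | i j where "b = Some (i, j)" "1 \<le> j" "j \<le> d"
  using assms by (auto simp: kernel_basis_def)

text \<open>Conjugation by y^i on words in the z_j, written over the kernel basis. Thus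
  \<open>shift_word d i u\<close> stands for y^i u y^-i.\<close>

definition shift_word :: "nat \<Rightarrow> int \<Rightarrow> gen letter list \<Rightarrow> (int \<times> nat) option letter list" where
  "shift_word d i = eval_word (free_group (kernel_basis d))
     (\<lambda>g. case g of GZ j \<Rightarrow> free_gen (Some (i, j)) | _ \<Rightarrow> [])"

locale surface_presentation =
  fixes d :: nat and u :: "gen letter list"
  assumes u_gen: "u \<in> generate (freeF d) (z\<^sub>F ` {1..d})"
begin

abbreviation F where "F \<equiv> freeF d"
abbreviation K where "K \<equiv> free_group (kernel_basis d)"
abbreviation t where "t \<equiv> free_gen (None :: (int \<times> nat) option)"
abbreviation z :: "int \<Rightarrow> nat \<Rightarrow> (int \<times> nat) option letter list" where "z i j \<equiv> free_gen (Some (i, j))"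
abbreviation lu where "lu i \<equiv> shift_word d i u"

sublocale F: group F by (rule group_freeF)
sublocale K: group K by (rule group_free_group)

lemma x_closed [simp]: "x\<^sub>F \<in> carrier F" and y_closed [simp]: "y\<^sub>F \<in> carrier F"
  and z_closed [simp]: "1 \<le> j \<Longrightarrow> j \<le> d \<Longrightarrow> z\<^sub>F j \<in> carrier F"
  by (auto intro!: free_gen_closed_freeF simp: gens_def)

lemma Nil_closed [simp]: "[] \<in> carrier K"
  using K.one_closed by simp

lemma t_closed [simp]: "t \<in> carrier K" 
  and kz_closed [simp]: "1 \<le> j \<Longrightarrow> j \<le> d \<Longrightarrow> z i j \<in> carrier K"
  by (auto intro!: free_gen_closed simp: kernel_basis_def)

lemma gens_sub: "GZ ` {1..d} \<subseteq> gens d" by (auto simp: gens_def)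

lemma u_free: "u \<in> carrier (free_group (GZ ` {1..d}))"
  using u_gen generate_free_gen[OF gens_sub] by (simp add: image_image freeF_def)

lemma u_closed [simp]: "u \<in> carrier F"
  using u_free subgroup.subset[OF subgroup_free_group[OF gens_sub]] by (auto simp: freeF_def)

lemma homs_agree_u:
  assumes "group_hom (free_group (GZ ` {1..d})) G h" "group_hom (free_group (GZ ` {1..d})) G k"
    and "\<And>j. 1 \<le> j \<Longrightarrow> j \<le> d \<Longrightarrow> h (z\<^sub>F j) = k (z\<^sub>F j)"
  shows "h u = k u"
proof (rule hom_free_group_eq[OF assms(1,2) _ u_free])
  show "h (free_gen a) = k (free_gen a)" if "a \<in> GZ ` {1..d}" for a
    using that assms(3) by auto
qed

lemma shift_word_hom: "group_hom (free_group (GZ ` {1..d})) K (shift_word d i)"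
  unfolding shift_word_def by (rule K.eval_word_hom) auto

lemma shift_word_z [simp]: "1 \<le> j \<Longrightarrow> j \<le> d \<Longrightarrow> shift_word d i (z\<^sub>F j) = z i j"
  unfolding shift_word_def by simp

lemma lu_closed [simp]: "lu i \<in> carrier K"
  using group_hom.hom_closed[OF shift_word_hom u_free] .

text \<open>Conjugation by \<open>y\<close>: in the one-relator group, \<open>y\<^sup>2 x y\<^sup>-\<^sup>2\<close> is \<open>(y u y\<inverse>) (y x y\<inverse>)\<close>.\<close>

definition \<phi>gen :: "(int \<times> nat) option \<Rightarrow> (int \<times> nat) option letter list" where
  "\<phi>gen b = (case b of None \<Rightarrow> lu 1 \<otimes>\<^bsub>K\<^esub> t | Some (i, j) \<Rightarrow> z (i + 1) j)"

text \<open>Conjugating y x y^-1 by y^-1 gives x, which the relator rewrites as u^-1 (y x y^-1);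
  hence the value at \<open>None\<close>.\<close>

definition \<phi>inv_gen :: "(int \<times> nat) option \<Rightarrow> (int \<times> nat) option letter list" where
  "\<phi>inv_gen b = (case b of None \<Rightarrow> inv\<^bsub>K\<^esub> (lu 0) \<otimes>\<^bsub>K\<^esub> t | Some (i, j) \<Rightarrow> z (i - 1) j)"

definition \<phi> where "\<phi> = restrict (eval_word K \<phi>gen) (carrier K)"
definition \<phi>inv where "\<phi>inv = eval_word K \<phi>inv_gen"

lemma \<phi>gen_closed: "\<phi>gen ` kernel_basis d \<subseteq> carrier K"
  by (auto simp: \<phi>gen_def elim!: kernel_basisE)

lemma \<phi>inv_gen_closed: "\<phi>inv_gen ` kernel_basis d \<subseteq> carrier K"
  by (auto simp: \<phi>inv_gen_def elim!: kernel_basisE)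

lemma \<phi>gen_hom: "group_hom K K (eval_word K \<phi>gen)"
  by (rule K.eval_word_hom[OF \<phi>gen_closed])

lemma \<phi>inv_hom: "group_hom K K \<phi>inv"
  unfolding \<phi>inv_def by (rule K.eval_word_hom[OF \<phi>inv_gen_closed])

lemma eval_\<phi>gen_t [simp]: "eval_word K \<phi>gen t = lu 1 \<otimes>\<^bsub>K\<^esub> t"
  and eval_\<phi>gen_z [simp]: "1 \<le> j \<Longrightarrow> j \<le> d \<Longrightarrow> eval_word K \<phi>gen (z i j) = z (i + 1) j"
  by (simp_all add: \<phi>gen_def)

lemma \<phi>inv_t [simp]: "\<phi>inv t = inv\<^bsub>K\<^esub> (lu 0) \<otimes>\<^bsub>K\<^esub> t"
  and \<phi>inv_z [simp]: "1 \<le> j \<Longrightarrow> j \<le> d \<Longrightarrow> \<phi>inv (z i j) = z (i - 1) j"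
  by (simp_all add: \<phi>inv_def \<phi>inv_gen_def)

lemma eval_\<phi>gen_lu: "eval_word K \<phi>gen (lu i) = lu (i + 1)"
  by (rule homs_agree_u[of K "\<lambda>w. eval_word K \<phi>gen (shift_word d i w)" "shift_word d (i + 1)"])
    (rule group_hom_comp[OF shift_word_hom \<phi>gen_hom] shift_word_hom | simp)+

lemma \<phi>inv_lu: "\<phi>inv (lu i) = lu (i - 1)"
  by (rule homs_agree_u[of K "\<lambda>w. \<phi>inv (shift_word d i w)" "shift_word d (i - 1)"])
    (rule group_hom_comp[OF shift_word_hom \<phi>inv_hom] shift_word_hom | simp)+

lemma \<phi>_inverses:
  shows "\<phi> \<in> auto K" "\<And>w. w \<in> carrier K \<Longrightarrow> \<phi> (\<phi>inv w) = w" "\<And>w. w \<in> carrier K \<Longrightarrow> \<phi>inv (\<phi> w) = w"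
proof -
  interpret p: group_hom K K "eval_word K \<phi>gen" by (rule \<phi>gen_hom)
  interpret q: group_hom K K \<phi>inv by (rule \<phi>inv_hom)
  have 1: "eval_word K \<phi>gen (\<phi>inv_gen b) = free_gen b" if "b \<in> kernel_basis d" for b
    using that by (auto elim!: kernel_basisE simp: \<phi>inv_gen_def eval_\<phi>gen_lu K.cancel_left_inv)
  have 2: "eval_word K \<phi>inv_gen (\<phi>gen b) = free_gen b" if "b \<in> kernel_basis d" for b
    using that unfolding \<phi>inv_def[symmetric]
    by (auto elim!: kernel_basisE simp: \<phi>gen_def \<phi>inv_lu K.cancel_left_inv)
  note main = eval_word_mutually_inverse_auto[OF \<phi>gen_closed \<phi>inv_gen_closed 1 2]
  show "\<phi> \<in> auto K" unfolding \<phi>_def by (rule main(1))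
  show "\<phi> (\<phi>inv w) = w" if "w \<in> carrier K" for w
    unfolding \<phi>_def using that q.hom_closed[OF that] by (simp add: \<phi>inv_def main(2))
  show "\<phi>inv (\<phi> w) = w" if "w \<in> carrier K" for w
    unfolding \<phi>_def using that by (simp add: \<phi>inv_def main(3))
qed

sublocale group_with_automorphism K \<phi>
  by unfold_locales (rule \<phi>_inverses)

lemma \<phi>_t [simp]: "\<phi> t = lu 1 \<otimes>\<^bsub>K\<^esub> t"
  and \<phi>_z [simp]: "1 \<le> j \<Longrightarrow> j \<le> d \<Longrightarrow> \<phi> (z i j) = z (i + 1) j"
  by (simp_all add: \<phi>_def)

lemma \<Phi>_minus_1: "w \<in> carrier K \<Longrightarrow> \<Phi> (- 1) w = \<phi>inv w"
proof -
  assume w: "w \<in> carrier K"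
  have iw: "\<phi>inv w \<in> carrier K" using group_hom.hom_closed[OF \<phi>inv_hom w] .
  have "\<Phi> (- 1) w = \<Phi> (- 1) (\<Phi> 1 (\<phi>inv w))" using \<phi>_inverses(2)[OF w] by simp
  also have "\<dots> = \<phi>inv w" using \<Phi>_add[OF iw, of "- 1" 1] iw by simp
  finally show ?thesis .
qed

text \<open>The generator y becomes the stable letter. The value at x is forced: conjugation by y
  must carry it to \<open>t\<close>, so it is the preimage of \<open>t\<close> under
  \<open>\<phi>\<close>.\<close>

definition \<psi> where
  "\<psi> = eval_word T (\<lambda>g. case g of GX \<Rightarrow> (inv\<^bsub>K\<^esub> (lu 0) \<otimes>\<^bsub>K\<^esub> t, 0) | GY \<Rightarrow> (\<one>\<^bsub>K\<^esub>, 1) | GZ j \<Rightarrow> (z 0 j, 0))"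

definition \<sigma> :: "(int \<times> nat) option \<Rightarrow> gen letter list" where
  "\<sigma> b = (case b of None \<Rightarrow> y_conj d 1 x\<^sub>F | Some (i, j) \<Rightarrow> y_conj d i (z\<^sub>F j))"

definition s where "s = eval_word F \<sigma>"

sublocale T: group T by (rule group_mapping_torus)

sublocale \<psi>: group_hom F T \<psi>
  unfolding \<psi>_def freeF_def
  by (rule T.eval_word_hom) (auto simp: gens_def)

lemma \<psi>_x [simp]: "\<psi> x\<^sub>F = (inv\<^bsub>K\<^esub> (lu 0) \<otimes>\<^bsub>K\<^esub> t, 0)"
  and \<psi>_y [simp]: "\<psi> y\<^sub>F = (\<one>\<^bsub>K\<^esub>, 1)"
  and \<psi>_z [simp]: "1 \<le> j \<Longrightarrow> j \<le> d \<Longrightarrow> \<psi> (z\<^sub>F j) = (z 0 j, 0)"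
  unfolding \<psi>_def by simp_all

lemma y_conj_closed [simp]: "f \<in> carrier F \<Longrightarrow> y_conj d i f \<in> carrier F"
  by (simp add: y_conj_def)

lemma \<sigma>_closed: "\<sigma> ` kernel_basis d \<subseteq> carrier F"
  by (auto simp: \<sigma>_def elim!: kernel_basisE)

sublocale s: group_hom K F s
  unfolding s_def by (rule F.eval_word_hom[OF \<sigma>_closed])

lemma s_t [simp]: "s t = y_conj d 1 x\<^sub>F"
  and s_z [simp]: "1 \<le> j \<Longrightarrow> j \<le> d \<Longrightarrow> s (z i j) = y_conj d i (z\<^sub>F j)"
  by (simp_all add: s_def \<sigma>_def)

lemma y_conj_eq: "f \<in> carrier F \<Longrightarrow> y_conj d i f = y\<^sub>F [^]\<^bsub>F\<^esub> i \<otimes>\<^bsub>F\<^esub> f \<otimes>\<^bsub>F\<^esub> inv\<^bsub>F\<^esub> (y\<^sub>F [^]\<^bsub>F\<^esub> i)"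
  by (simp add: y_conj_def F.int_pow_neg)

lemma \<psi>_y_pow: "\<psi> (y\<^sub>F [^]\<^bsub>F\<^esub> (i::int)) = (\<one>\<^bsub>K\<^esub>, i)"
  using \<psi>.hom_int_pow[of "y\<^sub>F" i] mapping_torus_pow by simp

lemma \<psi>_y_conj:
  assumes "f \<in> carrier F" "\<psi> f = (a, 0)"
  shows "\<psi> (y_conj d i f) = (\<Phi> i a, 0)"
proof -
  have "a \<in> carrier K" using \<psi>.hom_closed[OF assms(1)] assms(2) by simp
  then show ?thesis
    using mapping_torus_conj[of a i] assms by (simp add: y_conj_eq \<psi>_y_pow)
qed

lemma \<Phi>_z: assumes "1 \<le> j" "j \<le> d" shows "\<Phi> i (z k j) = z (k + i) j"
proof (induction i rule: int_induct[where k = 0])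
  case (step1 i)
  then show ?case using assms \<Phi>_add[of "z k j" 1 i] by (simp add: add_ac)
next
  case (step2 i)
  then show ?case using assms \<Phi>_add[of "z k j" "-1" i] by (simp add: \<Phi>_minus_1 algebra_simps)
qed (use assms in simp)

text \<open>So \<open>s\<close> is a section of \<open>\<psi>\<close> over the elements of level
  zero. Its injectivity, and with it the freeness of \<open>X1 d\<close>, is a consequence.\<close>

lemma \<psi>_s: "b \<in> carrier K \<Longrightarrow> \<psi> (s b) = (b, 0)"
proof (rule hom_free_group_eq[of "kernel_basis d" T "\<lambda>b. \<psi> (s b)" "\<lambda>b. (b, 0)"])
  show "group_hom K T (\<lambda>b. \<psi> (s b))" by (rule group_hom_comp[OF s.group_hom_axioms \<psi>.group_hom_axioms])
  show "group_hom K T (\<lambda>b. (b, 0))" by (rule mapping_torus_embed)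
  show "\<psi> (s (free_gen a)) = (free_gen a, 0)" if "a \<in> kernel_basis d" for a
  proof -
    \<comment> \<open>The only letter that involves u: \<open>s t\<close> is y x y^-1, so its image
      is \<open>\<phi>\<close> applied to the image of x.\<close>
    have "\<psi> (s t) = (\<phi> (inv\<^bsub>K\<^esub> (lu 0) \<otimes>\<^bsub>K\<^esub> t), 0)"
      using \<psi>_y_conj[of "x\<^sub>F" _ 1] by simp
    also have "\<phi> (inv\<^bsub>K\<^esub> (lu 0) \<otimes>\<^bsub>K\<^esub> t) = t" using \<phi>_inverses(2)[of t] by simp
    finally have "\<psi> (s t) = (t, 0)" .
    then show ?thesis using that by (auto elim!: kernel_basisE simp: \<psi>_y_conj \<Phi>_z)
  qed
qed

lemma s_inj: "a \<in> carrier K \<Longrightarrow> b \<in> carrier K \<Longrightarrow> s a = s b \<longleftrightarrow> a = b"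
  by (metis \<psi>_s prod.inject)

section \<open>The kernel of \<open>\<psi>\<close> is the normal closure of the relator\<close>

abbreviation rel where "rel \<equiv> surface_relator d u"
abbreviation N where "N \<equiv> normal_closure F {rel}"
abbreviation Q where "Q \<equiv> F Mod N"
abbreviation \<pi> where "\<pi> \<equiv> \<lambda>g. N #>\<^bsub>F\<^esub> g"
abbreviation x0 where "x0 \<equiv> inv\<^bsub>K\<^esub> (lu 0) \<otimes>\<^bsub>K\<^esub> t"

lemma commutator_closed: "commutator F x\<^sub>F y\<^sub>F \<in> carrier F"
  by (simp add: commutator_def)

lemma rel_closed [simp]: "rel \<in> carrier F"
  by (simp add: surface_relator_def commutator_closed)

lemma N_normal: "N \<lhd> F"
  by (rule F.normal_closure_normal) simp

lemma \<phi>_x0: "\<phi> x0 = t"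
  using \<phi>_inverses(2)[of t] by simp

lemma \<psi>_u: "\<psi> u = (lu 0, 0)"
proof (rule homs_agree_u[of T \<psi> "\<lambda>w. (shift_word d 0 w, 0)"])
  show "group_hom (free_group (GZ ` {1..d})) T \<psi>"
    using \<psi>.group_hom_axioms unfolding freeF_def by (rule group_hom_restrict_free_group[OF _ gens_sub])
  show "group_hom (free_group (GZ ` {1..d})) T (\<lambda>w. (shift_word d 0 w, 0))"
    by (rule group_hom_comp[OF shift_word_hom mapping_torus_embed])
qed simp

lemma s_lu: "s (lu i) = y_conj d i u"
proof (rule homs_agree_u[of F "\<lambda>w. s (shift_word d i w)" "y_conj d i"])
  show "group_hom (free_group (GZ ` {1..d})) F (\<lambda>w. s (shift_word d i w))"
    by (rule group_hom_comp[OF shift_word_hom s.group_hom_axioms])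
  have "group_hom F F (y_conj d i)"
    using F.conj_hom[of "y\<^sub>F [^]\<^bsub>F\<^esub> i"]
    by (simp add: group_hom_def group_hom_axioms_def group_freeF hom_def y_conj_eq)
  then show "group_hom (free_group (GZ ` {1..d})) F (y_conj d i)"
    unfolding freeF_def by (rule group_hom_restrict_free_group[OF _ gens_sub])
qed simp

lemma \<psi>_rel: "\<psi> rel = \<one>\<^bsub>T\<^esub>"
proof -
  interpret e: group_hom K T "\<lambda>a. (a, 0)" by (rule mapping_torus_embed)
  have cl: "(a, i) \<in> carrier T" if "a \<in> carrier K" for a i using that by simp
  have x0: "x0 \<in> carrier K" by simp
  have conj: "\<psi> (y\<^sub>F \<otimes>\<^bsub>F\<^esub> inv\<^bsub>F\<^esub> x\<^sub>F \<otimes>\<^bsub>F\<^esub> inv\<^bsub>F\<^esub> y\<^sub>F) = (inv\<^bsub>K\<^esub> t, 0)"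
  proof -
    have "\<psi> (y\<^sub>F \<otimes>\<^bsub>F\<^esub> inv\<^bsub>F\<^esub> x\<^sub>F \<otimes>\<^bsub>F\<^esub> inv\<^bsub>F\<^esub> y\<^sub>F) = \<psi> (y_conj d 1 (inv\<^bsub>F\<^esub> x\<^sub>F))"
      by (simp add: y_conj_eq)
    also have "\<dots> = (\<Phi> 1 (inv\<^bsub>K\<^esub> x0), 0)"
    proof (rule \<psi>_y_conj)
      show "\<psi> (inv\<^bsub>F\<^esub> x\<^sub>F) = (inv\<^bsub>K\<^esub> x0, 0)"
        using \<psi>.hom_inv[of "x\<^sub>F"] e.hom_inv[OF x0] by simp
    qed simp
    also have "\<Phi> 1 (inv\<^bsub>K\<^esub> x0) = inv\<^bsub>K\<^esub> t"
      using group_hom.hom_inv[OF \<Phi>_group_hom x0, of 1] \<phi>_x0 by simp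
    finally show ?thesis .
  qed
  \<comment> \<open>Grouped as x (y x^-1 y^-1) u, the relator has factors of level zero, with images
    \<open>x0\<close>, the inverse of \<open>t\<close>, and \<open>lu 0\<close>; they cancel inside
    \<open>K\<close>.\<close>
  have "rel = x\<^sub>F \<otimes>\<^bsub>F\<^esub> (y\<^sub>F \<otimes>\<^bsub>F\<^esub> inv\<^bsub>F\<^esub> x\<^sub>F \<otimes>\<^bsub>F\<^esub> inv\<^bsub>F\<^esub> y\<^sub>F) \<otimes>\<^bsub>F\<^esub> u"
    by (simp add: surface_relator_def commutator_def F.m_assoc)
  then have "\<psi> rel = (x0, 0) \<otimes>\<^bsub>T\<^esub> (inv\<^bsub>K\<^esub> t, 0) \<otimes>\<^bsub>T\<^esub> (lu 0, 0)"
    using conj by (simp add: \<psi>_u)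
  also have "\<dots> = (x0 \<otimes>\<^bsub>K\<^esub> inv\<^bsub>K\<^esub> t \<otimes>\<^bsub>K\<^esub> lu 0, 0)"
    by (simp add: mult_mapping_torus)
  also have "x0 \<otimes>\<^bsub>K\<^esub> inv\<^bsub>K\<^esub> t \<otimes>\<^bsub>K\<^esub> lu 0 = \<one>\<^bsub>K\<^esub>"
    by (simp add: K.m_assoc K.cancel_left_inv del: one_free_group)
  finally show ?thesis by (simp add: one_mapping_torus del: one_free_group e.hom_one)
qed

lemma N_sub_kernel: "N \<subseteq> kernel F T \<psi>"
  by (rule normal_closure_least[OF \<psi>.normal_kernel]) (simp add: kernel_def \<psi>_rel)

lemma group_Q: "group Q"
  using N_normal by (rule normal.factorgroup_is_group)

lemma \<pi>_hom: "group_hom F Q \<pi>"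
  using normal.r_coset_hom_Mod[OF N_normal]
  by (simp add: group_hom_def group_hom_axioms_def group_freeF group_Q)

lemma \<pi>_eq_one: "g \<in> carrier F \<Longrightarrow> \<pi> g = \<one>\<^bsub>Q\<^esub> \<longleftrightarrow> g \<in> N"
  using F.coset_join1[of N g] F.coset_join2[of g N] N_normal by (auto simp: normal_def)

text \<open>The counterpart of \<open>\<psi>_rel\<close>: the defining relations of the mapping
  torus already hold in the quotient by \<open>N\<close>. The relator enters only at the letter
  \<open>None\<close>; for the other letters the two sides agree in F.\<close>

lemma \<pi>_conj_y:
  assumes "b \<in> carrier K"
  shows "\<pi> (y\<^sub>F \<otimes>\<^bsub>F\<^esub> s b \<otimes>\<^bsub>F\<^esub> inv\<^bsub>F\<^esub> y\<^sub>F) = \<pi> (s (\<phi> b))"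
proof -
  interpret \<pi>: group_hom F Q \<pi> by (rule \<pi>_hom)
  have c: "group_hom F F (\<lambda>g. y\<^sub>F \<otimes>\<^bsub>F\<^esub> g \<otimes>\<^bsub>F\<^esub> inv\<^bsub>F\<^esub> y\<^sub>F)"
    using F.conj_hom[OF y_closed] by (simp add: group_hom_def group_hom_axioms_def group_freeF)
  have ph: "group_hom K K \<phi>" using \<Phi>_group_hom[of 1] by simp
  have conj: "\<pi> (y\<^sub>F \<otimes>\<^bsub>F\<^esub> x\<^sub>F \<otimes>\<^bsub>F\<^esub> inv\<^bsub>F\<^esub> y\<^sub>F) = \<pi> (u \<otimes>\<^bsub>F\<^esub> x\<^sub>F)"
  proof -
    \<comment> \<open>The elements u x and y x y^-1 differ by the conjugate x^-1 \<open>rel\<close>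
      x of the relator.\<close>
    have "u \<otimes>\<^bsub>F\<^esub> x\<^sub>F = (y\<^sub>F \<otimes>\<^bsub>F\<^esub> x\<^sub>F \<otimes>\<^bsub>F\<^esub> inv\<^bsub>F\<^esub> y\<^sub>F) \<otimes>\<^bsub>F\<^esub> (inv\<^bsub>F\<^esub> x\<^sub>F \<otimes>\<^bsub>F\<^esub> rel \<otimes>\<^bsub>F\<^esub> x\<^sub>F)"
      by (simp add: surface_relator_def commutator_def F.m_assoc F.cancel_left_inv)
    moreover have "\<pi> rel = \<one>\<^bsub>Q\<^esub>" using \<pi>_eq_one[of rel] subset_normal_closure[of "{rel}" F] by simp
    ultimately show ?thesis by (simp del: one_FactGroup mult_FactGroup)
  qed
  show ?thesis
  proof (rule hom_free_group_eq[of "kernel_basis d" Q "\<lambda>b. \<pi> (y\<^sub>F \<otimes>\<^bsub>F\<^esub> s b \<otimes>\<^bsub>F\<^esub> inv\<^bsub>F\<^esub> y\<^sub>F)" "\<lambda>b. \<pi> (s (\<phi> b))"])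
    show "group_hom K Q (\<lambda>b. \<pi> (y\<^sub>F \<otimes>\<^bsub>F\<^esub> s b \<otimes>\<^bsub>F\<^esub> inv\<^bsub>F\<^esub> y\<^sub>F))"
      by (rule group_hom_comp[OF group_hom_comp[OF s.group_hom_axioms c] \<pi>_hom])
    show "group_hom K Q (\<lambda>b. \<pi> (s (\<phi> b)))"
      by (rule group_hom_comp[OF group_hom_comp[OF ph s.group_hom_axioms] \<pi>_hom])
    show "\<pi> (y\<^sub>F \<otimes>\<^bsub>F\<^esub> s (free_gen a) \<otimes>\<^bsub>F\<^esub> inv\<^bsub>F\<^esub> y\<^sub>F) = \<pi> (s (\<phi> (free_gen a)))"
      if "a \<in> kernel_basis d" for a
      using that
    proof (cases rule: kernel_basisE)
      case 1
      have cong: "\<pi> (y\<^sub>F \<otimes>\<^bsub>F\<^esub> g \<otimes>\<^bsub>F\<^esub> inv\<^bsub>F\<^esub> y\<^sub>F) = \<pi> (y\<^sub>F \<otimes>\<^bsub>F\<^esub> h \<otimes>\<^bsub>F\<^esub> inv\<^bsub>F\<^esub> y\<^sub>F)"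
        if "\<pi> g = \<pi> h" "g \<in> carrier F" "h \<in> carrier F" for g h
        using that by (simp del: mult_FactGroup)
      have "\<pi> (y\<^sub>F \<otimes>\<^bsub>F\<^esub> s t \<otimes>\<^bsub>F\<^esub> inv\<^bsub>F\<^esub> y\<^sub>F) = \<pi> (y\<^sub>F \<otimes>\<^bsub>F\<^esub> (u \<otimes>\<^bsub>F\<^esub> x\<^sub>F) \<otimes>\<^bsub>F\<^esub> inv\<^bsub>F\<^esub> y\<^sub>F)"
        using cong[OF conj] by (simp add: y_conj_eq del: \<pi>.hom_mult mult_FactGroup)
      also have "y\<^sub>F \<otimes>\<^bsub>F\<^esub> (u \<otimes>\<^bsub>F\<^esub> x\<^sub>F) \<otimes>\<^bsub>F\<^esub> inv\<^bsub>F\<^esub> y\<^sub>F = s (\<phi> t)"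
        by (simp add: s_lu y_conj_eq F.m_assoc F.cancel_left_inv)
      finally show ?thesis using 1 by simp
    next
      case (2 i j)
      have "y\<^sub>F \<otimes>\<^bsub>F\<^esub> y_conj d i (z\<^sub>F j) \<otimes>\<^bsub>F\<^esub> inv\<^bsub>F\<^esub> y\<^sub>F = y_conj d (i + 1) (z\<^sub>F j)"
        using 2 F.int_pow_mult[OF y_closed, of 1 i]
        by (simp add: y_conj_eq F.m_assoc F.inv_mult_group add.commute)
      then show ?thesis using 2 by simp
    qed
  qed (rule assms)
qed

lemma \<pi>_conj_y_pow:
  assumes "b \<in> carrier K"
  shows "\<pi> (y_conj d i (s b)) = \<pi> (s (\<Phi> i b))"
  using assms
proof (induction i arbitrary: b rule: int_induct[where k = 0])
  interpret \<pi>: group_hom F Q \<pi> by (rule \<pi>_hom)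
  have y_conj_1: "y_conj d (i + 1) f = y_conj d i (y\<^sub>F \<otimes>\<^bsub>F\<^esub> f \<otimes>\<^bsub>F\<^esub> inv\<^bsub>F\<^esub> y\<^sub>F)"
    if "f \<in> carrier F" for i f
    using that by (simp add: y_conj_eq F.m_assoc F.inv_mult_group F.int_pow_mult)
  have cong: "\<pi> (y_conj d i f) = \<pi> (y_conj d i g)" if "f \<in> carrier F" "g \<in> carrier F" "\<pi> f = \<pi> g" for i f g
    using that by (simp add: y_conj_eq del: mult_FactGroup)
  have step: "\<pi> (y_conj d (i + 1) (s b)) = \<pi> (y_conj d i (s (\<phi> b)))" if "b \<in> carrier K" for i b
    using that \<Phi>_closed[of b 1] by (simp add: y_conj_1 cong[OF _ _ \<pi>_conj_y])
  {
    case base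
    then show ?case by (simp add: y_conj_def)
  next
    case (step1 i)
    then show ?case using step[of b i] \<Phi>_add[of b i 1] \<Phi>_closed[of b 1] by simp
  next
    case (step2 i)
    \<comment> \<open>For the downward step b is written as \<open>\<phi>\<close> of an element of
      \<open>K\<close>, so that \<open>step\<close> can be used from right to left.\<close>
    have b': "\<Phi> (- 1) b \<in> carrier K" "\<phi> (\<Phi> (- 1) b) = b"
      using step2.prems \<Phi>_add[of b 1 "- 1"] by simp_all
    have "\<pi> (y_conj d (i - 1) (s b)) = \<pi> (y_conj d i (s (\<Phi> (- 1) b)))"
      using step[OF b'(1), of "i - 1"] b'(2) by simp
    also have "\<dots> = \<pi> (s (\<Phi> (i - 1) b))"
      using step2.IH[OF b'(1)] \<Phi>_add[of b i "- 1"] step2.prems by simp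
    finally show ?case .
  }
qed

text \<open>The map \<open>\<kappa>\<close> from \<open>T\<close> to the quotient is the inverse of
  the map induced by \<open>\<psi>\<close>. Once it is known to be a homomorphism, the claim that
  \<open>\<kappa>\<close> after \<open>\<psi>\<close> is \<open>\<pi>\<close> need only be checked
  on x, y and the z_j. It follows that the kernel of \<open>\<psi>\<close> is no larger than
  \<open>N\<close>.\<close>

lemma \<pi>_eq_section:
  assumes "g \<in> carrier F"
  shows "\<pi> g = \<pi> (s (fst (\<psi> g)) \<otimes>\<^bsub>F\<^esub> y\<^sub>F [^]\<^bsub>F\<^esub> snd (\<psi> g))"
proof -
  interpret \<pi>: group_hom F Q \<pi> by (rule \<pi>_hom)
  define \<kappa> where "\<kappa> = (\<lambda>(b, k). \<pi> (s b \<otimes>\<^bsub>F\<^esub> y\<^sub>F [^]\<^bsub>F\<^esub> (k::int)))"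
  have "\<kappa> ((a, i) \<otimes>\<^bsub>T\<^esub> (b, j)) = \<kappa> (a, i) \<otimes>\<^bsub>Q\<^esub> \<kappa> (b, j)"
    if ab: "a \<in> carrier K" "b \<in> carrier K" for a b i j
  proof -
    have "\<kappa> ((a, i) \<otimes>\<^bsub>T\<^esub> (b, j)) = \<pi> (s a) \<otimes>\<^bsub>Q\<^esub> \<pi> (s (\<Phi> i b)) \<otimes>\<^bsub>Q\<^esub> \<pi> (y\<^sub>F [^]\<^bsub>F\<^esub> (i + j))"
      using ab by (simp add: \<kappa>_def mult_mapping_torus del: mult_FactGroup)
    also have "\<dots> = \<pi> (s a \<otimes>\<^bsub>F\<^esub> y_conj d i (s b) \<otimes>\<^bsub>F\<^esub> y\<^sub>F [^]\<^bsub>F\<^esub> (i + j))"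
      using ab by (simp flip: \<pi>_conj_y_pow del: mult_FactGroup)
    also have "s a \<otimes>\<^bsub>F\<^esub> y_conj d i (s b) \<otimes>\<^bsub>F\<^esub> y\<^sub>F [^]\<^bsub>F\<^esub> (i + j)
        = (s a \<otimes>\<^bsub>F\<^esub> y\<^sub>F [^]\<^bsub>F\<^esub> i) \<otimes>\<^bsub>F\<^esub> (s b \<otimes>\<^bsub>F\<^esub> y\<^sub>F [^]\<^bsub>F\<^esub> j)"
      using ab by (simp add: y_conj_eq F.m_assoc F.int_pow_mult F.cancel_left_inv)
    also have "\<pi> \<dots> = \<kappa> (a, i) \<otimes>\<^bsub>Q\<^esub> \<kappa> (b, j)"
      using ab by (simp add: \<kappa>_def del: mult_FactGroup)
    finally show ?thesis .
  qed
  then have "\<kappa> (p \<otimes>\<^bsub>T\<^esub> q) = \<kappa> p \<otimes>\<^bsub>Q\<^esub> \<kappa> q" if "p \<in> carrier T" "q \<in> carrier T" for p q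
    using that by (cases p; cases q) (simp del: mult_FactGroup)
  moreover have "\<kappa> p \<in> carrier Q" if "p \<in> carrier T" for p
    using that unfolding \<kappa>_def split_beta by (intro \<pi>.hom_closed) simp
  ultimately have \<kappa>: "group_hom T Q \<kappa>"
    by (simp add: group_hom_def group_hom_axioms_def group_mapping_torus group_Q hom_def
        del: mult_FactGroup carrier_mapping_torus)
  have "\<pi> g = \<kappa> (\<psi> g)"
  proof (rule hom_free_group_eq[of "gens d" Q \<pi> "\<lambda>g. \<kappa> (\<psi> g)"])
    show "group_hom (free_group (gens d)) Q \<pi>" using \<pi>_hom by (simp add: freeF_def)
    show "group_hom (free_group (gens d)) Q (\<lambda>g. \<kappa> (\<psi> g))"
      using group_hom_comp[OF \<psi>.group_hom_axioms \<kappa>] by (simp add: freeF_def)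
    show "g \<in> carrier (free_group (gens d))" using assms by (simp add: freeF_def)
    fix a assume "a \<in> gens d"
    then consider "a = GX" | "a = GY" | j where "a = GZ j" "1 \<le> j" "j \<le> d" by (auto simp: gens_def)
    then show "\<pi> (free_gen a) = \<kappa> (\<psi> (free_gen a))"
    proof cases
      case 1
      \<comment> \<open>Conjugation by y carries x to \<open>s t\<close> by the definition of
        \<open>s\<close>, and carries \<open>s x0\<close> to \<open>s t\<close> modulo
        \<open>N\<close>. Cancelling the conjugation identifies the two in the quotient.\<close>
      have "\<pi> (y\<^sub>F \<otimes>\<^bsub>F\<^esub> s x0 \<otimes>\<^bsub>F\<^esub> inv\<^bsub>F\<^esub> y\<^sub>F) = \<pi> (s t)"
        using \<pi>_conj_y[of x0] \<phi>_x0 by simp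
      then have "\<pi> y\<^sub>F \<otimes>\<^bsub>Q\<^esub> \<pi> (s x0) \<otimes>\<^bsub>Q\<^esub> inv\<^bsub>Q\<^esub> \<pi> y\<^sub>F = \<pi> y\<^sub>F \<otimes>\<^bsub>Q\<^esub> \<pi> x\<^sub>F \<otimes>\<^bsub>Q\<^esub> inv\<^bsub>Q\<^esub> \<pi> y\<^sub>F"
        by (simp add: y_conj_eq del: mult_FactGroup s.hom_mult)
      then have "\<pi> (s x0) = \<pi> x\<^sub>F" by (simp del: mult_FactGroup s.hom_mult)
      then show ?thesis using 1 by (simp add: \<kappa>_def del: mult_FactGroup s.hom_mult \<pi>.hom_mult)
    next
      case 2
      then show ?thesis using s.hom_one by (simp add: \<kappa>_def del: s.hom_one)
    next
      case (3 j)
      then show ?thesis by (simp add: \<kappa>_def y_conj_def del: mult_FactGroup \<pi>.hom_mult)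
    qed
  qed
  then show ?thesis by (simp add: \<kappa>_def split_beta)
qed

lemma kernel_\<psi>: "kernel F T \<psi> = N"
proof
  show "kernel F T \<psi> \<subseteq> N"
  proof
    fix g assume "g \<in> kernel F T \<psi>"
    then have g: "g \<in> carrier F" "\<psi> g = ([], 0)" by (simp_all add: kernel_def one_mapping_torus)
    have "\<pi> g = \<one>\<^bsub>Q\<^esub>"
      using \<pi>_eq_section[OF g(1)] s.hom_one group_hom.hom_one[OF \<pi>_hom] by (simp add: g(2) del: s.hom_one)
    then show "g \<in> N" using \<pi>_eq_one[OF g(1)] by simp
  qed
qed (rule N_sub_kernel)

lemma \<psi>_surj: "\<psi> ` carrier F = carrier T"
proof
  show "carrier T \<subseteq> \<psi> ` carrier F"
  proof
    fix p assume "p \<in> carrier T"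
    then obtain b k where p: "p = (b, k)" "b \<in> carrier K" by (cases p) auto
    then have "\<psi> (s b \<otimes>\<^bsub>F\<^esub> y\<^sub>F [^]\<^bsub>F\<^esub> k) = p"
      by (simp add: \<psi>_s \<psi>_y_pow mult_mapping_torus group_hom.hom_one[OF \<Phi>_group_hom] del: one_free_group)
    then show "p \<in> \<psi> ` carrier F" using p by (intro image_eqI[of _ _ "s b \<otimes>\<^bsub>F\<^esub> y\<^sub>F [^]\<^bsub>F\<^esub> k"]) auto
  qed
qed (rule image_subsetI, rule \<psi>.hom_closed)

end

section \<open>Conjugacy to a normal form\<close>

lemma hom_image_free_group:
  assumes h: "group_hom (free_group B) G h" and C: "C \<subseteq> B" and H: "subgroup H G"
    and gen: "\<And>b. b \<in> C \<Longrightarrow> h (free_gen b) \<in> H" and w: "w \<in> carrier (free_group C)"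
  shows "h w \<in> H"
proof -
  interpret h: group_hom "free_group B" G h by (rule h)
  have cl: "(\<lambda>b. h (free_gen b)) ` C \<subseteq> carrier G"
    using gen subgroup.subset[OF H] by auto
  have "h w = eval_word G (\<lambda>b. h (free_gen b)) w"
    using hom_free_group_eq[OF group_hom_restrict_free_group[OF h C] h.H.eval_word_hom[OF cl] _ w]
      cl by (simp add: image_subset_iff)
  also have "\<dots> \<in> H"
    using w gen by (intro h.H.eval_word_in_subgroup[OF H]) (auto simp: carrier_free_group)
  finally show ?thesis .
qed

lemma free_group_singleton:
  assumes "w \<in> carrier (free_group {a})" "a \<in> B"
  shows "\<exists>n::int. w = free_gen a [^]\<^bsub>free_group B\<^esub> n"
proof -
  interpret group "free_group B" by (rule group_free_group)
  have "w \<in> generate (free_group B) {free_gen a}"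
    using generate_free_gen[of "{a}" B] assms by simp
  then show ?thesis using generate_pow[OF free_gen_closed[OF assms(2)]] by blast
qed

lemma free_group_Int: "carrier (free_group (A \<inter> B)) = carrier (free_group A) \<inter> carrier (free_group B)"
  by (auto simp: carrier_free_group)

lemma free_group_mono: "A \<subseteq> B \<Longrightarrow> carrier (free_group A) \<subseteq> carrier (free_group B)"
  by (rule subgroup.subset[OF subgroup_free_group])

text \<open>The letter \<open>None\<close> belongs to every band, as y x y^-1 carries no index. The
  bands {0..} and {1..} correspond to \<open>X1 d\<close> and \<open>X1_upper d\<close>; bounded
  bands carry the inductions.\<close>

definition kernel_band :: "nat \<Rightarrow> int set \<Rightarrow> (int \<times> nat) option set" where
  "kernel_band d I = insert None (Some ` (I \<times> {1..d}))"

context surface_presentation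
begin

abbreviation KI where "KI I \<equiv> carrier (free_group (kernel_band d I))"

lemma kernel_band_sub: "kernel_band d I \<subseteq> kernel_basis d"
  by (auto simp: kernel_band_def kernel_basis_def)

lemma KI_subgroup: "subgroup (KI I) K"
  by (rule subgroup_free_group[OF kernel_band_sub])

lemma KI_mono: "I \<subseteq> J \<Longrightarrow> KI I \<subseteq> KI J"
  by (rule free_group_mono) (auto simp: kernel_band_def)

lemma KI_closed: "w \<in> KI I \<Longrightarrow> w \<in> carrier K"
  using subgroup.subset[OF KI_subgroup] by blast

lemma t_KI: "t \<in> KI I" and kz_KI: "i \<in> I \<Longrightarrow> 1 \<le> j \<Longrightarrow> j \<le> d \<Longrightarrow> z i j \<in> KI I"
  by (rule free_gen_closed, auto simp: kernel_band_def)+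

lemma lu_KI: "i \<in> I \<Longrightarrow> lu i \<in> KI I"
  unfolding shift_word_def
proof (rule K.eval_word_in_subgroup[OF KI_subgroup], rule image_subsetI)
  fix g assume i: "i \<in> I" and "g \<in> fst ` set u"
  then have "g \<in> GZ ` {1..d}" using u_free unfolding carrier_free_group by blast
  then obtain j where "g = GZ j" "1 \<le> j" "j \<le> d" by auto
  then show "(case g of GZ j \<Rightarrow> z i j | _ \<Rightarrow> []) \<in> KI I" using kz_KI[OF i] by simp
qed

lemma hom_image_KI:
  assumes h: "group_hom K K h" and w: "w \<in> KI I" and "h t \<in> KI J"
    and "\<And>i j. i \<in> I \<Longrightarrow> 1 \<le> j \<Longrightarrow> j \<le> d \<Longrightarrow> h (z i j) \<in> KI J"
  shows "h w \<in> KI J"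
  by (rule hom_image_free_group[OF h kernel_band_sub KI_subgroup _ w]) (use assms(3,4) in \<open>auto simp: kernel_band_def\<close>)

text \<open>The image of \<open>t\<close> brings in the letters of \<open>lu 1\<close>, so the
  target band has to contain 1 besides the shifted indices. For \<open>\<phi>inv_KI\<close> the same
  role is played by \<open>lu 0\<close> and the index 0.\<close>

lemma \<phi>_KI:
  assumes "w \<in> KI I" "(\<lambda>i. i + 1) ` I \<subseteq> J" "1 \<in> J"
  shows "\<phi> w \<in> KI J"
proof (rule hom_image_KI[OF _ assms(1)])
  show "group_hom K K \<phi>" using \<Phi>_group_hom[of 1] by simp
  show "\<phi> t \<in> KI J"
    using subgroup.m_closed[OF KI_subgroup lu_KI[OF assms(3)] t_KI] by simp
qed (use assms(2) kz_KI in auto)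

lemma \<phi>inv_KI:
  assumes "w \<in> KI I" "(\<lambda>i. i - 1) ` I \<subseteq> J" "0 \<in> J"
  shows "\<phi>inv w \<in> KI J"
proof (rule hom_image_KI[OF \<phi>inv_hom assms(1)])
  show "\<phi>inv t \<in> KI J"
    using subgroup.m_closed[OF KI_subgroup subgroup.m_inv_closed[OF KI_subgroup lu_KI[OF assms(3)]] t_KI]
    by simp
qed (use assms(2) kz_KI in auto)

text \<open>Conjugacy in S for elements of the free kernel: conjugating (b, 0) by (p, k) amounts to
  applying the k-th power of \<open>\<phi>\<close> and then conjugating by p in
  \<open>K\<close>.\<close>

definition torus_conj where
  "torus_conj b b' \<longleftrightarrow> (\<exists>p \<in> carrier T. p \<otimes>\<^bsub>T\<^esub> (b, 0) \<otimes>\<^bsub>T\<^esub> inv\<^bsub>T\<^esub> p = (b', 0))"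

lemma torus_conj_trans:
  assumes "torus_conj a b" "torus_conj b c" "a \<in> carrier K"
  shows "torus_conj a c"
proof -
  obtain p q where p: "p \<in> carrier T" "p \<otimes>\<^bsub>T\<^esub> (a, 0) \<otimes>\<^bsub>T\<^esub> inv\<^bsub>T\<^esub> p = (b, 0)"
    and q: "q \<in> carrier T" "q \<otimes>\<^bsub>T\<^esub> (b, 0) \<otimes>\<^bsub>T\<^esub> inv\<^bsub>T\<^esub> q = (c, 0)"
    using assms unfolding torus_conj_def by blast
  have a: "(a, 0) \<in> carrier T" using assms(3) by simp
  have "(q \<otimes>\<^bsub>T\<^esub> p) \<otimes>\<^bsub>T\<^esub> (a, 0) \<otimes>\<^bsub>T\<^esub> inv\<^bsub>T\<^esub> (q \<otimes>\<^bsub>T\<^esub> p) = (c, 0)"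
    unfolding q(2)[symmetric] p(2)[symmetric]
    using p(1) q(1) a T.inv_closed[OF p(1)] T.inv_closed[OF q(1)]
    by (simp add: T.m_assoc T.inv_mult_group del: carrier_mapping_torus)
  then show ?thesis unfolding torus_conj_def using T.m_closed[OF q(1) p(1)] by blast
qed

lemma torus_conj_\<Phi>: "b \<in> carrier K \<Longrightarrow> torus_conj b (\<Phi> i b)"
  unfolding torus_conj_def using mapping_torus_conj[of b i] by (intro bexI[of _ "(\<one>\<^bsub>K\<^esub>, i)"]) auto

lemma torus_conj_\<phi>: "b \<in> carrier K \<Longrightarrow> torus_conj b (\<phi> b)"
  using torus_conj_\<Phi>[of b 1] by simp

lemma torus_conj_\<phi>inv: "b \<in> carrier K \<Longrightarrow> torus_conj b (\<phi>inv b)"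
  using torus_conj_\<Phi>[of b "- 1"] by (simp add: \<Phi>_minus_1)

lemma torus_conj_inner:
  assumes "p \<in> carrier K" "b \<in> carrier K"
  shows "torus_conj b (p \<otimes>\<^bsub>K\<^esub> b \<otimes>\<^bsub>K\<^esub> inv\<^bsub>K\<^esub> p)"
proof -
  interpret e: group_hom K T "\<lambda>a. (a, 0)" by (rule mapping_torus_embed)
  have "(p, 0) \<otimes>\<^bsub>T\<^esub> (b, 0) \<otimes>\<^bsub>T\<^esub> inv\<^bsub>T\<^esub> (p, 0) = (p \<otimes>\<^bsub>K\<^esub> b \<otimes>\<^bsub>K\<^esub> inv\<^bsub>K\<^esub> p, 0)"
    using assms by simp
  then show ?thesis unfolding torus_conj_def using e.hom_closed[OF assms(1)] by blast
qed

lemma torus_conj_inner_sym: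
  assumes "p \<in> carrier K" "b \<in> carrier K"
  shows "torus_conj (p \<otimes>\<^bsub>K\<^esub> b \<otimes>\<^bsub>K\<^esub> inv\<^bsub>K\<^esub> p) b"
proof -
  have "inv\<^bsub>K\<^esub> p \<otimes>\<^bsub>K\<^esub> (p \<otimes>\<^bsub>K\<^esub> b \<otimes>\<^bsub>K\<^esub> inv\<^bsub>K\<^esub> p) \<otimes>\<^bsub>K\<^esub> inv\<^bsub>K\<^esub> (inv\<^bsub>K\<^esub> p) = b"
    using assms by (simp add: K.m_assoc K.cancel_left_inv del: one_free_group)
  then show ?thesis
    using torus_conj_inner[of "inv\<^bsub>K\<^esub> p" "p \<otimes>\<^bsub>K\<^esub> b \<otimes>\<^bsub>K\<^esub> inv\<^bsub>K\<^esub> p"] assms by simp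
qed

text \<open>Conditions R1 to R4 read inside \<open>K\<close>: \<open>s\<close> maps
  \<open>KI {0..}\<close> onto the subgroup generated by \<open>X1 d\<close>,
  \<open>KI {1..}\<close> onto the free factor in R4, and \<open>x0\<close> to the generator of the
  cyclic subgroup in R2.\<close>

definition hempel_form where
  "hempel_form b \<longleftrightarrow> b \<in> KI {0..} \<and> cyclically_reduced b \<and> b \<notin> KI {1..} \<and>
     (\<forall>h \<in> KI {0..}. \<forall>n::int. b \<noteq> h \<otimes>\<^bsub>K\<^esub> x0 [^]\<^bsub>K\<^esub> n \<otimes>\<^bsub>K\<^esub> inv\<^bsub>K\<^esub> h)"

text \<open>Since \<open>x0\<close> is the image of x, the first alternative describes the images of
  powers of x. The sign of the exponent is settled later by \<open>xsum\<close>.\<close>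

definition normal_form where
  "normal_form b \<longleftrightarrow> (\<exists>n::int. b = x0 [^]\<^bsub>K\<^esub> n) \<or> hempel_form b"

text \<open>Over the empty band only powers of \<open>t\<close> remain, and one shift down turns
  \<open>t\<close> into \<open>x0\<close>.\<close>

lemma normal_form_power_t:
  assumes "b \<in> KI {}"
  shows "\<exists>b'. torus_conj b b' \<and> normal_form b'"
proof -
  interpret q: group_hom K K \<phi>inv by (rule \<phi>inv_hom)
  have "None \<in> kernel_basis d" by (simp add: kernel_basis_def)
  then obtain n :: int where n: "b = t [^]\<^bsub>K\<^esub> n"
    using free_group_singleton[of b None "kernel_basis d"] assms by (auto simp: kernel_band_def)
  have "\<phi>inv b = x0 [^]\<^bsub>K\<^esub> n" unfolding n using q.hom_int_pow[of t n] by simp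
  then show ?thesis
    using torus_conj_\<phi>inv[of b] n by (auto simp: normal_form_def)
qed

text \<open>If no letter \<open>z 0 j\<close> occurs in the cyclically reduced word \<open>w\<close>, then shifting \<open>w\<close> down by
  \<open>\<phi>inv\<close> keeps its indices nonnegative and lowers the bound on them: the letters of \<open>lu 0\<close>
  created by the shift have index \<open>0\<close>.\<close>

lemma normal_form_bounded:
  assumes "b \<in> KI {0..<int m}"
  shows "\<exists>b'. torus_conj b b' \<and> normal_form b'"
  using assms
proof (induction m arbitrary: b)
  case 0
  then show ?case using normal_form_power_t by simp
next
  case (Suc m)
  \<comment> \<open>Cyclic reduction is carried out in the free group on the band itself, so that p
    and w obey the same bounds on indices.\<close>
  obtain p w where p: "p \<in> KI {0..<int (Suc m)}" and w: "w \<in> KI {0..<int (Suc m)}" "cyclically_reduced w"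
    and b: "b = p \<otimes>\<^bsub>free_group (kernel_band d {0..<int (Suc m)})\<^esub> w \<otimes>\<^bsub>free_group (kernel_band d {0..<int (Suc m)})\<^esub>
        inv\<^bsub>free_group (kernel_band d {0..<int (Suc m)})\<^esub> p"
    using cyclic_reduction_conj[OF Suc.prems] by blast
  have pK: "p \<in> carrier K" and wK: "w \<in> carrier K" using p w KI_closed by auto
  have "b = p \<otimes>\<^bsub>K\<^esub> w \<otimes>\<^bsub>K\<^esub> inv\<^bsub>K\<^esub> p"
    using b inv_free_group[OF p] inv_free_group[OF pK] by (simp add: mult_free_group)
  then have bw: "torus_conj b w" using torus_conj_inner_sym[OF pK wK] by simp
  have bK: "b \<in> carrier K" using Suc.prems KI_closed by blast
  show ?case
  proof (cases "w \<in> KI {1..}")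
    case True
    have "kernel_band d {1..} \<inter> kernel_band d {0..<int (Suc m)} = kernel_band d ({1..} \<inter> {0..<int (Suc m)})"
      by (auto simp: kernel_band_def)
    then have "w \<in> KI ({1..} \<inter> {0..<int (Suc m)})"
      using True w(1) free_group_Int[of "kernel_band d {1..}" "kernel_band d {0..<int (Suc m)}"] by auto
    moreover have "{1..} \<inter> {0..<int (Suc m)} = {1..int m}" by auto
    ultimately have w1: "w \<in> KI {1..int m}" by simp
    obtain w' where w': "torus_conj b w'" "w' \<in> KI {0..<int m}"
    proof (cases m)
      case 0
      \<comment> \<open>For m = 0 the band of w is already empty. A shift would introduce the
        letters of \<open>lu 0\<close>, for which {0..<0} has no room.\<close>
      then show ?thesis using that bw w1 by simp
    next
      case (Suc k)
      have "\<phi>inv w \<in> KI {0..<int m}"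
        by (rule \<phi>inv_KI[OF w1]) (use Suc in auto)
      then show ?thesis using that torus_conj_trans[OF bw torus_conj_\<phi>inv[OF wK] bK] by blast
    qed
    then obtain b' where "torus_conj w' b'" "normal_form b'" using Suc.IH by blast
    then show ?thesis using torus_conj_trans[OF w'(1) _ bK] by blast
  next
    case False
    have "{0..<int (Suc m)} \<subseteq> {0..}" by auto
    then have w0: "w \<in> KI {0..}" using w(1) KI_mono by blast
    show ?thesis
    proof (cases "hempel_form w")
      case True
      then show ?thesis using bw by (auto simp: normal_form_def)
    next
      case nh: False
      \<comment> \<open>All other clauses of \<open>hempel_form\<close> hold for w, so it can only
        fail because w is conjugate to a power of \<open>x0\<close>.\<close>
      then obtain h and n :: int where h: "h \<in> KI {0..}" "w = h \<otimes>\<^bsub>K\<^esub> x0 [^]\<^bsub>K\<^esub> n \<otimes>\<^bsub>K\<^esub> inv\<^bsub>K\<^esub> h"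
        using False w(2) w0 unfolding hempel_form_def by blast
      then have "torus_conj w (x0 [^]\<^bsub>K\<^esub> n)"
        using torus_conj_inner_sym[of h "x0 [^]\<^bsub>K\<^esub> n"] KI_closed[OF h(1)] by simp
      then show ?thesis using torus_conj_trans[OF bw _ bK] by (auto simp: normal_form_def)
    qed
  qed
qed

lemma KI_bounded:
  assumes "b \<in> carrier K"
  shows "\<exists>k m. b \<in> KI {- int k..<int m}"
proof -
  \<comment> \<open>The sum of the absolute values of the indices bounds each of them and is also
    defined for the empty word.\<close>
  define M where "M = (\<Sum>l\<leftarrow>b. case fst l of None \<Rightarrow> 0 | Some (i, j) \<Rightarrow> nat \<bar>i\<bar>)"
  have "fst l \<in> kernel_band d {- int M..<int (Suc M)}" if l: "l \<in> set b" for l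
  proof -
    have "(case fst l of None \<Rightarrow> 0 | Some (i, j) \<Rightarrow> nat \<bar>i\<bar>) \<le> M"
      unfolding M_def using l by (intro member_le_sum_list) auto
    moreover have "fst l \<in> kernel_basis d" using assms l by (auto simp: carrier_free_group)
    moreover have "i \<in> {- int M..<int (Suc M)}" if "nat \<bar>i\<bar> \<le> M" for i :: int
      using that by auto
    ultimately show ?thesis by (force elim!: kernel_basisE simp: kernel_band_def)
  qed
  then have "b \<in> KI {- int M..<int (Suc M)}" using assms by (auto simp: carrier_free_group)
  then show ?thesis by blast
qed

lemma torus_conj_nonneg:
  assumes "b \<in> KI {- int k..<int m}"
  shows "\<exists>b' m'. torus_conj b b' \<and> b' \<in> KI {0..<int m'}"
  using assms
proof (induction k arbitrary: b m)
  case 0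
  have "torus_conj b b" using torus_conj_\<Phi>[of b 0] KI_closed[OF 0] by simp
  then show ?case using 0 by auto
next
  case (Suc k)
  have bK: "b \<in> carrier K" using Suc.prems KI_closed by blast
  \<comment> \<open>The shift alone would give the bound m + 1; the extra unit makes room for the
    index 1 of \<open>lu 1\<close> when m = 0.\<close>
  have "\<phi> b \<in> KI {- int k..<int (m + 2)}"
    by (rule \<phi>_KI[OF Suc.prems]) auto
  then obtain b' m' where "torus_conj (\<phi> b) b'" "b' \<in> KI {0..<int m'}" using Suc.IH by blast
  then show ?case using torus_conj_trans[OF torus_conj_\<phi>[OF bK] _ bK] by blast
qed

lemma torus_conj_normal_form:
  assumes "b \<in> carrier K"
  shows "\<exists>b'. torus_conj b b' \<and> normal_form b'"
proof -
  obtain k m where "b \<in> KI {- int k..<int m}" using KI_bounded[OF assms] by blast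
  then obtain b1 m' where b1: "torus_conj b b1" "b1 \<in> KI {0..<int m'}" using torus_conj_nonneg by blast
  then obtain b' where "torus_conj b1 b'" "normal_form b'" using normal_form_bounded by blast
  then show ?thesis using torus_conj_trans[OF b1(1) _ assms] by blast
qed

end

section \<open>Automorphisms that fix the commutator\<close>

definition xsum :: "gen letter list \<Rightarrow> int" where
  "xsum = eval_word integer_group (\<lambda>g. if g = GX then 1 else 0)"

definition ysum :: "gen letter list \<Rightarrow> int" where
  "ysum = eval_word integer_group (\<lambda>g. if g = GY then 1 else 0)"

lemma xsum_hom: "group_hom (free_group B) integer_group xsum"
  and ysum_hom: "group_hom (free_group B) integer_group ysum"
  unfolding xsum_def ysum_def by (rule group.eval_word_hom; simp)+

lemma xsum_gen [simp]: "xsum (free_gen a) = (if a = GX then 1 else 0)"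
  and ysum_gen [simp]: "ysum (free_gen a) = (if a = GY then 1 else 0)"
  unfolding xsum_def ysum_def by (simp_all add: group.eval_word_free_gen)

definition commutator_autos :: "(gen letter list \<Rightarrow> gen letter list) set" where
  "commutator_autos = {\<alpha> \<in> auto freeFxy. \<alpha> (commutator freeFxy x\<^sub>F y\<^sub>F) = commutator freeFxy x\<^sub>F y\<^sub>F}"

abbreviation xy_map :: "gen letter list \<Rightarrow> gen letter list \<Rightarrow> gen \<Rightarrow> gen letter list" where
  "xy_map a b \<equiv> \<lambda>g. if g = GX then a else b"

interpretation Fxy: group freeFxy
  by (simp add: freeFxy_def group_free_group)

lemma xy_closed [simp]: "x\<^sub>F \<in> carrier freeFxy" "y\<^sub>F \<in> carrier freeFxy"
  by (simp_all add: freeFxy_def free_gen_closed)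

lemma xy_map_hom:
  "a \<in> carrier freeFxy \<Longrightarrow> b \<in> carrier freeFxy \<Longrightarrow> group_hom freeFxy freeFxy (eval_word freeFxy (xy_map a b))"
  unfolding freeFxy_def by (rule group_hom_eval_free_group) auto

lemma xy_map_auto:
  assumes cl: "a \<in> carrier freeFxy" "b \<in> carrier freeFxy" "a' \<in> carrier freeFxy" "b' \<in> carrier freeFxy"
    and "eval_word freeFxy (xy_map a b) a' = x\<^sub>F" "eval_word freeFxy (xy_map a b) b' = y\<^sub>F"
    and "eval_word freeFxy (xy_map a' b') a = x\<^sub>F" "eval_word freeFxy (xy_map a' b') b = y\<^sub>F"
    and comm: "commutator freeFxy a b = commutator freeFxy x\<^sub>F y\<^sub>F"
  shows "restrict (eval_word freeFxy (xy_map a b)) (carrier freeFxy) \<in> commutator_autos"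
proof -
  interpret e: group_hom freeFxy freeFxy "eval_word freeFxy (xy_map a b)"
    using cl by (intro xy_map_hom)
  have "restrict (eval_word freeFxy (xy_map a b)) (carrier freeFxy) \<in> auto freeFxy"
    using assms unfolding freeFxy_def
    by (intro eval_word_mutually_inverse_auto(1)[where g = "xy_map a' b'"]) auto
  moreover have "eval_word freeFxy (xy_map a b) (commutator freeFxy x\<^sub>F y\<^sub>F) = commutator freeFxy a b"
    using cl by (simp add: commutator_def)
  moreover have "commutator freeFxy x\<^sub>F y\<^sub>F \<in> carrier freeFxy" by (simp add: commutator_def)
  ultimately show ?thesis using comm by (simp add: commutator_autos_def)
qed

text \<open>The automorphisms \<open>shear k\<close> and \<open>turn\<close> act on the pair of exponent sums of \<open>x\<close> and \<open>y\<close> by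
  matrices that generate the special linear group of rank two over the integers.\<close>

abbreviation twist :: "int \<Rightarrow> gen letter list" where
  "twist k \<equiv> x\<^sub>F \<otimes>\<^bsub>freeFxy\<^esub> y\<^sub>F [^]\<^bsub>freeFxy\<^esub> k"

definition shear :: "int \<Rightarrow> gen letter list \<Rightarrow> gen letter list" where
  "shear k = restrict (eval_word freeFxy (xy_map (twist k) y\<^sub>F)) (carrier freeFxy)"

definition turn :: "gen letter list \<Rightarrow> gen letter list" where
  "turn = restrict (eval_word freeFxy
     (xy_map (x\<^sub>F \<otimes>\<^bsub>freeFxy\<^esub> y\<^sub>F \<otimes>\<^bsub>freeFxy\<^esub> inv\<^bsub>freeFxy\<^esub> x\<^sub>F) (inv\<^bsub>freeFxy\<^esub> x\<^sub>F))) (carrier freeFxy)"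

lemma shear_x: "shear k x\<^sub>F = twist k" and shear_y: "shear k y\<^sub>F = y\<^sub>F"
  by (simp_all add: shear_def)

lemma turn_x: "turn x\<^sub>F = x\<^sub>F \<otimes>\<^bsub>freeFxy\<^esub> y\<^sub>F \<otimes>\<^bsub>freeFxy\<^esub> inv\<^bsub>freeFxy\<^esub> x\<^sub>F"
  and turn_y: "turn y\<^sub>F = inv\<^bsub>freeFxy\<^esub> x\<^sub>F"
  by (simp_all add: turn_def)

lemma shear_auto: "shear k \<in> commutator_autos"
proof -
  have tw: "eval_word freeFxy (xy_map (twist k) y\<^sub>F) (twist (- k)) = x\<^sub>F" for k
  proof -
    interpret e: group_hom freeFxy freeFxy "eval_word freeFxy (xy_map (twist k) y\<^sub>F)"
      by (rule xy_map_hom) simp_all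
    show ?thesis by (simp add: e.hom_int_pow Fxy.m_assoc Fxy.int_pow_neg)
  qed
  have "commutator freeFxy (twist k) y\<^sub>F = commutator freeFxy x\<^sub>F y\<^sub>F"
  proof -
    \<comment> \<open>Because y^k commutes with y, it cancels from the commutator of x y^k and
      y.\<close>
    have "y\<^sub>F [^]\<^bsub>freeFxy\<^esub> k \<otimes>\<^bsub>freeFxy\<^esub> y\<^sub>F = y\<^sub>F \<otimes>\<^bsub>freeFxy\<^esub> y\<^sub>F [^]\<^bsub>freeFxy\<^esub> k"
      using Fxy.int_pow_mult[of "y\<^sub>F" k 1] Fxy.int_pow_mult[of "y\<^sub>F" 1 k] by (simp add: add.commute)
    then have "twist k \<otimes>\<^bsub>freeFxy\<^esub> y\<^sub>F = x\<^sub>F \<otimes>\<^bsub>freeFxy\<^esub> y\<^sub>F \<otimes>\<^bsub>freeFxy\<^esub> y\<^sub>F [^]\<^bsub>freeFxy\<^esub> k"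
      by (simp add: Fxy.m_assoc)
    then have "commutator freeFxy (twist k) y\<^sub>F =
        x\<^sub>F \<otimes>\<^bsub>freeFxy\<^esub> y\<^sub>F \<otimes>\<^bsub>freeFxy\<^esub> y\<^sub>F [^]\<^bsub>freeFxy\<^esub> k \<otimes>\<^bsub>freeFxy\<^esub> inv\<^bsub>freeFxy\<^esub> (twist k) \<otimes>\<^bsub>freeFxy\<^esub> inv\<^bsub>freeFxy\<^esub> y\<^sub>F"
      unfolding commutator_def by simp
    also have "\<dots> = commutator freeFxy x\<^sub>F y\<^sub>F"
      by (simp add: commutator_def Fxy.inv_mult_group Fxy.m_assoc Fxy.cancel_left_inv)
    finally show ?thesis .
  qed
  then show ?thesis
    unfolding shear_def using tw[of k] tw[of "- k"]
    by (intro xy_map_auto[where a' = "twist (- k)" and b' = "y\<^sub>F"]) simp_all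
qed

text \<open>The inverse comes from solving X = x y x^-1 and Y = x^-1 for x and y: x = Y^-1 and y = Y
  X Y^-1.\<close>

lemma turn_auto: "turn \<in> commutator_autos"
  unfolding turn_def
proof (rule xy_map_auto[where a' = "inv\<^bsub>freeFxy\<^esub> y\<^sub>F" and b' = "y\<^sub>F \<otimes>\<^bsub>freeFxy\<^esub> x\<^sub>F \<otimes>\<^bsub>freeFxy\<^esub> inv\<^bsub>freeFxy\<^esub> y\<^sub>F"])
  let ?X = "x\<^sub>F \<otimes>\<^bsub>freeFxy\<^esub> y\<^sub>F \<otimes>\<^bsub>freeFxy\<^esub> inv\<^bsub>freeFxy\<^esub> x\<^sub>F" and ?Y = "inv\<^bsub>freeFxy\<^esub> x\<^sub>F"
  let ?X' = "inv\<^bsub>freeFxy\<^esub> y\<^sub>F" and ?Y' = "y\<^sub>F \<otimes>\<^bsub>freeFxy\<^esub> x\<^sub>F \<otimes>\<^bsub>freeFxy\<^esub> inv\<^bsub>freeFxy\<^esub> y\<^sub>F"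
  interpret e: group_hom freeFxy freeFxy "eval_word freeFxy (xy_map ?X ?Y)"
    by (rule xy_map_hom) simp_all
  interpret e': group_hom freeFxy freeFxy "eval_word freeFxy (xy_map ?X' ?Y')"
    by (rule xy_map_hom) simp_all
  show "eval_word freeFxy (xy_map ?X ?Y) ?X' = x\<^sub>F" by simp
  show "eval_word freeFxy (xy_map ?X ?Y) ?Y' = y\<^sub>F" by (simp add: Fxy.m_assoc Fxy.cancel_left_inv)
  show "eval_word freeFxy (xy_map ?X' ?Y') ?X = x\<^sub>F" by (simp add: Fxy.m_assoc Fxy.cancel_left_inv)
  show "eval_word freeFxy (xy_map ?X' ?Y') ?Y = y\<^sub>F" by simp
  show "commutator freeFxy ?X ?Y = commutator freeFxy x\<^sub>F y\<^sub>F"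
    by (simp add: commutator_def Fxy.inv_mult_group Fxy.m_assoc Fxy.cancel_left_inv)
qed simp_all


section \<open>Extending automorphisms to F\<close>

lemma commutator_autosD:
  assumes "\<alpha> \<in> commutator_autos"
  shows "\<alpha> \<in> auto freeFxy" "\<alpha> (commutator freeFxy x\<^sub>F y\<^sub>F) = commutator freeFxy x\<^sub>F y\<^sub>F"
  using assms by (auto simp: commutator_autos_def)

lemma auto_group_hom: "\<alpha> \<in> auto freeFxy \<Longrightarrow> group_hom freeFxy freeFxy \<alpha>"
  by (simp add: auto_def group_hom_def group_hom_axioms_def Fxy.is_group)

lemma mult_AutoGroup_freeFxy:
  "\<alpha> \<in> auto freeFxy \<Longrightarrow> \<beta> \<in> auto freeFxy \<Longrightarrow>
    \<alpha> \<otimes>\<^bsub>AutoGroup freeFxy\<^esub> \<beta> = compose (carrier freeFxy) \<alpha> \<beta>"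
  by (simp add: AutoGroup_def BijGroup_def auto_def)

lemma compose_auto:
  assumes "\<alpha> \<in> auto freeFxy" "\<beta> \<in> auto freeFxy"
  shows "compose (carrier freeFxy) \<alpha> \<beta> \<in> auto freeFxy"
proof -
  interpret A: group "AutoGroup freeFxy" by (rule Fxy.AutoGroup)
  show ?thesis
    using A.m_closed[of \<alpha> \<beta>] assms mult_AutoGroup_freeFxy[OF assms] by (simp add: AutoGroup_def)
qed

lemma compose_commutator_autos:
  assumes "\<alpha> \<in> commutator_autos" "\<beta> \<in> commutator_autos"
  shows "compose (carrier freeFxy) \<alpha> \<beta> \<in> commutator_autos"
proof -
  have "commutator freeFxy x\<^sub>F y\<^sub>F \<in> carrier freeFxy" by (simp add: commutator_def)
  then show ?thesis using assms compose_auto by (simp add: commutator_autos_def compose_eq)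
qed

lemma carrier_freeFxy_sub: "carrier freeFxy \<subseteq> carrier (freeF d)"
  unfolding freeFxy_def freeF_def by (rule free_group_mono) (simp add: gens_def)

lemma extend_to_F_hom:
  assumes "\<alpha> \<in> auto freeFxy"
  shows "group_hom (freeF d) (freeF d) (extend_to_F d \<alpha>)"
proof -
  interpret a: group_hom freeFxy freeFxy \<alpha> using assms by (rule auto_group_hom)
  have "\<alpha> x\<^sub>F \<in> carrier (freeF d)" "\<alpha> y\<^sub>F \<in> carrier (freeF d)"
    using carrier_freeFxy_sub[of d] a.hom_closed[of "x\<^sub>F"] a.hom_closed[of "y\<^sub>F"] by auto
  then show ?thesis
    unfolding extend_to_F_def freeF_def
    by (intro group_hom_eval_free_group) (auto simp: gens_def intro!: free_gen_closed)
qed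

lemma extend_to_F_gen:
  assumes "\<alpha> \<in> auto freeFxy"
  shows "extend_to_F d \<alpha> x\<^sub>F = \<alpha> x\<^sub>F" "extend_to_F d \<alpha> y\<^sub>F = \<alpha> y\<^sub>F"
    and "1 \<le> j \<Longrightarrow> j \<le> d \<Longrightarrow> extend_to_F d \<alpha> (z\<^sub>F j) = z\<^sub>F j"
proof -
  interpret F: group "freeF d" by (rule group_freeF)
  interpret a: group_hom freeFxy freeFxy \<alpha> using assms by (rule auto_group_hom)
  have "\<alpha> x\<^sub>F \<in> carrier (freeF d)" "\<alpha> y\<^sub>F \<in> carrier (freeF d)"
    using carrier_freeFxy_sub[of d] a.hom_closed[of "x\<^sub>F"] a.hom_closed[of "y\<^sub>F"] by auto
  then show "extend_to_F d \<alpha> x\<^sub>F = \<alpha> x\<^sub>F" "extend_to_F d \<alpha> y\<^sub>F = \<alpha> y\<^sub>F"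
    unfolding extend_to_F_def by simp_all
  show "1 \<le> j \<Longrightarrow> j \<le> d \<Longrightarrow> extend_to_F d \<alpha> (z\<^sub>F j) = z\<^sub>F j"
    unfolding extend_to_F_def by (simp add: free_gen_closed_freeF gens_def)
qed

lemma extend_to_F_freeFxy:
  assumes "\<alpha> \<in> auto freeFxy" "w \<in> carrier freeFxy"
  shows "extend_to_F d \<alpha> w = \<alpha> w"
proof (rule hom_free_group_eq[of "{GX, GY}" "freeF d" "extend_to_F d \<alpha>" \<alpha>])
  show "group_hom (free_group {GX, GY}) (freeF d) (extend_to_F d \<alpha>)"
    using extend_to_F_hom[OF assms(1)] unfolding freeF_def
    by (rule group_hom_restrict_free_group) (simp add: gens_def)
  interpret a: group_hom freeFxy freeFxy \<alpha> using assms(1) by (rule auto_group_hom)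
  show "group_hom (free_group {GX, GY}) (freeF d) \<alpha>"
    using a.hom_closed carrier_freeFxy_sub[of d] a.hom_mult
    by (auto simp: group_hom_def group_hom_axioms_def group_freeF group_free_group hom_def
        freeFxy_def freeF_def mult_free_group)
qed (use assms extend_to_F_gen[OF assms(1)] in \<open>auto simp: freeFxy_def\<close>)

lemma extend_to_F_compose:
  assumes "\<alpha> \<in> auto freeFxy" "\<beta> \<in> auto freeFxy" "w \<in> carrier (freeF d)"
  shows "extend_to_F d (compose (carrier freeFxy) \<alpha> \<beta>) w = extend_to_F d \<alpha> (extend_to_F d \<beta> w)"
proof (rule hom_free_group_eq[of "gens d" "freeF d" _ "\<lambda>w. extend_to_F d \<alpha> (extend_to_F d \<beta> w)"])
  show "group_hom (free_group (gens d)) (freeF d) (extend_to_F d (compose (carrier freeFxy) \<alpha> \<beta>))"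
    using extend_to_F_hom[OF compose_auto[OF assms(1,2)]] by (simp add: freeF_def)
  show "group_hom (free_group (gens d)) (freeF d) (\<lambda>w. extend_to_F d \<alpha> (extend_to_F d \<beta> w))"
    using group_hom_comp[OF extend_to_F_hom[OF assms(2)] extend_to_F_hom[OF assms(1)]]
    by (simp add: freeF_def)
  interpret b: group_hom freeFxy freeFxy \<beta> using assms(2) by (rule auto_group_hom)
  show "extend_to_F d (compose (carrier freeFxy) \<alpha> \<beta>) (free_gen a) = extend_to_F d \<alpha> (extend_to_F d \<beta> (free_gen a))"
    if "a \<in> gens d" for a
    using that extend_to_F_gen[OF assms(1)] extend_to_F_gen[OF assms(2)]
      extend_to_F_gen[OF compose_auto[OF assms(1,2)]] extend_to_F_freeFxy[OF assms(1)] b.hom_closed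
    by (auto simp: gens_def compose_eq)
qed (use assms(3) in \<open>simp add: freeF_def\<close>)

lemma extend_to_F_inverse:
  assumes "\<alpha> \<in> commutator_autos"
  obtains \<beta> where "\<beta> \<in> commutator_autos"
    "\<And>w. w \<in> carrier (freeF d) \<Longrightarrow> extend_to_F d \<alpha> (extend_to_F d \<beta> w) = w"
    "\<And>w. w \<in> carrier (freeF d) \<Longrightarrow> extend_to_F d \<beta> (extend_to_F d \<alpha> w) = w"
proof -
  interpret A: group "AutoGroup freeFxy" by (rule Fxy.AutoGroup)
  let ?c = "commutator freeFxy x\<^sub>F y\<^sub>F"
  define \<beta> where "\<beta> = inv\<^bsub>AutoGroup freeFxy\<^esub> \<alpha>"
  have car: "carrier (AutoGroup freeFxy) = auto freeFxy" by (simp add: AutoGroup_def)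
  have \<alpha>: "\<alpha> \<in> auto freeFxy" using assms by (rule commutator_autosD)
  have \<beta>: "\<beta> \<in> auto freeFxy" using A.inv_closed[of \<alpha>] \<alpha> car by (simp add: \<beta>_def)
  \<comment> \<open>The identity of \<open>AutoGroup\<close> is the identity function restricted to
    the carrier, so its extension to F has to be shown to be trivial separately.\<close>
  define I where "I = (\<lambda>w \<in> carrier freeFxy. w)"
  have id: "\<one>\<^bsub>AutoGroup freeFxy\<^esub> = I" by (simp add: I_def AutoGroup_def BijGroup_def)
  have "compose (carrier freeFxy) \<alpha> \<beta> = \<one>\<^bsub>AutoGroup freeFxy\<^esub>"
      "compose (carrier freeFxy) \<beta> \<alpha> = \<one>\<^bsub>AutoGroup freeFxy\<^esub>"
    using mult_AutoGroup_freeFxy[OF \<alpha> \<beta>] mult_AutoGroup_freeFxy[OF \<beta> \<alpha>] \<alpha> car A.r_inv[of \<alpha>] A.l_inv[of \<alpha>]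
    by (simp_all add: \<beta>_def)
  then have comp: "compose (carrier freeFxy) \<alpha> \<beta> = I"
      "compose (carrier freeFxy) \<beta> \<alpha> = I" using id by simp_all
  have id_auto: "I \<in> auto freeFxy" unfolding I_def by (rule Fxy.id_in_auto)
  have "I x\<^sub>F = x\<^sub>F" "I y\<^sub>F = y\<^sub>F" by (simp_all add: I_def)
  note I_gen = extend_to_F_gen[OF id_auto, where d = d, unfolded this]
  have ext_id: "extend_to_F d I w = w" if "w \<in> carrier (freeF d)" for w
  proof (rule hom_free_group_eq[of "gens d" "freeF d" _ "\<lambda>w. w"])
    show "group_hom (free_group (gens d)) (freeF d) (extend_to_F d I)"
      using extend_to_F_hom[OF id_auto] by (simp add: freeF_def)
    show "group_hom (free_group (gens d)) (freeF d) (\<lambda>w. w)"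
      by (simp add: freeF_def group_hom_id group_free_group)
  qed (use I_gen that in \<open>auto simp: gens_def freeF_def\<close>)
  have c: "?c \<in> carrier freeFxy" by (simp add: commutator_def)
  have "\<beta> ?c = \<beta> (\<alpha> ?c)" using commutator_autosD[OF assms] by simp
  also have "\<dots> = ?c" using comp(2) c by (metis I_def compose_eq restrict_apply')
  finally have "\<beta> \<in> commutator_autos" using \<beta> by (simp add: commutator_autos_def)
  then show ?thesis
    using that[of \<beta>] extend_to_F_compose[OF \<alpha> \<beta>] extend_to_F_compose[OF \<beta> \<alpha>] comp ext_id by simp
qed

section \<open>Euclid's algorithm on the exponent sums\<close>

lemma sums_shear:
  assumes "w \<in> carrier (freeF d)"
  shows "xsum (extend_to_F d (shear k) w) = xsum w"
    and "ysum (extend_to_F d (shear k) w) = ysum w + k * xsum w"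
proof -
  interpret xf: group_hom "freeF d" integer_group xsum using xsum_hom by (simp add: freeF_def)
  interpret yf: group_hom "freeF d" integer_group ysum using ysum_hom by (simp add: freeF_def)
  interpret x2: group_hom freeFxy integer_group xsum using xsum_hom by (simp add: freeFxy_def)
  interpret y2: group_hom freeFxy integer_group ysum using ysum_hom by (simp add: freeFxy_def)
  have au: "shear k \<in> auto freeFxy" using commutator_autosD(1)[OF shear_auto] .
  note E = extend_to_F_hom[OF au, of d]
  have gen: "xsum (extend_to_F d (shear k) (free_gen a)) = xsum (free_gen a)"
    "ysum (extend_to_F d (shear k) (free_gen a)) = ysum (free_gen a) + k * xsum (free_gen a)" if "a \<in> gens d" for a
    using that by (auto simp: gens_def extend_to_F_gen[OF au] shear_x shear_y x2.hom_int_pow y2.hom_int_pow)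
  show "xsum (extend_to_F d (shear k) w) = xsum w"
    using hom_free_group_eq[of "gens d" integer_group "\<lambda>w. xsum (extend_to_F d (shear k) w)" xsum w]
      group_hom_comp[OF E xf.group_hom_axioms] xsum_hom assms gen(1) by (simp add: freeF_def)
  have "group_hom (freeF d) integer_group (\<lambda>w. ysum w + k * xsum w)"
    by (simp add: group_hom_def group_hom_axioms_def group_freeF hom_def algebra_simps)
  then show "ysum (extend_to_F d (shear k) w) = ysum w + k * xsum w"
    using hom_free_group_eq[of "gens d" integer_group "\<lambda>w. ysum (extend_to_F d (shear k) w)" "\<lambda>w. ysum w + k * xsum w" w]
      group_hom_comp[OF E yf.group_hom_axioms] assms gen(2) by (simp add: freeF_def)
qed

lemma sums_turn:
  assumes "w \<in> carrier (freeF d)"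
  shows "xsum (extend_to_F d turn w) = - ysum w"
    and "ysum (extend_to_F d turn w) = xsum w"
proof -
  interpret xf: group_hom "freeF d" integer_group xsum using xsum_hom by (simp add: freeF_def)
  interpret yf: group_hom "freeF d" integer_group ysum using ysum_hom by (simp add: freeF_def)
  interpret x2: group_hom freeFxy integer_group xsum using xsum_hom by (simp add: freeFxy_def)
  interpret y2: group_hom freeFxy integer_group ysum using ysum_hom by (simp add: freeFxy_def)
  have au: "turn \<in> auto freeFxy" using commutator_autosD(1)[OF turn_auto] .
  note E = extend_to_F_hom[OF au, of d]
  have gen: "xsum (extend_to_F d turn (free_gen a)) = - ysum (free_gen a)"
    "ysum (extend_to_F d turn (free_gen a)) = xsum (free_gen a)" if "a \<in> gens d" for a
    using that by (auto simp: gens_def extend_to_F_gen[OF au] turn_x turn_y)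
  have "group_hom (freeF d) integer_group (\<lambda>w. - ysum w)"
    by (simp add: group_hom_def group_hom_axioms_def group_freeF hom_def)
  then show "xsum (extend_to_F d turn w) = - ysum w"
    using hom_free_group_eq[of "gens d" integer_group "\<lambda>w. xsum (extend_to_F d turn w)" "\<lambda>w. - ysum w" w]
      group_hom_comp[OF E xf.group_hom_axioms] assms gen(1) by (simp add: freeF_def)
  show "ysum (extend_to_F d turn w) = xsum w"
    using hom_free_group_eq[of "gens d" integer_group "\<lambda>w. ysum (extend_to_F d turn w)" xsum w]
      group_hom_comp[OF E yf.group_hom_axioms] xsum_hom assms gen(2) by (simp add: freeF_def)
qed

lemma ex_auto_sums:
  assumes "w \<in> carrier (freeF d)"
  shows "\<exists>\<alpha> \<in> commutator_autos. ysum (extend_to_F d \<alpha> w) = 0 \<and> xsum (extend_to_F d \<alpha> w) \<ge> 0"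
  using assms
proof (induction "nat \<bar>ysum w\<bar>" arbitrary: w rule: less_induct)
  case less
  have tu: "turn \<in> auto freeFxy" using commutator_autosD(1)[OF turn_auto] .
  have sh: "shear k \<in> auto freeFxy" for k using commutator_autosD(1)[OF shear_auto] .
  let ?w1 = "extend_to_F d turn w"
  have w1: "?w1 \<in> carrier (freeF d)"
    using group_hom.hom_closed[OF extend_to_F_hom[OF tu] less.prems] .
  show ?case
  proof (cases "ysum w = 0")
    case True
    show ?thesis
    proof (cases "xsum w \<ge> 0")
      case True
      then show ?thesis
        \<comment> \<open>\<open>shear 0\<close> serves as the identity.\<close>
        using sums_shear[OF less.prems, of 0] \<open>ysum w = 0\<close> by (intro bexI[OF _ shear_auto[of 0]]) simp
    next
      case False
      then show ?thesis
        \<comment> \<open>Two turns negate both exponent sums.\<close>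
        using sums_turn[OF less.prems] sums_turn[OF w1] \<open>ysum w = 0\<close> extend_to_F_compose[OF tu tu less.prems]
        by (intro bexI[OF _ compose_commutator_autos[OF turn_auto turn_auto]]) simp
    qed
  next
    case False
    \<comment> \<open>For sums (a, b), a turn gives (-b, a), and a shear by a div b then replaces
      the second entry by a mod b, which is smaller than b in absolute value.\<close>
    let ?s = "shear (xsum w div ysum w)"
    let ?w2 = "extend_to_F d ?s ?w1"
    have w2: "?w2 \<in> carrier (freeF d)"
      using group_hom.hom_closed[OF extend_to_F_hom[OF sh] w1] .
    have "ysum ?w2 = xsum w mod ysum w"
      using sums_shear(2)[OF w1] sums_turn[OF less.prems] by (simp flip: minus_div_mult_eq_mod)
    then have "nat \<bar>ysum ?w2\<bar> < nat \<bar>ysum w\<bar>"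
      using False abs_mod_less[of "ysum w" "xsum w"] by simp
    then obtain \<alpha> where \<alpha>: "\<alpha> \<in> commutator_autos"
        "ysum (extend_to_F d \<alpha> ?w2) = 0" "xsum (extend_to_F d \<alpha> ?w2) \<ge> 0"
      using less.hyps[OF _ w2] by blast
    have st: "compose (carrier freeFxy) ?s turn \<in> commutator_autos"
      by (rule compose_commutator_autos[OF shear_auto turn_auto])
    have "extend_to_F d (compose (carrier freeFxy) \<alpha> (compose (carrier freeFxy) ?s turn)) w = extend_to_F d \<alpha> ?w2"
      using extend_to_F_compose[OF commutator_autosD(1)[OF \<alpha>(1)] commutator_autosD(1)[OF st] less.prems]
        extend_to_F_compose[OF sh tu less.prems] by simp
    then show ?thesis
      using \<alpha> by (intro bexI[OF _ compose_commutator_autos[OF \<alpha>(1) st]]) simp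
  qed
qed

section \<open>From normal forms to relators\<close>

lemma eval_word_map:
  "eval_word G g (map (map_prod f id) w) = eval_word G (\<lambda>a. g (f a)) w"
  by (induction w) (simp_all add: eval_word_def split: prod.splits)

text \<open>Needed because \<open>cyclically_reduced_wrt\<close> uses group elements as letters: a
  word over \<open>kernel_basis d\<close> is renamed along \<open>\<sigma>\<close>, and injectivity
  ensures that no new cancelling pairs arise.\<close>

lemma cyclically_reduced_map:
  assumes "inj_on f (fst ` set w)" "cyclically_reduced w"
  shows "cyclically_reduced (map (map_prod f id) w)"
proof -
  have iff: "map_prod f id q = inv_letter (map_prod f id p) \<longleftrightarrow> q = inv_letter p"
    if "p \<in> set w" "q \<in> set w" for p q
    using inj_on_eq_iff[OF assms(1), of "fst q" "fst p"] that
    by (cases p; cases q) (simp add: inv_letter_def rev_image_eqI)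
  have "reduced (map (map_prod f id) w)"
    unfolding reduced_def successively_map
    by (rule successively_mono[of "\<lambda>p q. q \<noteq> inv_letter p"])
      (use assms(2) iff in \<open>simp_all add: cyclically_reduced_def reduced_def\<close>)
  moreover have "hd (map (map_prod f id) w) \<noteq> inv_letter (last (map (map_prod f id) w))" if "w \<noteq> []"
    using that assms(2) iff[of "last w" "hd w"] by (simp add: hd_map last_map cyclically_reduced_def)
  ultimately show ?thesis by (simp add: cyclically_reduced_def)
qed

lemma normal_vimage:
  assumes "group_hom G H h" "M \<lhd> H"
  shows "{g \<in> carrier G. h g \<in> M} \<lhd> G"
proof -
  interpret h: group_hom G H h by fact
  interpret M: normal M H by fact
  have *: "h x \<otimes>\<^bsub>H\<^esub> m \<otimes>\<^bsub>H\<^esub> inv\<^bsub>H\<^esub> h x \<in> M" if "x \<in> carrier G" "m \<in> M" for x m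
    using that assms(2) by (auto simp: h.H.normal_inv_iff)
  show ?thesis
    unfolding h.G.normal_inv_iff
    by (auto intro!: h.G.subgroupI exI[of _ "\<one>\<^bsub>G\<^esub>"] simp: *)
qed

lemma FactGroup_iso_set_apply:
  assumes h: "group_hom G H h" "h ` carrier G = carrier H" and M: "kernel G H h = M" and g: "g \<in> carrier G"
  shows "\<exists>f \<in> iso (G Mod M) H. f (M #>\<^bsub>G\<^esub> g) = h g"
proof -
  interpret h: group_hom G H h by fact
  interpret M: normal M G using h.normal_kernel M by simp
  have "h x = h g" if "x \<in> M #>\<^bsub>G\<^esub> g" for x
    using that g unfolding r_coset_def M[symmetric] kernel_def by auto
  moreover have "g \<in> M #>\<^bsub>G\<^esub> g" using g normal_imp_subgroup[OF M.normal_axioms] by (rule h.G.rcos_self)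
  ultimately have "h ` (M #>\<^bsub>G\<^esub> g) = {h g}" by blast
  then show ?thesis using h.FactGroup_iso_set[OF h(2)] M
    by (intro bexI[of _ "\<lambda>A. the_elem (h ` A)"]) simp_all
qed

context surface_presentation
begin

section \<open>Logarithms and relators obtained from the section\<close>

lemma ysum_eq: "w \<in> carrier F \<Longrightarrow> snd (\<psi> w) = ysum w"
proof (rule hom_free_group_eq[of "gens d" integer_group "\<lambda>w. snd (\<psi> w)" ysum])
  show "group_hom (free_group (gens d)) integer_group (\<lambda>w. snd (\<psi> w))"
    using group_hom_comp[OF \<psi>.group_hom_axioms mapping_torus_snd] by (simp add: freeF_def)
  show "snd (\<psi> (free_gen a)) = ysum (free_gen a)" if "a \<in> gens d" for a
    using that by (auto simp: gens_def)
qed (simp_all add: ysum_hom freeF_def)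

lemma xsum_hom_F: "group_hom F integer_group xsum"
  using xsum_hom by (simp add: freeF_def)

lemma xsum_u: "xsum u = 0"
proof (rule homs_agree_u[OF xsum_hom, of "\<lambda>_. 0"])
  show "group_hom (free_group (GZ ` {1..d})) integer_group (\<lambda>_. 0)"
    by (simp add: group_hom_def group_hom_axioms_def group_free_group hom_def)
qed simp

text \<open>The exponent sum of x is thus well defined on S. It is used to identify the exponent of
  a power of x from its image in S.\<close>

lemma xsum_N: "v \<in> N \<Longrightarrow> xsum v = 0"
proof -
  interpret x: group_hom F integer_group xsum by (rule xsum_hom_F)
  have "xsum rel = 0" by (simp add: surface_relator_def commutator_def xsum_u)
  then have "N \<subseteq> kernel F integer_group xsum"
    by (intro normal_closure_least[OF x.normal_kernel]) (simp add: kernel_def)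
  then show "v \<in> N \<Longrightarrow> xsum v = 0" by (auto simp: kernel_def)
qed

lemma F_free: "F = free_group (gens d)"
  by (simp add: freeF_def)

text \<open>A maximal root of c in \<open>K\<close> is sent to \<open>T\<close> by the embedding and
  to F by \<open>s\<close>, and \<open>\<psi>\<close> matches the two images. The root in
  \<open>T\<close> is maximal, so the one in F is maximal by \<open>max_root_pullback\<close>, with
  the same n.\<close>

lemma group_log_conj_section:
  assumes c: "c \<in> carrier K" "c \<noteq> []" and q: "q \<in> carrier F"
  defines "g \<equiv> q \<otimes>\<^bsub>F\<^esub> s c \<otimes>\<^bsub>F\<^esub> inv\<^bsub>F\<^esub> q"
  shows "\<exists>C n. max_root T (\<psi> g) C n \<and> group_log F g = enat n"
proof -
  obtain c' n where root: "max_root K c c' n" using free_group_max_root[OF c] by blast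
  then have c': "c' \<in> carrier K" "c' [^]\<^bsub>K\<^esub> n = c" by (auto simp: max_root_def)
  define C where "C = q \<otimes>\<^bsub>F\<^esub> s c' \<otimes>\<^bsub>F\<^esub> inv\<^bsub>F\<^esub> q"
  interpret q: group_hom F F "\<lambda>x. q \<otimes>\<^bsub>F\<^esub> x \<otimes>\<^bsub>F\<^esub> inv\<^bsub>F\<^esub> q"
    using F.conj_hom[OF q] by (simp add: group_hom_def group_hom_axioms_def group_freeF)
  have C: "C \<in> carrier F" using q c' by (simp add: C_def)
  have Cn: "C [^]\<^bsub>F\<^esub> n = g"
    using q.hom_nat_pow[OF s.hom_closed[OF c'(1)], of n] s.hom_nat_pow[OF c'(1), of n] c'(2)
    by (simp add: C_def g_def)
  have "max_root T (\<psi> q \<otimes>\<^bsub>T\<^esub> (c, 0) \<otimes>\<^bsub>T\<^esub> inv\<^bsub>T\<^esub> \<psi> q) (\<psi> q \<otimes>\<^bsub>T\<^esub> (c', 0) \<otimes>\<^bsub>T\<^esub> inv\<^bsub>T\<^esub> \<psi> q) n"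
    by (rule T.max_root_conj[OF max_root_mapping_torus[OF root] \<psi>.hom_closed[OF q]])
  then have rT: "max_root T (\<psi> g) (\<psi> C) n"
    using q c c' by (simp add: g_def C_def \<psi>_s)
  have "max_root F g C n"
    by (rule max_root_pullback[OF \<psi>.group_hom_axioms rT C Cn])
      (use free_group_unique_roots[of _ "gens d"] in \<open>simp add: F_free\<close>)
  then show ?thesis using rT F.group_log_eq_max_root by blast
qed

lemma \<sigma>_inj: "inj_on \<sigma> (kernel_basis d)"
proof (rule inj_onI)
  fix a b assume ab: "a \<in> kernel_basis d" "b \<in> kernel_basis d" "\<sigma> a = \<sigma> b"
  have s: "s (free_gen a) = \<sigma> a" if "a \<in> kernel_basis d" for a
    using \<sigma>_closed that unfolding s_def by (intro F.eval_word_free_gen) auto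
  have "free_gen a = free_gen b"
    using s_inj[of "free_gen a" "free_gen b"] ab by (simp add: s free_gen_closed)
  then show "a = b" by (simp add: free_gen_def)
qed

lemma generate_\<sigma>: "I \<subseteq> kernel_basis d \<Longrightarrow> generate F (\<sigma> ` I) = s ` carrier (free_group I)"
  unfolding s_def using \<sigma>_closed by (intro F.generate_eq_eval_word_image) blast

lemma X1_eq: "X1 d = \<sigma> ` kernel_band d {0..}" and X1_upper_eq: "X1_upper d = \<sigma> ` kernel_band d {1..}"
  by (force simp: X1_def X1_upper_def kernel_band_def \<sigma>_def)+

lemma hempel_relator_section:
  assumes "hempel_form b"
  shows "hempel_relator d u (s b)"
proof -
  have b: "b \<in> KI {0..}" "cyclically_reduced b" "b \<notin> KI {1..}"
    and nconj: "\<And>h n. h \<in> KI {0..} \<Longrightarrow> b \<noteq> h \<otimes>\<^bsub>K\<^esub> x0 [^]\<^bsub>K\<^esub> (n::int) \<otimes>\<^bsub>K\<^esub> inv\<^bsub>K\<^esub> h"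
    using assms unfolding hempel_form_def by blast+
  have bK: "b \<in> carrier K" using b KI_closed by blast
  have gX1: "generate F (X1 d) = s ` KI {0..}" and gX1u: "generate F (X1_upper d) = s ` KI {1..}"
    unfolding X1_eq X1_upper_eq by (rule generate_\<sigma>[OF kernel_band_sub])+
  \<comment> \<open>This equality holds in F itself, not only modulo \<open>N\<close>, so R2 can be
    tested inside \<open>K\<close>.\<close>
  have sx0: "inv\<^bsub>F\<^esub> u \<otimes>\<^bsub>F\<^esub> y_conj d 1 x\<^sub>F = s x0"
    by (simp add: s_lu) (simp add: y_conj_def)
  have "False" if g: "g \<in> generate F (X1 d)" and c: "c \<in> generate F {inv\<^bsub>F\<^esub> u \<otimes>\<^bsub>F\<^esub> y_conj d 1 x\<^sub>F}"
    and eq: "s b = g \<otimes>\<^bsub>F\<^esub> c \<otimes>\<^bsub>F\<^esub> inv\<^bsub>F\<^esub> g" for g c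
  proof -
    obtain h where h: "h \<in> KI {0..}" "g = s h" using g gX1 by blast
    obtain n :: int where n: "c = s x0 [^]\<^bsub>F\<^esub> n"
      using c F.generate_pow[of "s x0"] unfolding sx0 by auto
    have hK: "h \<in> carrier K" using h KI_closed by blast
    have "s b = s (h \<otimes>\<^bsub>K\<^esub> x0 [^]\<^bsub>K\<^esub> n \<otimes>\<^bsub>K\<^esub> inv\<^bsub>K\<^esub> h)"
      unfolding eq h n using hK s.hom_int_pow[of x0 n] by simp
    moreover have "h \<otimes>\<^bsub>K\<^esub> x0 [^]\<^bsub>K\<^esub> n \<otimes>\<^bsub>K\<^esub> inv\<^bsub>K\<^esub> h \<in> carrier K" using hK by simp
    ultimately have "b = h \<otimes>\<^bsub>K\<^esub> x0 [^]\<^bsub>K\<^esub> n \<otimes>\<^bsub>K\<^esub> inv\<^bsub>K\<^esub> h"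
      using s_inj[OF bK] by blast
    then show False using nconj[OF h(1)] by blast
  qed
  moreover have "cyclically_reduced_wrt F (X1 d) (s b)"
    unfolding cyclically_reduced_wrt_def
  proof (intro exI[of _ "map (map_prod \<sigma> id) b"] conjI)
    have sub: "fst ` set b \<subseteq> kernel_band d {0..}" using b by (simp add: carrier_free_group)
    then show "fst ` set (map (map_prod \<sigma> id) b) \<subseteq> X1 d"
      unfolding X1_eq by (auto simp: image_subset_iff)
    show "cyclically_reduced (map (map_prod \<sigma> id) b)"
      using sub kernel_band_sub by (intro cyclically_reduced_map inj_on_subset[OF \<sigma>_inj] b) blast
    show "eval_word F (\<lambda>a. a) (map (map_prod \<sigma> id) b) = s b"
      by (simp add: eval_word_map s_def)
  qed
  moreover have "s b \<notin> generate F (X1_upper d)"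
    using b(3) s_inj[OF bK] KI_closed unfolding gX1u by blast
  moreover have "s b \<in> generate F (X1 d)" using b(1) gX1 by blast
  ultimately show ?thesis unfolding hempel_relator_def by blast
qed

text \<open>The kernel basis contains y x y^-1 in place of x, so powers of x come under
  \<open>group_log_conj_section\<close> only after a conjugation by y.\<close>

lemma x_pow_eq_conj_section:
  "x\<^sub>F [^]\<^bsub>F\<^esub> (n::int) = inv\<^bsub>F\<^esub> y\<^sub>F \<otimes>\<^bsub>F\<^esub> s (t [^]\<^bsub>K\<^esub> n) \<otimes>\<^bsub>F\<^esub> inv\<^bsub>F\<^esub> (inv\<^bsub>F\<^esub> y\<^sub>F)"
proof -
  interpret q: group_hom F F "\<lambda>g. inv\<^bsub>F\<^esub> y\<^sub>F \<otimes>\<^bsub>F\<^esub> g \<otimes>\<^bsub>F\<^esub> inv\<^bsub>F\<^esub> (inv\<^bsub>F\<^esub> y\<^sub>F)"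
    using F.conj_hom[of "inv\<^bsub>F\<^esub> y\<^sub>F"] by (simp add: group_hom_def group_hom_axioms_def group_freeF)
  have "inv\<^bsub>F\<^esub> y\<^sub>F \<otimes>\<^bsub>F\<^esub> s t \<otimes>\<^bsub>F\<^esub> inv\<^bsub>F\<^esub> (inv\<^bsub>F\<^esub> y\<^sub>F) = x\<^sub>F"
    by (simp add: y_conj_eq F.m_assoc F.cancel_left_inv)
  then show ?thesis
    using q.hom_int_pow[OF s.hom_closed[OF t_closed], of n] s.hom_int_pow[OF t_closed, of n] by simp
qed

lemma extend_to_F_rel:
  assumes "\<alpha> \<in> commutator_autos"
  shows "extend_to_F d \<alpha> rel = rel"
proof -
  note \<alpha> = commutator_autosD[OF assms]
  interpret e: group_hom F F "extend_to_F d \<alpha>" by (rule extend_to_F_hom[OF \<alpha>(1)])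
  have "extend_to_F d \<alpha> u = u"
  proof (rule homs_agree_u[of F "extend_to_F d \<alpha>" "\<lambda>w. w"])
    show "group_hom (free_group (GZ ` {1..d})) F (extend_to_F d \<alpha>)"
      using e.group_hom_axioms unfolding F_free by (rule group_hom_restrict_free_group[OF _ gens_sub])
    show "group_hom (free_group (GZ ` {1..d})) F (\<lambda>w. w)"
      using group_hom_id[OF group_free_group] unfolding F_free by (rule group_hom_restrict_free_group[OF _ gens_sub])
  qed (rule extend_to_F_gen[OF \<alpha>(1)])
  \<comment> \<open>The two commutators, formed in F and in the free group on x and y, are the same
    reduced word.\<close>
  moreover have comm: "commutator F x\<^sub>F y\<^sub>F = commutator freeFxy x\<^sub>F y\<^sub>F"
    using inv_free_group[of "x\<^sub>F" "gens d"] inv_free_group[of "y\<^sub>F" "gens d"]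
      inv_free_group[of "x\<^sub>F" "{GX, GY}"] inv_free_group[of "y\<^sub>F" "{GX, GY}"]
      x_closed y_closed xy_closed
    by (simp add: commutator_def mult_free_group freeFxy_def F_free)
  moreover have "commutator freeFxy x\<^sub>F y\<^sub>F \<in> carrier freeFxy"
    using group.subgroup_self[OF group_free_group] xy_closed
    by (simp add: commutator_def freeFxy_def group.is_monoid monoid.m_closed group.inv_closed group_free_group)
  ultimately show ?thesis
    using commutator_closed extend_to_F_freeFxy[OF \<alpha>(1)] \<alpha>(2) by (simp add: surface_relator_def)
qed

end

text \<open>With f and g mutually inverse, the two inclusions give that w lies in one normal closure
  exactly when f w lies in the other. Hence f followed by the projection is onto with the right
  kernel.\<close>

lemma presented_group_iso:
  fixes B :: "'a set"
  defines "F \<equiv> free_group B"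
  assumes f: "group_hom F F f" and g: "group_hom F F g"
    and fg: "\<And>w. w \<in> carrier F \<Longrightarrow> f (g w) = w" and gf: "\<And>w. w \<in> carrier F \<Longrightarrow> g (f w) = w"
    and R: "R \<subseteq> carrier F" "f ` R \<subseteq> normal_closure F R'"
    and R': "R' \<subseteq> carrier F" "g ` R' \<subseteq> normal_closure F R"
  shows "presented_group B R \<cong> presented_group B R'"
proof -
  interpret F: group F unfolding F_def by (rule group_free_group)
  interpret f: group_hom F F f by (rule f)
  interpret g: group_hom F F g by (rule g)
  let ?N = "normal_closure F R" and ?N' = "normal_closure F R'"
  have N: "?N \<lhd> F" and N': "?N' \<lhd> F" using R R' by (simp_all add: F.normal_closure_normal)
  have "?N \<subseteq> {w \<in> carrier F. f w \<in> ?N'}"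
    using R by (intro normal_closure_least[OF normal_vimage[OF f N']]) auto
  moreover have "?N' \<subseteq> {w \<in> carrier F. g w \<in> ?N}"
    using R' by (intro normal_closure_least[OF normal_vimage[OF g N]]) auto
  ultimately have mem: "f w \<in> ?N' \<longleftrightarrow> w \<in> ?N" if "w \<in> carrier F" for w
    using gf[OF that] by (metis (no_types, lifting) mem_Collect_eq subsetD)
  have p: "group_hom F (F Mod ?N') (\<lambda>w. ?N' #>\<^bsub>F\<^esub> w)"
    using normal.r_coset_hom_Mod[OF N'] normal.factorgroup_is_group[OF N']
    by (simp add: group_hom_def group_hom_axioms_def F.is_group)
  have fp: "group_hom F (F Mod ?N') (\<lambda>w. ?N' #>\<^bsub>F\<^esub> f w)"
    by (rule group_hom_comp[OF f p])
  have surj: "(\<lambda>w. ?N' #>\<^bsub>F\<^esub> f w) ` carrier F = carrier (F Mod ?N')"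
  proof -
    have "f ` carrier F = carrier F" using f.hom_closed fg g.hom_closed by (metis (no_types, lifting) image_eqI image_subsetI subsetI subset_antisym)
    then show ?thesis by (metis carrier_FactGroup image_image)
  qed
  have "kernel F (F Mod ?N') (\<lambda>w. ?N' #>\<^bsub>F\<^esub> f w) = ?N"
  proof -
    have "?N' #>\<^bsub>F\<^esub> w = ?N' \<longleftrightarrow> w \<in> ?N'" if "w \<in> carrier F" for w
      using that F.coset_join1[of ?N' w] F.coset_join2[of w ?N'] N' by (auto simp: normal_def)
    then have iff: "?N' #>\<^bsub>F\<^esub> f w = ?N' \<longleftrightarrow> w \<in> ?N" if "w \<in> carrier F" for w
      using mem[OF that] f.hom_closed[OF that] by simp
    show ?thesis
      unfolding kernel_def one_FactGroup
      using iff subgroup.subset[OF normal_imp_subgroup[OF N]] by blast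
  qed
  then have "\<exists>h. h \<in> iso (F Mod ?N) (F Mod ?N')"
    using FactGroup_iso_set_apply[OF fp surj _ F.one_closed] by blast
  then show ?thesis by (auto simp: is_iso_def presented_group_def F_def)
qed

context surface_presentation
begin

lemma \<psi>_surjE:
  assumes "p \<in> carrier T"
  obtains w where "w \<in> carrier F" "\<psi> w = p"
proof -
  have "p \<in> \<psi> ` carrier F" unfolding \<psi>_surj by (rule assms)
  then show ?thesis by (rule imageE) (use that in simp)
qed

text \<open>The elements c and q record that r' is conjugate in F to an element of the image of
  \<open>s\<close>, in both alternatives. This is the form in which its logarithm can be
  computed.\<close>

lemma ex_relator_in_normal_form:
  assumes \<rho>: "\<rho> \<in> carrier F" and sums: "ysum \<rho> = 0" "xsum \<rho> \<ge> 0"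
  obtains w r' c q where "w \<in> carrier F" "r' \<in> carrier F"
    "\<psi> r' = \<psi> (w \<otimes>\<^bsub>F\<^esub> \<rho> \<otimes>\<^bsub>F\<^esub> inv\<^bsub>F\<^esub> w)"
    "(\<exists>n::nat. r' = x\<^sub>F [^]\<^bsub>F\<^esub> n) \<or> hempel_relator d u r'"
    "c \<in> carrier K" "q \<in> carrier F" "r' = q \<otimes>\<^bsub>F\<^esub> s c \<otimes>\<^bsub>F\<^esub> inv\<^bsub>F\<^esub> q"
proof -
  interpret xs: group_hom F integer_group xsum by (rule xsum_hom_F)
  obtain b where \<psi>\<rho>: "\<psi> \<rho> = (b, 0)" and b: "b \<in> carrier K"
    using ysum_eq[OF \<rho>] sums \<psi>.hom_closed[OF \<rho>] by (cases "\<psi> \<rho>") auto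
  obtain b' p where b': "normal_form b'" and p: "p \<in> carrier T" "p \<otimes>\<^bsub>T\<^esub> (b, 0) \<otimes>\<^bsub>T\<^esub> inv\<^bsub>T\<^esub> p = (b', 0)"
    using torus_conj_normal_form[OF b] unfolding torus_conj_def by blast
  obtain w where w: "w \<in> carrier F" "\<psi> w = p" by (rule \<psi>_surjE[OF p(1)])
  define \<rho>' where "\<rho>' = w \<otimes>\<^bsub>F\<^esub> \<rho> \<otimes>\<^bsub>F\<^esub> inv\<^bsub>F\<^esub> w"
  have \<rho>': "\<rho>' \<in> carrier F" "\<psi> \<rho>' = (b', 0)"
    using w \<rho> p(2) \<psi>\<rho> by (simp_all add: \<rho>'_def)
  from b' consider n :: int where "b' = x0 [^]\<^bsub>K\<^esub> n" | "hempel_form b'"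
    unfolding normal_form_def by blast
  then show ?thesis
  proof cases
    case (1 n)
    interpret e: group_hom K T "\<lambda>a. (a, 0)" by (rule mapping_torus_embed)
    let ?r = "x\<^sub>F [^]\<^bsub>F\<^esub> n"
    have eq: "\<psi> ?r = \<psi> \<rho>'"
      using \<psi>.hom_int_pow[OF x_closed, of n] e.hom_int_pow[of x0 n] 1 \<rho>'(2) by simp
    then have "?r \<otimes>\<^bsub>F\<^esub> inv\<^bsub>F\<^esub> \<rho>' \<in> kernel F T \<psi>"
      using \<rho>'(1) \<psi>.hom_closed[OF \<rho>'(1)] by (simp add: kernel_def del: carrier_mapping_torus)
    \<comment> \<open>The two elements have the same image in \<open>T\<close>, so they differ by an
      element of \<open>N\<close>, where \<open>xsum\<close> vanishes. This makes n the exponent sum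
      of x in \<rho>.\<close>
    then have "xsum (?r \<otimes>\<^bsub>F\<^esub> inv\<^bsub>F\<^esub> \<rho>') = 0" using xsum_N kernel_\<psi> by blast
    then have "xsum ?r = xsum \<rho>'" using \<rho>'(1) by simp
    moreover have "xsum ?r = n" using xs.hom_int_pow[OF x_closed, of n] by simp
    moreover have "xsum \<rho>' = xsum \<rho>" using w(1) \<rho> by (simp add: \<rho>'_def)
    ultimately have "n \<ge> 0" using sums(2) by simp
    then have "?r = x\<^sub>F [^]\<^bsub>F\<^esub> nat n" by simp
    then have "(\<exists>n::nat. ?r = x\<^sub>F [^]\<^bsub>F\<^esub> n) \<or> hempel_relator d u ?r" by blast
    then show ?thesis
      using that[OF w(1) _ eq[unfolded \<rho>'_def] _ _ _ x_pow_eq_conj_section[of n]] by simp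
  next
    case 2
    then have b'K: "b' \<in> carrier K" using KI_closed unfolding hempel_form_def by blast
    show ?thesis
    proof (rule that[of w "s b'" b' "\<one>\<^bsub>F\<^esub>"])
      show "\<psi> (s b') = \<psi> (w \<otimes>\<^bsub>F\<^esub> \<rho> \<otimes>\<^bsub>F\<^esub> inv\<^bsub>F\<^esub> w)"
        using \<rho>'(2) \<psi>_s[OF b'K] by (simp add: \<rho>'_def)
      show "(\<exists>n::nat. s b' = x\<^sub>F [^]\<^bsub>F\<^esub> n) \<or> hempel_relator d u (s b')"
        using hempel_relator_section[OF 2] by blast
      show "s b' = \<one>\<^bsub>F\<^esub> \<otimes>\<^bsub>F\<^esub> s b' \<otimes>\<^bsub>F\<^esub> inv\<^bsub>F\<^esub> \<one>\<^bsub>F\<^esub>" using b'K by simp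
    qed (use w b'K in simp_all)
  qed
qed

text \<open>Any homomorphism \<theta> onto \<open>T\<close> with kernel \<open>N\<close> identifies
  S with \<open>T\<close>. Taking for \<theta> a version of \<open>\<psi>\<close> twisted by
  \<alpha> and w sends r directly to \<open>\<psi> r'\<close>, so the invariance of the logarithm
  under \<alpha> and conjugation needs no separate argument.\<close>

lemma group_log_relator:
  assumes c: "c \<in> carrier K" and q: "q \<in> carrier F" and r': "r' = q \<otimes>\<^bsub>F\<^esub> s c \<otimes>\<^bsub>F\<^esub> inv\<^bsub>F\<^esub> q"
    and \<theta>: "group_hom F T \<theta>" "\<theta> ` carrier F = carrier T" "kernel F T \<theta> = N"
    and r: "r \<in> carrier F" "\<theta> r = \<psi> r'"
  shows "group_log F r' = group_log Q (\<pi> r)"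
proof (cases "c = []")
  case True
  then have "r' = \<one>\<^bsub>F\<^esub>" using q s.hom_one by (simp add: r' del: s.hom_one)
  then have "r \<in> N" using r \<psi>.hom_one unfolding \<theta>(3)[symmetric] by (simp add: kernel_def)
  then have "\<pi> r = \<one>\<^bsub>Q\<^esub>" using \<pi>_eq_one[OF r(1)] by simp
  then show ?thesis using \<open>r' = \<one>\<^bsub>F\<^esub>\<close> by (simp add: group_log_def)
next
  case False
  obtain C n where "max_root T (\<psi> r') C n" "group_log F r' = enat n"
    using group_log_conj_section[OF c False q] r' by blast
  moreover obtain h where h: "h \<in> iso Q T" "h (\<pi> r) = \<theta> r"
    using FactGroup_iso_set_apply[OF \<theta> r(1)] by blast
  moreover have "\<pi> r \<in> carrier Q" using group_hom.hom_closed[OF \<pi>_hom r(1)] .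
  ultimately show ?thesis
    using group_log_iso[OF h(1) group_Q group_mapping_torus] r(2) by simp
qed

end

theorem lemma5p4:
  fixes d :: nat and u r :: "gen letter list"
  assumes "r \<in> carrier (freeF d)"
    and "u \<in> generate (freeF d) (z\<^sub>F ` {1..d})"
  shows "\<exists>w \<in> carrier (freeF d).
         \<exists>v \<in> normal_closure (freeF d) {surface_relator d u}.
         \<exists>\<alpha> \<in> auto freeFxy.
           \<alpha> (commutator freeFxy x\<^sub>F y\<^sub>F) = commutator freeFxy x\<^sub>F y\<^sub>F \<and>
           (let r' = v \<otimes>\<^bsub>freeF d\<^esub> (w \<otimes>\<^bsub>freeF d\<^esub> extend_to_F d \<alpha> r \<otimes>\<^bsub>freeF d\<^esub> inv\<^bsub>freeF d\<^esub> w) in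
             ((\<exists>n::nat. r' = x\<^sub>F [^]\<^bsub>freeF d\<^esub> n) \<or> hempel_relator d u r') \<and>
             presented_group (gens d) {surface_relator d u, r}
               \<cong> presented_group (gens d) {surface_relator d u, r'} \<and>
             group_log (freeF d) r' =
               group_log (presented_group (gens d) {surface_relator d u})
                 (image_in_presented (gens d) {surface_relator d u} r))"
proof -
  interpret surface_presentation d u by unfold_locales (rule assms(2))
  have r: "r \<in> carrier F" by (rule assms(1))
  obtain \<alpha> where \<alpha>: "\<alpha> \<in> commutator_autos"
    and sums: "ysum (extend_to_F d \<alpha> r) = 0" "xsum (extend_to_F d \<alpha> r) \<ge> 0"
    using ex_auto_sums[OF r] by blast
  obtain \<beta> where \<beta>: "\<beta> \<in> commutator_autos"
    and inverse: "\<And>w. w \<in> carrier F \<Longrightarrow> extend_to_F d \<alpha> (extend_to_F d \<beta> w) = w"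
      "\<And>w. w \<in> carrier F \<Longrightarrow> extend_to_F d \<beta> (extend_to_F d \<alpha> w) = w"
    using extend_to_F_inverse[OF \<alpha>] by blast
  let ?f = "extend_to_F d \<alpha>" and ?g = "extend_to_F d \<beta>"
  interpret f: group_hom F F ?f by (rule extend_to_F_hom[OF commutator_autosD(1)[OF \<alpha>]])
  interpret g: group_hom F F ?g by (rule extend_to_F_hom[OF commutator_autosD(1)[OF \<beta>]])
  have fr: "?f r \<in> carrier F" using r by simp
  obtain w r' c q where w: "w \<in> carrier F" and r': "r' \<in> carrier F"
    and \<psi>r': "\<psi> r' = \<psi> (w \<otimes>\<^bsub>F\<^esub> ?f r \<otimes>\<^bsub>F\<^esub> inv\<^bsub>F\<^esub> w)"
    and form: "(\<exists>n::nat. r' = x\<^sub>F [^]\<^bsub>F\<^esub> n) \<or> hempel_relator d u r'"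
    and c: "c \<in> carrier K" "q \<in> carrier F" "r' = q \<otimes>\<^bsub>F\<^esub> s c \<otimes>\<^bsub>F\<^esub> inv\<^bsub>F\<^esub> q"
    by (rule ex_relator_in_normal_form[OF fr sums])
  define \<rho>' where "\<rho>' = w \<otimes>\<^bsub>F\<^esub> ?f r \<otimes>\<^bsub>F\<^esub> inv\<^bsub>F\<^esub> w"
  have \<rho>': "\<rho>' \<in> carrier F" using w fr by (simp add: \<rho>'_def)
  \<comment> \<open>The only choice compatible with r' = v \<rho>'; it lies in \<open>N\<close>
    since r' and \<rho>' have the same image under \<open>\<psi>\<close>.\<close>
  define v where "v = r' \<otimes>\<^bsub>F\<^esub> inv\<^bsub>F\<^esub> \<rho>'"
  have "v \<in> kernel F T \<psi>"
    using \<rho>' r' \<psi>r' \<psi>.hom_closed[OF \<rho>'] unfolding \<rho>'_def[symmetric]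
    by (simp add: kernel_def v_def del: carrier_mapping_torus)
  then have v: "v \<in> N" by (simp add: kernel_\<psi>)
  have r'_eq: "r' = v \<otimes>\<^bsub>F\<^esub> \<rho>'" using r' \<rho>' by (simp add: v_def F.m_assoc)

  have N_mono: "v \<in> normal_closure F {rel, a}" if "v \<in> N" for v a
    using that unfolding normal_closure_def by auto
  have in_closure: "rel \<in> normal_closure F {rel, a}" "a \<in> normal_closure F {rel, a}" for a
    by (auto simp: normal_closure_def)
  \<comment> \<open>The extended automorphisms fix the relator, so the preimage of \<open>N\<close>
    is a normal subgroup that contains it.\<close>
  have preserve: "extend_to_F d \<gamma> a \<in> N" if "\<gamma> \<in> commutator_autos" "a \<in> N" for \<gamma> a
  proof -
    have "N \<subseteq> {a \<in> carrier F. extend_to_F d \<gamma> a \<in> N}"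
    proof (rule normal_closure_least)
      show "{a \<in> carrier F. extend_to_F d \<gamma> a \<in> N} \<lhd> F"
        by (rule normal_vimage[OF extend_to_F_hom[OF commutator_autosD(1)[OF that(1)]] N_normal])
      show "{rel} \<subseteq> {a \<in> carrier F. extend_to_F d \<gamma> a \<in> N}"
        using extend_to_F_rel[OF that(1)] subset_normal_closure[of "{rel}" F] by simp
    qed
    then show ?thesis using that(2) by blast
  qed

  have "presented_group (gens d) {rel, r} \<cong> presented_group (gens d) {rel, r'}"
  proof (rule presented_group_iso[where B = "gens d" and f = ?f and g = ?g, folded F_free])
    let ?N1 = "normal_closure F {rel, r}" and ?N2 = "normal_closure F {rel, r'}"
    have N1: "?N1 \<lhd> F" and N2: "?N2 \<lhd> F" using r r' by (simp_all add: F.normal_closure_normal)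
    have sg1: "subgroup ?N1 F" and sg2: "subgroup ?N2 F"
      using N1 N2 by (simp_all add: normal_imp_subgroup)
    have "v \<in> ?N2" "v \<in> carrier F" using N_mono[OF v] subgroup.mem_carrier[OF normal_imp_subgroup[OF N_normal] v] by auto
    then have "inv\<^bsub>F\<^esub> v \<otimes>\<^bsub>F\<^esub> r' \<in> ?N2"
      using in_closure(2)[of r'] sg2 by (simp add: subgroup.m_closed subgroup.m_inv_closed)
    then have "\<rho>' \<in> ?N2" using r'_eq \<rho>' \<open>v \<in> carrier F\<close> by (simp add: F.cancel_left_inv)
    then have "inv\<^bsub>F\<^esub> w \<otimes>\<^bsub>F\<^esub> \<rho>' \<otimes>\<^bsub>F\<^esub> inv\<^bsub>F\<^esub> (inv\<^bsub>F\<^esub> w) \<in> ?N2"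
      using N2 w unfolding F.normal_inv_iff by blast
    then have "?f r \<in> ?N2"
      using w fr by (simp add: \<rho>'_def F.m_assoc F.cancel_left_inv)
    then show "?f ` {rel, r} \<subseteq> ?N2"
      using in_closure extend_to_F_rel[OF \<alpha>] by simp
    have gv: "?g v \<in> ?N1" using preserve[OF \<beta> v] N_mono by blast
    have "?g \<rho>' = ?g w \<otimes>\<^bsub>F\<^esub> r \<otimes>\<^bsub>F\<^esub> inv\<^bsub>F\<^esub> ?g w"
      using w fr inverse(2)[OF r] by (simp add: \<rho>'_def)
    then have "?g \<rho>' \<in> ?N1"
      using N1 in_closure(2)[of r] g.hom_closed[OF w] unfolding F.normal_inv_iff by simp
    then have "?g r' \<in> ?N1"
      using gv \<rho>' \<open>v \<in> carrier F\<close> sg1 by (simp add: r'_eq subgroup.m_closed)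
    then show "?g ` {rel, r'} \<subseteq> ?N1"
      using in_closure extend_to_F_rel[OF \<beta>] by simp
  qed (use f.group_hom_axioms g.group_hom_axioms inverse r r' in simp_all)

  moreover have "group_log F r' = group_log Q (\<pi> r)"
  proof (rule group_log_relator[OF c])
    define \<theta> where "\<theta> = (\<lambda>a. \<psi> (w \<otimes>\<^bsub>F\<^esub> ?f a \<otimes>\<^bsub>F\<^esub> inv\<^bsub>F\<^esub> w))"
    have conj: "group_hom F F (\<lambda>a. w \<otimes>\<^bsub>F\<^esub> a \<otimes>\<^bsub>F\<^esub> inv\<^bsub>F\<^esub> w)"
      using F.conj_hom[OF w] by (simp add: group_hom_def group_hom_axioms_def group_freeF)
    show \<theta>: "group_hom F T \<theta>"
      unfolding \<theta>_def
      using group_hom_comp[OF group_hom_comp[OF f.group_hom_axioms conj] \<psi>.group_hom_axioms] .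
    show "\<theta> ` carrier F = carrier T"
    proof
      show "\<theta> ` carrier F \<subseteq> carrier T"
        using group_hom.hom_closed[OF \<theta>] by blast
      show "carrier T \<subseteq> \<theta> ` carrier F"
      proof
        fix p assume "p \<in> carrier T"
        then obtain a where a: "a \<in> carrier F" "\<psi> a = p" by (rule \<psi>_surjE)
        \<comment> \<open>The preimage under \<theta>: undo the conjugation by w, then undo \<alpha>
          by means of \<beta>.\<close>
        let ?a = "?g (inv\<^bsub>F\<^esub> w \<otimes>\<^bsub>F\<^esub> a \<otimes>\<^bsub>F\<^esub> w)"
        have "?f ?a = inv\<^bsub>F\<^esub> w \<otimes>\<^bsub>F\<^esub> a \<otimes>\<^bsub>F\<^esub> w"
          using inverse(1)[of "inv\<^bsub>F\<^esub> w \<otimes>\<^bsub>F\<^esub> a \<otimes>\<^bsub>F\<^esub> w"] w a(1) by blast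
        then have "\<theta> ?a = \<psi> (w \<otimes>\<^bsub>F\<^esub> (inv\<^bsub>F\<^esub> w \<otimes>\<^bsub>F\<^esub> a \<otimes>\<^bsub>F\<^esub> w) \<otimes>\<^bsub>F\<^esub> inv\<^bsub>F\<^esub> w)"
          by (simp add: \<theta>_def)
        also have "w \<otimes>\<^bsub>F\<^esub> (inv\<^bsub>F\<^esub> w \<otimes>\<^bsub>F\<^esub> a \<otimes>\<^bsub>F\<^esub> w) \<otimes>\<^bsub>F\<^esub> inv\<^bsub>F\<^esub> w = a"
          using w a(1) by (simp add: F.m_assoc F.cancel_left_inv)
        finally have "\<theta> ?a = p" using a(2) by simp
        moreover have "?a \<in> carrier F" using w a(1) by simp
        ultimately show "p \<in> \<theta> ` carrier F" by blast
      qed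
    qed
    show "kernel F T \<theta> = N"
    proof -
      have "\<theta> a = \<one>\<^bsub>T\<^esub> \<longleftrightarrow> a \<in> N" if a: "a \<in> carrier F" for a
      proof -
        have conj_N: "w \<otimes>\<^bsub>F\<^esub> b \<otimes>\<^bsub>F\<^esub> inv\<^bsub>F\<^esub> w \<in> N" if "w \<in> carrier F" "b \<in> N" for w b
          using N_normal that unfolding F.normal_inv_iff by blast
        have fa: "?f a \<in> carrier F" using a by simp
        have "\<theta> a = \<one>\<^bsub>T\<^esub> \<longleftrightarrow> w \<otimes>\<^bsub>F\<^esub> ?f a \<otimes>\<^bsub>F\<^esub> inv\<^bsub>F\<^esub> w \<in> kernel F T \<psi>"
          unfolding \<theta>_def kernel_def using w fa by blast
        also have "\<dots> \<longleftrightarrow> ?f a \<in> N"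
        proof
          assume "w \<otimes>\<^bsub>F\<^esub> ?f a \<otimes>\<^bsub>F\<^esub> inv\<^bsub>F\<^esub> w \<in> kernel F T \<psi>"
          then have "inv\<^bsub>F\<^esub> w \<otimes>\<^bsub>F\<^esub> (w \<otimes>\<^bsub>F\<^esub> ?f a \<otimes>\<^bsub>F\<^esub> inv\<^bsub>F\<^esub> w) \<otimes>\<^bsub>F\<^esub> inv\<^bsub>F\<^esub> (inv\<^bsub>F\<^esub> w) \<in> N"
            unfolding kernel_\<psi> by (rule conj_N[OF F.inv_closed[OF w]])
          then show "?f a \<in> N" using w fa by (simp add: F.m_assoc F.cancel_left_inv)
        next
          assume "?f a \<in> N"
          then show "w \<otimes>\<^bsub>F\<^esub> ?f a \<otimes>\<^bsub>F\<^esub> inv\<^bsub>F\<^esub> w \<in> kernel F T \<psi>"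
            unfolding kernel_\<psi> by (rule conj_N[OF w])
        qed
        also have "\<dots> \<longleftrightarrow> a \<in> N"
          using preserve[OF \<alpha>] preserve[OF \<beta>] inverse(2)[OF a] by metis
        finally show ?thesis .
      qed
      then show ?thesis
        using subgroup.subset[OF normal_imp_subgroup[OF N_normal]] by (auto simp: kernel_def)
    qed
    show "\<theta> r = \<psi> r'" using \<psi>r' by (simp add: \<theta>_def)
  qed (rule r)
  moreover have "Q = presented_group (gens d) {rel}" "\<pi> r = image_in_presented (gens d) {rel} r"
    by (simp_all add: presented_group_def image_in_presented_def freeF_def)
  ultimately have "\<alpha> (commutator freeFxy x\<^sub>F y\<^sub>F) = commutator freeFxy x\<^sub>F y\<^sub>F \<and>
    (let r' = v \<otimes>\<^bsub>F\<^esub> (w \<otimes>\<^bsub>F\<^esub> ?f r \<otimes>\<^bsub>F\<^esub> inv\<^bsub>F\<^esub> w) in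
      ((\<exists>n::nat. r' = x\<^sub>F [^]\<^bsub>F\<^esub> n) \<or> hempel_relator d u r') \<and>
      presented_group (gens d) {rel, r} \<cong> presented_group (gens d) {rel, r'} \<and>
      group_log F r' = group_log (presented_group (gens d) {rel}) (image_in_presented (gens d) {rel} r))"
    using form commutator_autosD(2)[OF \<alpha>] unfolding Let_def \<rho>'_def[symmetric] r'_eq[symmetric] by simp
  then show ?thesis using w v commutator_autosD(1)[OF \<alpha>] by blast
qed

end
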